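(* Fix $\theta\in(0,1)$, an integer $n\ge 3$, integers $\alpha_0,\dots,\alpha_n$ with $\alpha_n\neq 0$, and positive coprime integers $p,q$; put $t_r=2\pi p/q$. Let $u_0\in L^2(0,2\pi)$ and let $u$ be the $L^2$ solution of the quasi-periodic problem (QP) with initial datum $u_0$. Then: (i) If $\theta\in\mathbb{Q}$, then $u(\cdot,t_r)$ is a finite linear combination of translated copies of $u_0$; precisely, there exist $N\in\mathbb{N}$, constants $c_1,\dots,c_N\in\mathbb{C}$ and shifts $\sigma_1,\dots,\sigma_N\in\mathbb{R}$ such that for a.e. $x\in[0,2\pi]$, $u(x,t_r)=e^{i\theta x}\sum_{j=1}^N c_j\, z_0^{*}(x-\sigma_j)$, where $z_0(x)=e^{-i\theta x}u_0(x)$. (ii) If $\theta\notin\mathbb{Q}$ and $u_0$ is of bounded variation on $[0,2\pi]$, then $x\mapsto u(x,t_r)$ (has a representative which) is continuous on $[0,2\pi]$ and satisfies $e^{i2\pi\theta}u(0,t_r)=u(2\pi,t_r)$.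
   Context: Let $P(\lambda)=\sum_{m=0}^n\alpha_m\lambda^m$ with $\alpha_m\in\mathbb{Z}$, $\alpha_n\ne0$. The quasi-periodic problem (QP) on $[0,2\pi]\times[0,\infty)$ is $\partial_t u=-iP(-i\partial_x)u$, $u(x,0)=u_0(x)$, $e^{i2\pi\theta}\partial_x^m u(0,t)=\partial_x^m u(2\pi,t)$ for $m=0,\dots,n-1$. For $u_0\in L^2(0,2\pi)$ its solution is defined by $u(x,t)=\sum_{j\in\mathbb{Z}}\langle u_0,\phi_j\rangle e^{-iP(j+\theta)t}\phi_j(x)$, where $\phi_j(x)=e^{i(j+\theta)x}/\sqrt{2\pi}$ (an orthonormal basis of $L^2(0,2\pi)$) and $\langle f,g\rangle=\int_0^{2\pi}f\bar g\,dx$. For a function $f$ on $[0,2\pi)$, $f^{*}$ denotes its $2\pi$-periodic extension: $f^*(x)=f(x-2\pi m)$ for $2\pi m\le x<2\pi(m+1)$, $m\in\mathbb{Z}$. *)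

theory Defs
  imports "HOL-Analysis.Analysis"
begin

definition bounded_variation_on :: "(real \<Rightarrow> complex) \<Rightarrow> real \<Rightarrow> real \<Rightarrow> bool" where
  "bounded_variation_on f a b \<longleftrightarrow>
     (\<exists>B. \<forall>(m::nat) (xs::nat \<Rightarrow> real).
        (\<forall>k\<le>m. a \<le> xs k \<and> xs k \<le> b) \<and> (\<forall>k<m. xs k \<le> xs (Suc k)) \<longrightarrow>
        (\<Sum>k<m. cmod (f (xs (Suc k)) - f (xs k))) \<le> B)"

definition L2_0_2pi :: "(real \<Rightarrow> complex) \<Rightarrow> bool" where
  "L2_0_2pi f \<longleftrightarrow> set_borel_measurable lborel {0..2*pi} f \<and>
     set_integrable lborel {0..2*pi} (\<lambda>x. (cmod (f x))\<^sup>2)"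

definition phi :: "real \<Rightarrow> int \<Rightarrow> real \<Rightarrow> complex" where
  "phi \<theta> j x = exp (\<i> * complex_of_real ((real_of_int j + \<theta>) * x)) / complex_of_real (sqrt (2*pi))"

definition inner_L2 :: "(real \<Rightarrow> complex) \<Rightarrow> (real \<Rightarrow> complex) \<Rightarrow> complex" where
  "inner_L2 f g = (LINT x:{0..2*pi}|lborel. f x * cnj (g x))"

definition Psym :: "(nat \<Rightarrow> int) \<Rightarrow> nat \<Rightarrow> real \<Rightarrow> real" where
  "Psym \<alpha> n s = (\<Sum>m\<le>n. real_of_int (\<alpha> m) * s ^ m)"

definition QP_partial :: "(nat \<Rightarrow> int) \<Rightarrow> nat \<Rightarrow> real \<Rightarrow> (real \<Rightarrow> complex) \<Rightarrow> real \<Rightarrow> nat \<Rightarrow> real \<Rightarrow> complex" where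
  "QP_partial \<alpha> n \<theta> u0 t N x =
     (\<Sum>j\<in>{- int N..int N}. inner_L2 u0 (phi \<theta> j)
        * exp (- \<i> * complex_of_real (Psym \<alpha> n (real_of_int j + \<theta>) * t)) * phi \<theta> j x)"

text \<open>v is (a representative of) the L^2 solution u(.,t) of (QP) with datum u0:
  the series converges to v in L^2(0,2pi).\<close>
definition QP_solution_at :: "(nat \<Rightarrow> int) \<Rightarrow> nat \<Rightarrow> real \<Rightarrow> (real \<Rightarrow> complex) \<Rightarrow> real \<Rightarrow> (real \<Rightarrow> complex) \<Rightarrow> bool" where
  "QP_solution_at \<alpha> n \<theta> u0 t v \<longleftrightarrow> L2_0_2pi v \<and>
     (\<lambda>N. LINT x:{0..2*pi}|lborel. (cmod (QP_partial \<alpha> n \<theta> u0 t N x - v x))\<^sup>2) \<longlonglongrightarrow> 0"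

definition per_ext :: "(real \<Rightarrow> complex) \<Rightarrow> real \<Rightarrow> complex" where
  "per_ext f x = f (x - 2*pi * of_int \<lfloor>x / (2*pi)\<rfloor>)"

end

(*
  Write e(t) = exp(2 pi i t).  At time 2 pi p/q the j-th Fourier coefficient of z0 = e^(-i theta x) u0 is
  multiplied by mu_j = e(-P(j + theta) p/q).

  If theta is rational, mu is periodic in j, and the discrete Fourier transform writes the multiplier as a
  finite combination of translations; an integrable function is determined by its Fourier coefficients.

  If theta is irrational, the multiplier maps z0 to the convolution of its derivative, a finite measure, with the
  kernel sum mu_j e^(ijx) / j, so it suffices that the symmetric partial sums of this kernel over dyadic
  ranges converge uniformly in x.  Modulo 1 the phase has degree n - 1 >= 2 on progressions modulo q, with leading
  coefficient a rational multiple of theta.  By an inverse form of Weyl's inequality a dyadic block 2^k saves a power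
  of 2^k unless theta is extremely close to a fraction a/b with b at most a small power of 2^k.  The scales k
  with the same a/b form an interval.  On it the phase is a periodic one, whose Fourier coefficients are
  at most a negative power of b (complete sums, again by Weyl), plus a slowly varying polynomial R, and the sums
  of e(R(j) + jy)/j over symmetric ranges are bounded: by the cancellation between j and -j as long as R is
  bounded, and by the second derivative test beyond.  Distinct fractions have their first scale at distinct k, so these
  contributions are summable.
*)

theory Submission
  imports Defs
begin

section \<open>Exponential sums with monotone differences\<close>

text \<open>No Diophantine condition on \<open>\<theta>\<close> is available: it may stay close to
  one fraction over arbitrarily many scales, and bounding those blocks singly would cost a constant
  per block. A whole run must therefore cost only a constant times a negative power of b. The first
  scale that admits the denominator b is about 4 n log2 b, which makes this power geometric in the
  scale. The exponents in \<open>well_approx\<close> balance two demands. For a block of length N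
  the inverse Weyl inequality gives |theta - a/b| below N^(1-n), up to a small power of N; the slope
  of R, about |theta - a/b| N^(n-2), must stay below a constant over the period q b^n of the
  periodic phase. The exponent n - 3/2 lies between n - 2 and n - 1 and leaves N^(1/2) to pay for
  powers of b. Exponents of T are never tracked, since polynomial dependence suffices. Bounded
  variation enters only as an L^1 modulus of continuity O(h), so that difference quotients replace
  the derivative measure. Sums up to powers of 2 are enough because a subsequence identifies the L^2
  limit.\<close>

definition ee :: "real \<Rightarrow> complex" where
  "ee t = cis (2 * pi * t)"

lemma norm_ee [simp]: "cmod (ee t) = 1"
  by (simp add: ee_def)

lemma ee_add: "ee (s + t) = ee s * ee t"
  by (simp add: ee_def cis_mult distrib_left)

lemma ee_minus: "ee (- t) = cnj (ee t)"
  by (simp add: ee_def cis_cnj)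

lemma ee_diff: "ee (s - t) = ee s * cnj (ee t)"
  by (simp add: ee_add[of s "-t", simplified] ee_minus)

lemma ee_0 [simp]: "ee 0 = 1"
  by (simp add: ee_def)

lemma ee_int: "t \<in> \<int> \<Longrightarrow> ee t = 1"
  by (auto simp: ee_def complex_eq_iff elim!: Ints_cases)

lemma ee_cong: "s - t \<in> \<int> \<Longrightarrow> ee s = ee t"
  using ee_add[of "s - t" t] ee_int[of "s - t"] by simp

lemma norm_ee_diff_one: "cmod (ee t - 1) = 2 * \<bar>sin (pi * t)\<bar>"
proof -
  have c: "cos (2 * pi * t) = 1 - 2 * (sin (pi * t))\<^sup>2"
    using cos_double_sin[of "pi * t"] by (simp add: mult.assoc)
  have s: "sin (2 * pi * t) = 2 * sin (pi * t) * cos (pi * t)"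
    using sin_double[of "pi * t"] by (simp add: mult.assoc)
  have "(cmod (ee t - 1))\<^sup>2 = (cos (2 * pi * t) - 1)\<^sup>2 + (sin (2 * pi * t))\<^sup>2"
    by (simp add: ee_def cmod_power2)
  also have "\<dots> = 4 * (sin (pi * t))\<^sup>2 * ((sin (pi * t))\<^sup>2 + (cos (pi * t))\<^sup>2)"
    unfolding c s by algebra
  also have "\<dots> = (2 * \<bar>sin (pi * t)\<bar>)\<^sup>2"
    by (simp add: power_mult_distrib)
  finally show ?thesis
    by (rule power2_eq_imp_eq) auto
qed

lemma norm_ee_diff_le: "cmod (ee s - ee t) \<le> 2 * pi * \<bar>s - t\<bar>"
proof -
  have "ee s - ee t = ee t * (ee (s - t) - 1)"
    using ee_add[of t "s - t"] by (simp add: algebra_simps)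
  then have "cmod (ee s - ee t) = cmod (ee (s - t) - 1)"
    by (simp add: norm_mult)
  also have "\<dots> \<le> 2 * pi * \<bar>s - t\<bar>"
    using abs_sin_x_le_abs_x[of "pi * (s - t)"] by (simp add: norm_ee_diff_one abs_mult)
  finally show ?thesis .
qed

text \<open>Jordan's inequality: a concave function lies above its chord, here the one from 0 to
  \<open>pi / 2\<close>.\<close>

lemma sin_pi_ge_two:
  assumes "0 \<le> t" "t \<le> 1/2"
  shows "2 * t \<le> sin (pi * t)"
proof -
  have "concave_on {0..pi} sin"
    by (rule f''_le0_imp_concave[where f' = cos and f'' = "\<lambda>x. - sin x"])
       (auto intro!: derivative_eq_intros sin_ge_zero)
  from concave_onD[OF this, of "2 * t" 0 "pi / 2"] show ?thesis
    using assms by (simp add: mult.commute)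
qed

lemma sin_pi_ge:
  assumes "0 < l" "l \<le> t" "t \<le> 1 - l"
  shows "2 * l \<le> sin (pi * t)"
proof (cases "t \<le> 1/2")
  case True
  then show ?thesis using sin_pi_ge_two[of t] assms by simp
next
  case False
  have "sin (pi * t) = sin (pi * (1 - t))"
    by (simp add: algebra_simps sin_diff)
  then show ?thesis using sin_pi_ge_two[of "1 - t"] assms False by simp
qed

lemma sum_by_parts:
  fixes w :: "nat \<Rightarrow> 'a::comm_ring_1"
  shows "(\<Sum>j<Suc m. w j * z j) =
    w m * (\<Sum>j<Suc m. z j) - (\<Sum>j<m. (w (Suc j) - w j) * (\<Sum>i<Suc j. z i))"
  by (induction m) (simp_all add: algebra_simps)

text \<open>Abel summation: the weights decrease, so their variation telescopes to
  \<open>w 0 - w n\<close> and adds up with the boundary term \<open>w n\<close> to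
  \<open>w 0\<close>.\<close>

lemma norm_sum_antimono_le:
  fixes w :: "nat \<Rightarrow> real" and z :: "nat \<Rightarrow> complex"
  assumes w: "\<And>j. w (Suc j) \<le> w j" "\<And>j. 0 \<le> w j"
    and z: "\<And>k. k \<le> m \<Longrightarrow> cmod (\<Sum>j<k. z j) \<le> B"
  shows "cmod (\<Sum>j<m. of_real (w j) * z j) \<le> w 0 * B"
proof (cases m)
  case 0
  then show ?thesis using z[of 0] w(2)[of 0] by simp
next
  case (Suc n)
  have "cmod (\<Sum>j<m. of_real (w j) * z j) \<le>
      cmod (of_real (w n) * (\<Sum>j<Suc n. z j)) +
      cmod (\<Sum>j<n. (of_real (w (Suc j)) - of_real (w j)) * (\<Sum>i<Suc j. z i))"
    unfolding Suc sum_by_parts by (rule norm_triangle_ineq4)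
  also have "\<dots> \<le> w n * B + (\<Sum>j<n. (w j - w (Suc j)) * B)"
  proof (intro add_mono order.trans[OF norm_sum] sum_mono)
    show "cmod (of_real (w n) * (\<Sum>j<Suc n. z j)) \<le> w n * B"
      unfolding norm_mult using z[of "Suc n"] w(2)[of n] Suc
      by (intro mult_mono) auto
    fix j assume "j \<in> {..<n}"
    then show "cmod ((of_real (w (Suc j)) - of_real (w j)) * (\<Sum>i<Suc j. z i)) \<le> (w j - w (Suc j)) * B"
      unfolding norm_mult of_real_diff[symmetric] norm_of_real using z[of "Suc j"] w(1)[of j] Suc
      by (intro mult_mono) auto
  qed
  also have "(\<Sum>j<n. (w j - w (Suc j)) * B) = (w 0 - w n) * B"
    by (simp add: sum_distrib_right[symmetric] sum_lessThan_telescope')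
  finally show ?thesis by (simp add: algebra_simps)
qed

text \<open>The Kusmin-Landau, second difference and Weyl bounds below reach the kernel, with its
  weights \<open>1 / j\<close>, through this lemma; it gains the left end point
  \<open>U\<close>.\<close>

lemma norm_sum_over_le:
  fixes z :: "nat \<Rightarrow> complex"
  assumes z: "\<And>k. k \<le> V \<Longrightarrow> cmod (\<Sum>j\<in>{U<..k}. z j) \<le> B" and "0 < U"
  shows "cmod (\<Sum>j\<in>{U<..V}. z j / of_nat j) \<le> B / U"
proof (cases "U \<le> V")
  case False
  then show ?thesis using z[of 0] by simp
next
  case True
  have eq: "(\<Sum>j\<in>{U<..U + k}. f j) = (\<Sum>j<k. f (Suc (U + j)))" for k and f :: "nat \<Rightarrow> complex"
    by (induction k) (auto simp: atLeastSucAtMost_greaterThanAtMost[symmetric])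
  have B: "0 \<le> B" using z[of 0] by simp
  have "cmod (\<Sum>j<V - U. of_real (1 / real (Suc (U + j))) * z (Suc (U + j))) \<le> 1 / real (Suc (U + 0)) * B"
  proof (rule norm_sum_antimono_le)
    fix k assume "k \<le> V - U"
    then show "cmod (\<Sum>j<k. z (Suc (U + j))) \<le> B"
      using z[of "U + k"] eq[of z k] True by simp
  qed (auto simp: field_simps)
  also have "\<dots> \<le> B / U"
    using B assms(2) by (simp add: frac_le)
  also have "(\<Sum>j<V - U. of_real (1 / real (Suc (U + j))) * z (Suc (U + j))) = (\<Sum>j\<in>{U<..V}. z j / of_nat j)"
    using eq[of "\<lambda>j. z j / of_nat j" "V - U"] True by (simp add: field_simps)
  finally show ?thesis .
qed

section \<open>The Kusmin-Landau inequality\<close>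

lemma inverse_one_minus_ee:
  assumes "sin (pi * t) \<noteq> 0"
  shows "1 / (1 - ee t) = (1 + \<i> * of_real (cot (pi * t))) / 2"
proof -
  let ?s = "complex_of_real (sin (pi * t))" and ?c = "complex_of_real (cos (pi * t))"
  have sc: "?s\<^sup>2 + ?c\<^sup>2 = 1"
    by (metis of_real_add of_real_power of_real_1 sin_cos_squared_add)
  have "ee t = (cis (pi * t))\<^sup>2"
    by (simp add: ee_def power2_eq_square cis_mult mult.assoc)
  also have "cis (pi * t) = ?c + \<i> * ?s"
    by (simp add: complex_eq_iff)
  finally have "1 - ee t = (?s\<^sup>2 + ?c\<^sup>2) - (?c + \<i> * ?s)\<^sup>2"
    by (simp only: sc)
  also have "\<dots> = 2 * ?s * (?s - \<i> * ?c)"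
    by (simp add: power2_eq_square algebra_simps)
  finally have e: "1 - ee t = 2 * ?s * (?s - \<i> * ?c)" .
  have "(?s - \<i> * ?c) * (?s + \<i> * ?c) = 1"
    using sc by (simp add: power2_eq_square algebra_simps)
  then have "(1 - ee t) * (?s + \<i> * ?c) = 2 * ?s"
    unfolding e by (simp add: mult.assoc)
  moreover have X: "1 + \<i> * of_real (cot (pi * t)) = (?s + \<i> * ?c) / ?s"
    using assms by (simp add: cot_def field_simps)
  ultimately have "(1 - ee t) * (1 + \<i> * of_real (cot (pi * t))) = 2"
    unfolding X using assms by simp
  moreover from this have "1 - ee t \<noteq> 0"
    by auto
  ultimately show ?thesis
    by (simp add: divide_eq_eq eq_divide_eq mult.commute)
qed

lemma cot_antimono:
  assumes "0 < x" "x \<le> y" "y < pi"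
  shows "cot y \<le> cot x"
proof -
  have "cot x - cot y = sin (y - x) / (sin x * sin y)"
    using sin_gt_zero[of x] sin_gt_zero[of y] assms by (simp add: cot_def sin_diff field_simps)
  also have "\<dots> \<ge> 0"
    using assms by (intro divide_nonneg_nonneg mult_nonneg_nonneg sin_ge_zero) auto
  finally show ?thesis by simp
qed

text \<open>Writing \<open>ee (f j)\<close> as a difference divided by \<open>1 - ee (f (j + 1) - f j)\<close>, summation by parts
  reduces the claim to the total variation of \<open>1 / (1 - ee \<delta>) = (1 + \<i> cot (\<pi> \<delta>)) / 2\<close>,
  which telescopes by monotonicity.\<close>

lemma kusmin_landau_nat:
  fixes f :: "nat \<Rightarrow> real"
  assumes l: "0 < l"
    and range: "\<And>j. j < m \<Longrightarrow> l \<le> f (Suc j) - f j \<and> f (Suc j) - f j \<le> 1 - l"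
    and mono: "(\<forall>j. Suc j < m \<longrightarrow> f (Suc j) - f j \<le> f (Suc (Suc j)) - f (Suc j)) \<or>
               (\<forall>j. Suc j < m \<longrightarrow> f (Suc j) - f j \<ge> f (Suc (Suc j)) - f (Suc j))"
  shows "cmod (\<Sum>j<m. ee (f j)) \<le> 1 / l"
proof (cases m)
  case 0
  then show ?thesis using l by simp
next
  case (Suc n)
  define d where "d j = f (Suc j) - f j" for j
  define w where "w j = 1 / (1 - ee (d j))" for j
  have sinp: "2 * l \<le> sin (pi * d j)" if "j \<le> n" for j
    using sin_pi_ge[OF l, of "d j"] range[of j] that Suc by (auto simp: d_def)
  have sin0: "sin (pi * d j) > 0" if "j \<le> n" for j
    using sinp[OF that] l by linarith
  have w_eq: "w j = (1 + \<i> * of_real (cot (pi * d j))) / 2" if "j \<le> n" for j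
    unfolding w_def using sin0[OF that] by (intro inverse_one_minus_ee) auto
  have w_norm: "cmod (w j) \<le> 1 / (4 * l)" if "j \<le> n" for j
  proof -
    have "cmod (w j) = 1 / (2 * sin (pi * d j))"
      using sin0[OF that] norm_ee_diff_one[of "d j"]
      by (simp add: w_def norm_divide norm_minus_commute)
    also have "\<dots> \<le> 1 / (4 * l)"
      using sinp[OF that] l by (intro divide_left_mono mult_pos_pos) auto
    finally show ?thesis .
  qed
  have cot_abs: "\<bar>cot (pi * d j)\<bar> \<le> 1 / (2 * l)" if "j \<le> n" for j
  proof -
    have "\<bar>cot (pi * d j)\<bar> = \<bar>cos (pi * d j)\<bar> / sin (pi * d j)"
      using sin0[OF that] by (simp add: cot_def)
    also have "\<dots> \<le> 1 / (2 * l)"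
      using sinp[OF that] l by (intro frac_le) auto
    finally show ?thesis .
  qed
  have tele: "ee (f j) = w j * (ee (f j) - ee (f (Suc j)))" if "j \<le> n" for j
  proof -
    have "1 - ee (d j) \<noteq> 0"
      using norm_ee_diff_one[of "d j"] sin0[OF that] by auto
    moreover have "ee (f (Suc j)) = ee (f j) * ee (d j)"
      using ee_add[of "f j" "d j"] by (simp add: d_def)
    ultimately show ?thesis by (simp add: w_def field_simps)
  qed
  have part: "(\<Sum>i<Suc j. ee (f i) - ee (f (Suc i))) = ee (f 0) - ee (f (Suc j))" for j
    by (rule sum_lessThan_telescope')
  have "(\<Sum>j<m. ee (f j)) = (\<Sum>j<Suc n. w j * (ee (f j) - ee (f (Suc j))))"
    unfolding Suc using tele by (intro sum.cong) auto
  also have "\<dots> = w n * (ee (f 0) - ee (f (Suc n))) -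
      (\<Sum>j<n. (w (Suc j) - w j) * (ee (f 0) - ee (f (Suc j))))"
    unfolding sum_by_parts part ..
  \<comment> \<open>Regrouped so that each increment of \<open>w\<close> multiplies a unimodular
    number; the difference of two such numbers would cost a factor 2.\<close>
  also have "\<dots> = w 0 * ee (f 0) - w n * ee (f (Suc n)) + (\<Sum>j<n. (w (Suc j) - w j) * ee (f (Suc j)))"
  proof -
    have "(\<Sum>j<n. (w (Suc j) - w j) * (ee (f 0) - ee (f (Suc j)))) =
        (\<Sum>j<n. w (Suc j) - w j) * ee (f 0) - (\<Sum>j<n. (w (Suc j) - w j) * ee (f (Suc j)))"
      unfolding right_diff_distrib sum_subtractf[of "\<lambda>j. _ j * _"] sum_distrib_right ..
    also have "(\<Sum>j<n. w (Suc j) - w j) = w n - w 0"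
      by (rule sum_lessThan_telescope)
    finally show ?thesis by (simp only:) (simp only: algebra_simps)
  qed
  also have "cmod \<dots> \<le> cmod (w 0) + cmod (w n) + (\<Sum>j<n. cmod (w (Suc j) - w j))"
    by (intro order.trans[OF norm_triangle_ineq] add_mono order.trans[OF norm_triangle_ineq4]
        order.trans[OF norm_sum] sum_mono) (simp_all add: norm_mult)
  also have "(\<Sum>j<n. cmod (w (Suc j) - w j)) \<le> 1 / (2 * l)"
  proof -
    have df: "cmod (w (Suc j) - w j) = \<bar>cot (pi * d (Suc j)) - cot (pi * d j)\<bar> / 2" if "j < n" for j
    proof -
      have "w (Suc j) - w j = \<i> * of_real ((cot (pi * d (Suc j)) - cot (pi * d j)) / 2)"
        using that by (simp add: w_eq field_simps)
      then show ?thesis by (simp only: norm_mult norm_of_real) simp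
    qed
    have d01: "0 < pi * d j \<and> pi * d j < pi" if "j \<le> n" for j
      using range[of j] that Suc l by (auto simp: d_def)
    have tel: "(\<Sum>j<n. cot (pi * d (Suc j)) - cot (pi * d j)) = cot (pi * d n) - cot (pi * d 0)"
      by (rule sum_lessThan_telescope)
    have "(\<Sum>j<n. \<bar>cot (pi * d (Suc j)) - cot (pi * d j)\<bar>) = \<bar>cot (pi * d n) - cot (pi * d 0)\<bar>"
      using mono
    proof
      assume "\<forall>j. Suc j < m \<longrightarrow> f (Suc j) - f j \<le> f (Suc (Suc j)) - f (Suc j)"
      then have le: "cot (pi * d (Suc j)) \<le> cot (pi * d j)" if "j < n" for j
        using that d01[of j] d01[of "Suc j"] Suc by (intro cot_antimono) (auto simp: d_def)
      then have "(\<Sum>j<n. \<bar>cot (pi * d (Suc j)) - cot (pi * d j)\<bar>) =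
          (\<Sum>j<n. - (cot (pi * d (Suc j)) - cot (pi * d j)))"
        by (intro sum.cong refl abs_of_nonpos) simp
      also have "\<dots> = - (cot (pi * d n) - cot (pi * d 0))"
        by (simp only: sum_negf tel)
      also have "\<dots> = \<bar>cot (pi * d n) - cot (pi * d 0)\<bar>"
        using sum_nonpos[of "{..<n}" "\<lambda>j. cot (pi * d (Suc j)) - cot (pi * d j)"] le tel by auto
      finally show ?thesis .
    next
      assume "\<forall>j. Suc j < m \<longrightarrow> f (Suc j) - f j \<ge> f (Suc (Suc j)) - f (Suc j)"
      then have le: "cot (pi * d (Suc j)) \<ge> cot (pi * d j)" if "j < n" for j
        using that d01[of j] d01[of "Suc j"] Suc by (intro cot_antimono) (auto simp: d_def)
      then have "(\<Sum>j<n. \<bar>cot (pi * d (Suc j)) - cot (pi * d j)\<bar>) =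
          (\<Sum>j<n. (cot (pi * d (Suc j)) - cot (pi * d j)))"
        by (intro sum.cong refl abs_of_nonneg) simp
      also have "\<dots> = \<bar>cot (pi * d n) - cot (pi * d 0)\<bar>"
        using sum_nonneg[of "{..<n}" "\<lambda>j. cot (pi * d (Suc j)) - cot (pi * d j)"] le tel by auto
      finally show ?thesis .
    qed
    moreover have "\<dots> \<le> 1 / l"
      using cot_abs[of n] cot_abs[of 0] by (simp add: field_simps)
    ultimately have "(\<Sum>j<n. \<bar>cot (pi * d (Suc j)) - cot (pi * d j)\<bar>) \<le> 1 / l" by simp
    moreover have "(\<Sum>j<n. cmod (w (Suc j) - w j)) = (\<Sum>j<n. \<bar>cot (pi * d (Suc j)) - cot (pi * d j)\<bar>) / 2"
      unfolding sum_divide_distrib using df by (intro sum.cong) auto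
    ultimately show ?thesis by (simp add: field_simps)
  qed
  also have "cmod (w 0) + cmod (w n) + 1 / (2 * l) \<le> 1 / l"
  proof -
    have "1 / (4 * l) + 1 / (4 * l) + 1 / (2 * l) = 1 / l"
      using l by (simp add: field_simps)
    then show ?thesis using w_norm[of 0] w_norm[of n] by linarith
  qed
  finally show ?thesis by simp
qed

text \<open>Subtracting \<open>z * j\<close> from the phase does not change \<open>ee\<close>, so
  the slopes may lie between any two consecutive integers.\<close>

lemma kusmin_landau:
  fixes f :: "nat \<Rightarrow> real" and z :: int and l :: real
  assumes l: "0 < l"
    and range: "\<And>j. a \<le> j \<Longrightarrow> j < b \<Longrightarrow> real_of_int z + l \<le> f (Suc j) - f j \<and> f (Suc j) - f j \<le> real_of_int z + 1 - l"
    and mono: "(\<forall>j. a \<le> j \<and> Suc j < b \<longrightarrow> f (Suc j) - f j \<le> f (Suc (Suc j)) - f (Suc j)) \<or>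
               (\<forall>j. a \<le> j \<and> Suc j < b \<longrightarrow> f (Suc j) - f j \<ge> f (Suc (Suc j)) - f (Suc j))"
  shows "cmod (\<Sum>j\<in>{a..<b}. ee (f j)) \<le> 1 / l"
proof (cases "a \<le> b")
  case False
  then show ?thesis using l by simp
next
  case True
  define g where "g j = f (a + j) - of_int z * real j" for j
  have "(\<Sum>j\<in>{a..<b}. ee (f j)) = (\<Sum>j<b - a. ee (f (a + j)))"
    using sum.shift_bounds_nat_ivl[of "\<lambda>j. ee (f j)" 0 a "b - a"] True
    by (simp add: atLeast0LessThan add.commute)
  also have "\<dots> = (\<Sum>j<b - a. ee (g j))"
    by (intro sum.cong ee_cong) (auto simp: g_def)
  also have "cmod \<dots> \<le> 1 / l"
  proof (rule kusmin_landau_nat)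
    show "0 < l" by fact
    show "l \<le> g (Suc j) - g j \<and> g (Suc j) - g j \<le> 1 - l" if "j < b - a" for j
      using range[of "a + j"] that by (auto simp: g_def algebra_simps)
    show "(\<forall>j. Suc j < b - a \<longrightarrow> g (Suc j) - g j \<le> g (Suc (Suc j)) - g (Suc j)) \<or>
        (\<forall>j. Suc j < b - a \<longrightarrow> g (Suc (Suc j)) - g (Suc j) \<le> g (Suc j) - g j)"
      using mono
    proof (elim disjE)
      assume *: "\<forall>j. a \<le> j \<and> Suc j < b \<longrightarrow> f (Suc j) - f j \<le> f (Suc (Suc j)) - f (Suc j)"
      have "g (Suc j) - g j \<le> g (Suc (Suc j)) - g (Suc j)" if "Suc j < b - a" for j
        using *[rule_format, of "a + j"] that by (simp add: g_def algebra_simps)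
      then show ?thesis by blast
    next
      assume *: "\<forall>j. a \<le> j \<and> Suc j < b \<longrightarrow> f (Suc j) - f j \<ge> f (Suc (Suc j)) - f (Suc j)"
      have "g (Suc j) - g j \<ge> g (Suc (Suc j)) - g (Suc j)" if "Suc j < b - a" for j
        using *[rule_format, of "a + j"] that by (simp add: g_def algebra_simps)
      then show ?thesis by blast
    qed
  qed
  finally show ?thesis .
qed

section \<open>The inverse Weyl inequality\<close>

lemma pigeonhole_fiber:
  assumes "finite A" "finite B" "B \<noteq> {}" "\<And>a. a \<in> A \<Longrightarrow> f a \<in> B"
  obtains b where "b \<in> B" "card A \<le> card B * card {a \<in> A. f a = b}"
proof -
  have "\<exists>b\<in>B. card A \<le> card B * card {a \<in> A. f a = b}"
  proof (rule ccontr)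
    assume "\<not> ?thesis"
    then have *: "card B * card {a \<in> A. f a = b} < card A" if "b \<in> B" for b
      using that by (meson not_le)
    have "A = (\<Union>b\<in>B. {a \<in> A. f a = b})"
      using assms(4) by auto
    then have "card A \<le> (\<Sum>b\<in>B. card {a \<in> A. f a = b})"
      using card_UN_le[OF assms(2), of "\<lambda>b. {a \<in> A. f a = b}"] by simp
    then have "card B * card A \<le> (\<Sum>b\<in>B. card B * card {a \<in> A. f a = b})"
      by (simp add: sum_distrib_left[symmetric])
    also have "\<dots> < (\<Sum>b\<in>B. card A)"
      using * assms(2,3) by (intro sum_strict_mono) auto
    finally show False by simp
  qed
  then show ?thesis using that by blast
qed

lemma card_le_diameter:
  fixes X :: "nat set" and D :: real
  assumes "finite X" "0 \<le> D" "\<And>x y. x \<in> X \<Longrightarrow> y \<in> X \<Longrightarrow> x \<le> y \<Longrightarrow> real y - real x \<le> D"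
  shows "real (card X) \<le> D + 1"
proof (cases "X = {}")
  case False
  then have mm: "Min X \<in> X" "Max X \<in> X" "Min X \<le> Max X"
    using assms(1) by auto
  have "X \<subseteq> {Min X..Max X}"
    using assms(1) by auto
  from card_mono[OF _ this] have "card X \<le> Suc (Max X) - Min X" by simp
  with mm(3) have "real (card X) \<le> real (Max X) - real (Min X) + 1"
    by linarith
  then show ?thesis using assms(3)[OF mm] by simp
qed (use assms in auto)

lemma card_int_interval_le:
  fixes u v :: real
  assumes "u \<le> v"
  shows "real (card {a::int. u \<le> a \<and> a \<le> v}) \<le> v - u + 1" "finite {a::int. u \<le> a \<and> a \<le> v}"
proof -
  have eq: "{a::int. u \<le> a \<and> a \<le> v} = {\<lceil>u\<rceil>..\<lfloor>v\<rfloor>}"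
    by (auto simp: ceiling_le_iff le_floor_iff)
  then show "finite {a::int. u \<le> a \<and> a \<le> v}" by simp
  have "real (card {a::int. u \<le> a \<and> a \<le> v}) = real (nat (\<lfloor>v\<rfloor> - \<lceil>u\<rceil> + 1))"
    unfolding eq by simp
  also have "\<dots> \<le> v - u + 1" using assms by linarith
  finally show "real (card {a::int. u \<le> a \<and> a \<le> v}) \<le> v - u + 1" .
qed

text \<open>Bootstraps a crude recurrence. Two elements of the dense set \<open>A\<close> at a
  distance \<open>g\<close> of at most \<open>2 * E\<close> already bring
  \<open>g * \<gamma>\<close> within \<open>2 * \<epsilon>\<close> of an integer, but without the
  gain of \<open>N\<close>. Within a residue class modulo \<open>g\<close> the points
  \<open>\<gamma> * h\<close> then move modulo 1 in equal small steps, and they can be near integers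
  as often as the density of \<open>A\<close> demands only if they hardly move over the whole
  length.\<close>

lemma recurrence_denominator:
  fixes \<gamma> \<epsilon> E :: real and N :: nat
  assumes A: "A \<subseteq> {..<N}" "N \<le> card A * E" and E: "1 \<le> E" "4 * E \<le> N" and e: "0 \<le> \<epsilon>" "8 * \<epsilon> * E \<le> 1"
    and rec: "\<And>h. h \<in> A \<Longrightarrow> \<exists>a::int. \<bar>\<gamma> * real h - a\<bar> \<le> \<epsilon>"
  shows "\<exists>(g::nat) (a::int). 1 \<le> g \<and> g \<le> 2 * E \<and> \<bar>g * \<gamma> - a\<bar> * N \<le> 32 * \<epsilon> * E\<^sup>2"
proof -
  have finA: "finite A" using A(1) finite_subset by blast
  obtain c where c: "\<And>h. h \<in> A \<Longrightarrow> \<bar>\<gamma> * real h - of_int (c h)\<bar> \<le> \<epsilon>"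
    using bchoice[of A "\<lambda>h a. \<bar>\<gamma> * real h - of_int a\<bar> \<le> \<epsilon>"] rec by blast
  \<comment> \<open>Blocks of length \<open>2 * E\<close>: with one element of \<open>A\<close> per
    block there would be at most \<open>N / (2 * E) + 1\<close> elements, fewer than the
    \<open>N / E\<close> that exist.\<close>
  have "\<not> inj_on (\<lambda>h. nat \<lfloor>h / (2 * E)\<rfloor>) A"
  proof
    assume inj: "inj_on (\<lambda>h. nat \<lfloor>h / (2 * E)\<rfloor>) A"
    have sub: "(\<lambda>h. nat \<lfloor>h / (2 * E)\<rfloor>) ` A \<subseteq> {..nat \<lfloor>N / (2 * E)\<rfloor>}"
      using A(1) E by (auto intro!: nat_mono floor_mono divide_right_mono)
    have "card A \<le> nat \<lfloor>N / (2 * E)\<rfloor> + 1"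
      using card_inj_on_le[OF inj sub] by simp
    moreover have "0 \<le> N / (2 * E)" using E by simp
    ultimately have "real (card A) \<le> N / (2 * E) + 1"
      by linarith
    then have "card A * E \<le> N / 2 + E"
      using E by (simp add: field_simps)
    also have "\<dots> < N" using E by linarith
    finally show False using A(2) by simp
  qed
  then obtain k1 k2 where k: "k1 \<in> A" "k2 \<in> A" "k1 \<noteq> k2" "nat \<lfloor>k1 / (2 * E)\<rfloor> = nat \<lfloor>k2 / (2 * E)\<rfloor>"
    by (auto simp: inj_on_def)
  obtain h1 h2 where h: "h1 \<in> A" "h2 \<in> A" "h1 < h2" "nat \<lfloor>h1 / (2 * E)\<rfloor> = nat \<lfloor>h2 / (2 * E)\<rfloor>"
    using that[of k1 k2] that[of k2 k1] k by (cases "k1 < k2") auto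
  define g where "g = h2 - h1"
  define a0 where "a0 = c h2 - c h1"
  define \<tau> where "\<tau> = g * \<gamma> - a0"
  have g1: "1 \<le> g" using h(3) by (simp add: g_def)
  have "\<lfloor>h1 / (2 * E)\<rfloor> = \<lfloor>h2 / (2 * E)\<rfloor>"
    using h(4) E by (subst (asm) eq_nat_nat_iff) auto
  then have "h2 / (2 * E) - h1 / (2 * E) < 1" by linarith
  then have g2: "real g \<le> 2 * E"
    using h(3) E by (simp add: g_def of_nat_diff field_simps)
  have tau_le: "\<bar>\<tau>\<bar> \<le> 2 * \<epsilon>"
  proof -
    have "\<tau> = (\<gamma> * h2 - c h2) - (\<gamma> * h1 - c h1)"
      using h(3) by (simp add: \<tau>_def g_def a0_def of_nat_diff algebra_simps)
    then show ?thesis using c[OF h(1)] c[OF h(2)] by linarith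
  qed
  show ?thesis
  proof (cases "\<tau> = 0")
    case True
    then show ?thesis using g1 g2 e(1) by (intro exI[of _ g] exI[of _ a0]) (simp add: \<tau>_def)
  next
    case False
    \<comment> \<open>Along the class modulo \<open>g\<close> that is richest in \<open>A\<close>,
      \<open>\<gamma> * h\<close> is modulo 1 the arithmetic progression \<open>\<phi>\<close> with
      step \<open>\<tau>\<close>.\<close>
    obtain r where r: "r \<in> {..<g}" "card A \<le> card {..<g} * card {h \<in> A. h mod g = r}"
      by (rule pigeonhole_fiber[of A "{..<g}" "\<lambda>h. h mod g"]) (use finA g1 in \<open>auto simp: lessThan_empty_iff\<close>)
    define Ar where "Ar = {h \<in> A. h mod g = r}"
    have finAr: "finite Ar" using finA by (simp add: Ar_def)
    define \<phi> where "\<phi> h = \<gamma> * r + \<tau> * (h div g)" for h :: nat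
    define k where "k h = c h - a0 * int (h div g)" for h :: nat
    have close: "\<bar>\<phi> h - k h\<bar> \<le> \<epsilon>" if "h \<in> Ar" for h
    proof -
      have "h = r + g * (h div g)"
        using that by (auto simp: Ar_def)
      from arg_cong[OF this, of real] have "real h = real r + real g * real (h div g)"
        by simp
      then have "\<phi> h - k h = \<gamma> * h - c h"
        by (simp add: \<phi>_def k_def \<tau>_def algebra_simps)
      then show ?thesis using c[of h] that by (simp add: Ar_def)
    qed
    define L where "L = real N / g"
    have L0: "0 \<le> L" by (simp add: L_def)
    have div_le: "real (h div g) \<le> L" if "h \<in> Ar" for h
    proof -
      have "real (h div g) \<le> real h / g" by (rule of_nat_div_le_of_nat)
      also have "\<dots> \<le> L"
        using that A(1) by (auto simp: L_def Ar_def intro!: divide_right_mono)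
      finally show ?thesis .
    qed
    define D where "D = \<bar>\<tau>\<bar> * L"
    have D0: "0 \<le> D" using L0 by (simp add: D_def)
    \<comment> \<open>\<open>\<phi>\<close> drifts by at most \<open>D\<close> and only in the
      direction of the sign of \<open>\<tau>\<close>. An interval open to both sides would double
      the term that is absorbed at the end, and the absorption would fail.\<close>
    define lo where "lo = \<gamma> * r - (if \<tau> < 0 then D else 0) - \<epsilon>"
    define hi where "hi = \<gamma> * r + (if \<tau> < 0 then 0 else D) + \<epsilon>"
    have lohi: "lo \<le> hi" "hi - lo = \<bar>\<tau>\<bar> * L + 2 * \<epsilon>"
      using e(1) D0 by (auto simp: lo_def hi_def simp flip: D_def)
    have kB: "k h \<in> {a. lo \<le> of_int a \<and> of_int a \<le> hi}" if "h \<in> Ar" for h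
    proof -
      define z where "z = \<tau> * (h div g)"
      have "\<bar>\<tau>\<bar> * (h div g) \<le> D"
        unfolding D_def using div_le[OF that] by (intro mult_left_mono) auto
      then have "\<bar>z\<bar> \<le> D" "\<tau> < 0 \<Longrightarrow> z \<le> 0" "\<not> \<tau> < 0 \<Longrightarrow> 0 \<le> z"
        by (auto simp: z_def abs_mult mult_le_0_iff)
      moreover have "\<bar>\<gamma> * r + z - k h\<bar> \<le> \<epsilon>"
        using close[OF that] by (simp add: \<phi>_def z_def)
      ultimately show ?thesis by (cases "\<tau> < 0") (auto simp: lo_def hi_def)
    qed
    show ?thesis
    proof (cases "Ar = {}")
      case True
      then have "card A = 0" using r(2) True unfolding Ar_def[symmetric] by simp
      then show ?thesis using A(2) E by simp
    next
      case False
      then have ne: "{a::int. lo \<le> a \<and> a \<le> hi} \<noteq> {}" using kB by blast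
      obtain b where b: "card Ar \<le> card {a::int. lo \<le> a \<and> a \<le> hi} * card {h \<in> Ar. k h = b}"
        by (rule pigeonhole_fiber[of Ar "{a::int. lo \<le> a \<and> a \<le> hi}" k])
           (use finAr ne kB card_int_interval_le(2)[OF lohi(1)] in auto)
      define X where "X = (\<lambda>h. h div g) ` {h \<in> Ar. k h = b}"
      have injX: "inj_on (\<lambda>h. h div g) {h \<in> Ar. k h = b}"
      proof (rule inj_onI)
        fix x y assume "x \<in> {h \<in> Ar. k h = b}" "y \<in> {h \<in> Ar. k h = b}" "x div g = y div g"
        then show "x = y"
          using mult_div_mod_eq[of g x] mult_div_mod_eq[of g y] by (simp add: Ar_def)
      qed
      \<comment> \<open>While \<open>\<phi>\<close> stays within \<open>\<epsilon>\<close> of the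
        same integer it moves by at most \<open>2 * \<epsilon>\<close>. The extra 1 is absorbed
        next, because \<open>\<bar>\<tau>\<bar>\<close> is at most
        \<open>2 * \<epsilon>\<close>.\<close>
      have "real (card X) \<le> 2 * \<epsilon> / \<bar>\<tau>\<bar> + 1"
      proof (rule card_le_diameter)
        fix x y assume "x \<in> X" "y \<in> X" "x \<le> y"
        then obtain h h' where hh: "h \<in> Ar" "h' \<in> Ar" "k h = b" "k h' = b" "x = h div g" "y = h' div g"
          by (auto simp: X_def)
        then have "\<bar>\<phi> h' - \<phi> h\<bar> \<le> 2 * \<epsilon>" using close[of h] close[of h'] by simp
        then have "\<bar>\<tau> * (real y - real x)\<bar> \<le> 2 * \<epsilon>" using hh by (simp add: \<phi>_def algebra_simps)
        then show "real y - real x \<le> 2 * \<epsilon> / \<bar>\<tau>\<bar>"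
          using \<open>\<tau> \<noteq> 0\<close> \<open>x \<le> y\<close> by (simp add: abs_mult field_simps)
      qed (use e finAr in \<open>auto simp: X_def\<close>)
      moreover have "1 \<le> 2 * \<epsilon> / \<bar>\<tau>\<bar>"
        using tau_le \<open>\<tau> \<noteq> 0\<close> by (simp add: field_simps)
      ultimately have cX: "real (card {h \<in> Ar. k h = b}) \<le> 4 * \<epsilon> / \<bar>\<tau>\<bar>"
        using card_image[OF injX] by (simp add: X_def)
      have "real (card Ar) \<le> (\<bar>\<tau>\<bar> * L + 2 * \<epsilon> + 1) * (4 * \<epsilon> / \<bar>\<tau>\<bar>)"
      proof -
        have "real (card Ar) \<le> real (card {a::int. lo \<le> a \<and> a \<le> hi}) * real (card {h \<in> Ar. k h = b})"
          using b by (simp flip: of_nat_mult)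
        also have "\<dots> \<le> (\<bar>\<tau>\<bar> * L + 2 * \<epsilon> + 1) * (4 * \<epsilon> / \<bar>\<tau>\<bar>)"
          using card_int_interval_le(1)[OF lohi(1)] lohi(2) cX L0 e
          by (intro mult_mono) auto
        finally show ?thesis .
      qed
      moreover have "(\<bar>\<tau>\<bar> * L + 2 * \<epsilon> + 1) * (4 * \<epsilon> / \<bar>\<tau>\<bar>) = 4 * \<epsilon> * L + (2 * \<epsilon> + 1) * (4 * \<epsilon> / \<bar>\<tau>\<bar>)"
        using \<open>\<tau> \<noteq> 0\<close> by (simp add: field_simps)
      moreover have "(2 * \<epsilon> + 1) * (4 * \<epsilon> / \<bar>\<tau>\<bar>) \<le> 2 * (4 * \<epsilon> / \<bar>\<tau>\<bar>)"
      proof (rule mult_right_mono)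
        have "\<epsilon> * 1 \<le> \<epsilon> * E" using e E by (intro mult_left_mono) auto
        then show "2 * \<epsilon> + 1 \<le> 2" using e(2) by simp
      qed (use e in auto)
      ultimately have 1: "real (card Ar) \<le> 4 * \<epsilon> * L + 8 * \<epsilon> / \<bar>\<tau>\<bar>"
        by simp
      have "real N \<le> real (card A) * E" by fact
      also have "\<dots> \<le> real (g * card Ar) * E"
        using r(2) E(1) unfolding Ar_def card_lessThan by (intro mult_right_mono of_nat_mono) auto
      finally have "L \<le> real (card Ar) * E"
        using g1 by (simp add: L_def field_simps)
      also have "\<dots> \<le> (4 * \<epsilon> * L + 8 * \<epsilon> / \<bar>\<tau>\<bar>) * E"
        using 1 E by (intro mult_right_mono) auto
      also have "\<dots> = (8 * \<epsilon> * E) * L / 2 + 8 * \<epsilon> * E / \<bar>\<tau>\<bar>"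
        by (simp add: algebra_simps)
      \<comment> \<open>The hypothesis \<open>8 * \<epsilon> * E \<le> 1\<close> turns the first
        term into \<open>L / 2\<close>, which moves to the left-hand side.\<close>
      also have "\<dots> \<le> 1 * L / 2 + 8 * \<epsilon> * E / \<bar>\<tau>\<bar>"
        using e(2) L0 by (intro add_right_mono divide_right_mono mult_right_mono) auto
      finally have "L * \<bar>\<tau>\<bar> \<le> 16 * \<epsilon> * E"
        using \<open>\<tau> \<noteq> 0\<close> by (simp add: field_simps)
      then have "\<bar>\<tau>\<bar> * N \<le> 16 * \<epsilon> * E * g"
        using g1 by (simp add: L_def field_simps)
      also have "\<dots> \<le> 16 * \<epsilon> * E * (2 * E)"
        using g2 e E by (intro mult_left_mono) auto
      finally have "\<bar>\<tau>\<bar> * N \<le> 32 * \<epsilon> * E\<^sup>2"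
        by (simp add: power2_eq_square)
      then show ?thesis using g1 g2 by (intro exI[of _ g] exI[of _ a0]) (simp add: \<tau>_def)
    qed
  qed
qed

text \<open>\<open>polyphase d \<beta> F\<close>: modulo 1, \<open>F\<close> behaves under differencing like a polynomial of degree at most
  \<open>d + 1\<close> in which \<open>\<beta>\<close> is the coefficient of the power \<open>d + 1\<close>.\<close>

primrec polyphase :: "nat \<Rightarrow> real \<Rightarrow> (nat \<Rightarrow> real) \<Rightarrow> bool" where
  "polyphase 0 \<beta> F \<longleftrightarrow> (\<forall>l. F (Suc l) - F l - \<beta> \<in> \<int>)"
| "polyphase (Suc d) \<beta> F \<longleftrightarrow> (\<forall>h. polyphase d (real (d + 2) * real h * \<beta>) (\<lambda>l. F (l + h) - F l))"

lemma polyphase_cong_Ints: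
  assumes "polyphase d \<beta> F" "\<And>l. G l - F l \<in> \<int>"
  shows "polyphase d \<beta> G"
  using assms
proof (induction d arbitrary: \<beta> F G)
  case 0
  have "G (Suc l) - G l - \<beta> \<in> \<int>" for l
  proof -
    have "F (Suc l) - F l - \<beta> \<in> \<int>" using 0(1) by simp
    from Ints_diff[OF Ints_add[OF this 0(2)[of "Suc l"]] 0(2)[of l]]
    show ?thesis by (simp add: algebra_simps)
  qed
  then show ?case by simp
next
  case (Suc d)
  have "polyphase d (real (d + 2) * real h * \<beta>) (\<lambda>l. G (l + h) - G l)" for h
  proof (rule Suc.IH[of _ "\<lambda>l. F (l + h) - F l"])
    fix l
    have "(G (l + h) - G l) - (F (l + h) - F l) = (G (l + h) - F (l + h)) - (G l - F l)"
      by simp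
    also have "\<dots> \<in> \<int>" using Suc.prems(2) by (rule Ints_diff[OF _ Suc.prems(2)])
    finally show "(G (l + h) - G l) - (F (l + h) - F l) \<in> \<int>" .
  qed (use Suc.prems(1) in auto)
  then show ?case by simp
qed

text \<open>Weyl differencing: pairs \<open>(k, l)\<close> with \<open>l < k\<close> are grouped by
  \<open>h = k - l\<close>, those with \<open>k < l\<close> give the complex conjugate, and the
  diagonal contributes \<open>m\<close>.\<close>

lemma norm_sum_ee_square_le:
  "(cmod (\<Sum>l<m. ee (F l)))\<^sup>2 \<le> real m + 2 * (\<Sum>h\<in>{1..<m}. cmod (\<Sum>l<m - h. ee (F (l + h) - F l)))"
proof -
  let ?z = "\<lambda>l. ee (F l)"
  have "(cmod (\<Sum>l<m. ?z l))\<^sup>2 = cmod ((\<Sum>l<m. ?z l) * cnj (\<Sum>l<m. ?z l))"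
    by (simp add: norm_mult power2_eq_square del: cnj_sum)
  also have "(\<Sum>l<m. ?z l) * cnj (\<Sum>l<m. ?z l) = (\<Sum>(k, l)\<in>{..<m} \<times> {..<m}. ?z k * cnj (?z l))"
    by (simp add: sum_product sum.cartesian_product)
  also have "{..<m} \<times> {..<m} = {(k, l). l < k \<and> k < m} \<union> {(k, l). k < l \<and> l < m} \<union> (\<lambda>l. (l, l)) ` {..<m}"
    by auto
  also have "(\<Sum>(k, l)\<in>\<dots>. ?z k * cnj (?z l)) =
      (\<Sum>(k, l)\<in>{(k, l). l < k \<and> k < m}. ?z k * cnj (?z l)) +
      (\<Sum>(k, l)\<in>{(k, l). k < l \<and> l < m}. ?z k * cnj (?z l)) + (\<Sum>(k, l)\<in>(\<lambda>l. (l, l)) ` {..<m}. ?z k * cnj (?z l))"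
  proof -
    have fin: "finite {(k::nat, l). l < k \<and> k < m}" "finite {(k::nat, l). k < l \<and> l < m}"
      by (rule finite_subset[of _ "{..<m} \<times> {..<m}"]; auto)+
    show ?thesis
      by (subst sum.union_disjoint, use fin in \<open>auto simp: sum.union_disjoint\<close>)+
  qed
  also have "(\<Sum>(k, l)\<in>{(k, l). l < k \<and> k < m}. ?z k * cnj (?z l)) = (\<Sum>h\<in>{1..<m}. \<Sum>l<m - h. ee (F (l + h) - F l))"
    by (subst sum.Sigma, simp, simp, rule sum.reindex_bij_witness[of _ "\<lambda>(h, l). (l + h, l)" "\<lambda>(k, l). (k - l, l)"])
       (auto simp: ee_diff)
  also have "(\<Sum>(k, l)\<in>{(k, l). k < l \<and> l < m}. ?z k * cnj (?z l)) = cnj (\<Sum>h\<in>{1..<m}. \<Sum>l<m - h. ee (F (l + h) - F l))"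
    unfolding cnj_sum
    by (subst sum.Sigma, simp, simp, rule sum.reindex_bij_witness[of _ "\<lambda>(h, l). (l, l + h)" "\<lambda>(k, l). (l - k, k)"])
       (auto simp: ee_diff)
  also have "(\<Sum>(k, l)\<in>(\<lambda>l. (l, l)) ` {..<m}. ?z k * cnj (?z l)) = of_nat m"
    by (subst sum.reindex) (auto simp: inj_on_def simp flip: complex_norm_square)
  also have "cmod ((\<Sum>h\<in>{1..<m}. \<Sum>l<m - h. ee (F (l + h) - F l)) +
      cnj (\<Sum>h\<in>{1..<m}. \<Sum>l<m - h. ee (F (l + h) - F l)) + of_nat m) \<le>
      2 * cmod (\<Sum>h\<in>{1..<m}. \<Sum>l<m - h. ee (F (l + h) - F l)) + m"
    using norm_triangle_ineq[of "\<Sum>h\<in>{1..<m}. \<Sum>l<m - h. ee (F (l + h) - F l)" "cnj (\<Sum>h\<in>{1..<m}. \<Sum>l<m - h. ee (F (l + h) - F l))"]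
    by (intro order.trans[OF norm_triangle_ineq]) (simp del: cnj_sum)
  also have "\<dots> \<le> 2 * (\<Sum>h\<in>{1..<m}. cmod (\<Sum>l<m - h. ee (F (l + h) - F l))) + m"
    by (simp add: norm_sum)
  finally show ?thesis by simp
qed

text \<open>A large sum makes many differenced sums large, and by induction each such shift
  \<open>h\<close> has a denominator of bounded size for \<open>(d + 2) * h * \<beta>\<close>. One
  denominator \<open>b0\<close> serves a large share of the shifts;
  \<open>recurrence_denominator\<close> then removes the factor \<open>h\<close> and gains the
  missing power of \<open>N\<close>. The length \<open>m\<close> is kept apart from the scale
  \<open>N\<close> because differencing shortens the sum but not the scale.\<close>

lemma weyl_inverse_step:
  fixes T \<beta> :: real and N m d K :: nat and F
  assumes K: "1 \<le> K" and IH: "\<And>(T::real) (N::nat) m (\<beta>::real) F. 1 \<le> T \<Longrightarrow> 1 \<le> N \<Longrightarrow> m \<le> N \<Longrightarrow>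
      polyphase d \<beta> F \<Longrightarrow> N \<le> cmod (\<Sum>l<m. ee (F l)) * T \<Longrightarrow>
      (\<exists>(b::nat) (a::int). (1::nat) \<le> b \<and> b \<le> K * T ^ K \<and> \<bar>b * \<beta> - a\<bar> * N ^ (d + 1) \<le> K * T ^ K)"
    and T: "1 \<le> T" and N: "1 \<le> N" and m: "m \<le> N"
    and F: "polyphase (Suc d) \<beta> F" and S: "N \<le> cmod (\<Sum>l<m. ee (F l)) * T"
  defines "C0 \<equiv> K\<^sup>2 * 64 ^ K"
  defines "K' \<equiv> (2048 * (d + 2) * C0) ^ (d + 2) + (4 * K + 2) * (d + 2)"
  shows "\<exists>(b::nat) (a::int). (1::nat) \<le> b \<and> b \<le> K' * T ^ K' \<and> \<bar>b * \<beta> - a\<bar> * N ^ (d + 2) \<le> K' * T ^ K'"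
proof -
  \<comment> \<open>A shift will count as large if its differenced sum is at least
    \<open>N / T'\<close>. The factor 8 lets the small shifts take at most a quarter of the squared
    sum.\<close>
  define T' where "T' = 8 * T\<^sup>2"
  define B where "B = K * T' ^ K"
  define E where "E = T' * B"
  define Y where "Y = T\<^sup>2 * B\<^sup>2"
  define Z where "Z = 2048 * real (d + 2) * Y"
  have T2: "1 \<le> T\<^sup>2" using T by simp
  have T': "1 \<le> T'" using T2 by (simp add: T'_def)
  have B: "1 \<le> B" using K T' mult_mono[of 1 "real K" 1 "T' ^ K"] by (simp add: B_def)
  have E: "1 \<le> E" using T' B mult_mono[of 1 T' 1 B] by (simp add: E_def)
  have B2: "B \<le> B\<^sup>2" "1 \<le> B\<^sup>2" using B mult_mono[of 1 B 1 B] by (auto simp: power2_eq_square)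
have "T\<^sup>2 * 1 \<le> T\<^sup>2 * B\<^sup>2" "1 * B\<^sup>2 \<le> T\<^sup>2 * B\<^sup>2"
    using T2 B2 by (intro mult_mono; simp)+
  then have Y1: "T\<^sup>2 \<le> Y" "B\<^sup>2 \<le> Y" by (simp_all add: Y_def)
  then have Y: "1 \<le> Y" "B \<le> Y" using T2 B2 by auto
  have "2048 * Y \<le> (2048 * real (d + 2)) * Y" "(16 * real (d + 2)) * Y \<le> (2048 * real (d + 2)) * Y"
    using Y by (intro mult_right_mono; simp)+
  then have Z: "2048 * Y \<le> Z" "16 * real (d + 2) * Y \<le> Z"
    by (simp_all only: Z_def)
  then have Z1: "1 \<le> Z" using Y by linarith
  note Z = Z Z1
  have "T'\<^sup>2 = 64 * T ^ 4"
    by (simp add: T'_def power_mult_distrib flip: power_mult)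
  then have T'2: "T' ^ (2 * K) = 64 ^ K * T ^ (4 * K)"
    by (simp add: power_mult power_mult_distrib)
  have "B\<^sup>2 = K\<^sup>2 * T' ^ (2 * K)"
    by (simp add: B_def power2_eq_square mult_2 power_add)
  then have YC: "Y = C0 * T ^ (4 * K + 2)"
    by (simp add: Y_def T'2 C0_def power_add power2_eq_square)
  have ZC: "Z = real (2048 * (d + 2) * C0) * T ^ (4 * K + 2)"
    by (simp add: Z_def YC)
  have ZK: "Z ^ (d + 2) \<le> K' * T ^ K'"
  proof -
    have "Z ^ (d + 2) = real ((2048 * (d + 2) * C0) ^ (d + 2)) * T ^ ((4 * K + 2) * (d + 2))"
      by (simp only: ZC power_mult_distrib[of "real (2048 * (d + 2) * C0)"] of_nat_power power_mult)
    also have "\<dots> \<le> K' * T ^ K'"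
      using T by (intro mult_mono power_increasing of_nat_mono) (auto simp: K'_def)
    finally show ?thesis .
  qed
  have Zle: "Z \<le> Z ^ (d + 2)" "Z\<^sup>2 \<le> Z ^ (d + 2)"
    using Z power_increasing[of 1 "d + 2" Z] power_increasing[of 2 "d + 2" Z] by simp_all
  show ?thesis
  \<comment> \<open>For such small \<open>N\<close> the choice \<open>b = 1\<close> with the nearest
    integer is good enough. The threshold is \<open>24 * (B * E)\<close>, which equals
    \<open>192 * Y\<close>; in this form it is used below.\<close>
  proof (cases "N \<le> 192 * Y")
    case True
    have "real N ^ (d + 2) \<le> (192 * Y) ^ (d + 2)"
      using True by (intro power_mono) auto
    then have "\<bar>\<beta> - round \<beta>\<bar> * N ^ (d + 2) \<le> 1 * (192 * Y) ^ (d + 2)"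
      using of_int_round_abs_le[of \<beta>] unfolding of_nat_power
      by (intro mult_mono) (auto simp: abs_minus_commute)
    also have "\<dots> \<le> Z ^ (d + 2)"
      using Y Z by (simp only: mult_1) (intro power_mono, auto)
    finally have "\<bar>\<beta> - round \<beta>\<bar> * N ^ (d + 2) \<le> K' * T ^ K'" using ZK by simp
    moreover have "1 \<le> K' * T ^ K'" using ZK Zle Z by linarith
    ultimately show ?thesis by (intro exI[of _ 1] exI[of _ "round \<beta>"]) auto
  next
    case False
    define s where "s h = cmod (\<Sum>l<m - h. ee (F (l + h) - F l))" for h
    define A where "A = {h \<in> {1..<N}. N \<le> s h * T'}"
    have finA: "finite A" by (simp add: A_def)
    have s_le: "s h \<le> N" for h
    proof -
      have "s h \<le> (\<Sum>l<m - h. 1)" unfolding s_def by (rule order.trans[OF norm_sum]) simp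
      then show ?thesis using m by simp
    qed
    have cardA: "N \<le> card A * T'"
    proof -
      have "(\<Sum>h\<in>{1..<m}. s h) \<le> (\<Sum>h\<in>{1..<N}. s h)"
        using m by (intro sum_mono2) (auto simp: s_def)
      also have "\<dots> = (\<Sum>h\<in>A. s h) + (\<Sum>h\<in>{1..<N} - A. s h)"
        by (subst sum.subset_diff[of A]) (auto simp: A_def)
      also have "(\<Sum>h\<in>A. s h) \<le> (\<Sum>h\<in>A. real N)"
        by (intro sum_mono s_le)
      also have "(\<Sum>h\<in>{1..<N} - A. s h) \<le> (\<Sum>h\<in>{1..<N} - A. N / T')"
        using T' by (intro sum_mono) (auto simp: A_def field_simps)
      also have "(\<Sum>h\<in>{1..<N} - A. N / T') \<le> N * (N / T')"
      proof -
        have "card ({1..<N} - A) \<le> N"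
          using card_mono[of "{1..<N}" "{1..<N} - A"] by auto
        then show ?thesis using T' by (simp only: sum_constant) (intro mult_right_mono, auto)
      qed
      finally have 1: "(\<Sum>h\<in>{1..<m}. s h) \<le> card A * N + N * (N / T')" by simp
      have "(N / T)\<^sup>2 \<le> (cmod (\<Sum>l<m. ee (F l)))\<^sup>2"
        using S T by (intro power_mono) (auto simp: field_simps)
      also have "\<dots> \<le> m + 2 * (\<Sum>h\<in>{1..<m}. s h)"
        unfolding s_def by (rule norm_sum_ee_square_le)
      also have "\<dots> \<le> N + 2 * (card A * N + N * (N / T'))"
        using m by (intro add_mono mult_left_mono 1) auto
      finally have "N * (N / T\<^sup>2) \<le> N * (1 + 2 * (card A + N / T'))"
        by (simp add: power_divide power2_eq_square algebra_simps)
      then have "N / T\<^sup>2 \<le> 1 + 2 * (card A + N / T')"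
        using N by (simp only: mult_le_cancel_left_pos[of "real N"])
      \<comment> \<open>The diagonal takes at most half of \<open>N / T\<^sup>2\<close> and the
        small shifts take a quarter; the remaining quarter must come from
        \<open>2 * card A\<close>.\<close>
      moreover have "1 \<le> N / T\<^sup>2 / 2"
      proof -
        have "2 * T\<^sup>2 \<le> N" using False Y1 T2 by linarith
        then show ?thesis using T by (simp add: le_divide_eq)
      qed
      moreover have "N / T' = N / T\<^sup>2 / 8" by (simp add: T'_def)
      moreover define X where "X = N / T\<^sup>2"
      ultimately have "X \<le> 1 + 2 * (real (card A) + X / 8)" "1 \<le> X / 2" and X: "N / T' = X / 8" by simp_all
      then have "N / T' \<le> card A" by simp
      then show ?thesis using T' by (simp add: field_simps)
    qed
    have "\<exists>(b::nat) (a::int). (1::nat) \<le> b \<and> b \<le> B \<and> \<bar>b * (real (d + 2) * h * \<beta>) - a\<bar> * N ^ (d + 1) \<le> B" if "h \<in> A" for h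
      unfolding B_def
    proof (rule IH[OF T' N])
      show "m - h \<le> N" using m by simp
      show "polyphase d (real (d + 2) * h * \<beta>) (\<lambda>l. F (l + h) - F l)" using F by simp
      show "N \<le> cmod (\<Sum>l<m - h. ee (F (l + h) - F l)) * T'" using that by (simp add: A_def s_def)
    qed
    then obtain b where b: "\<And>h. h \<in> A \<Longrightarrow> (1::nat) \<le> b h \<and> b h \<le> B \<and>
        (\<exists>a::int. \<bar>b h * (real (d + 2) * h * \<beta>) - a\<bar> * N ^ (d + 1) \<le> B)"
      by metis
    have bB: "b h \<in> {1..nat \<lfloor>B\<rfloor>}" if "h \<in> A" for h
      using b[OF that] by (auto simp: le_nat_floor)
    have "{1..nat \<lfloor>B\<rfloor>} \<noteq> {}" using B by (simp add: le_nat_floor)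
    then obtain b0 where b0: "b0 \<in> {1..nat \<lfloor>B\<rfloor>}" "card A \<le> card {1..nat \<lfloor>B\<rfloor>} * card {h \<in> A. b h = b0}"
      using pigeonhole_fiber[of A "{1..nat \<lfloor>B\<rfloor>}" b] finA bB by blast
    define A' where "A' = {h \<in> A. b h = b0}"
    have nB: "real (nat \<lfloor>B\<rfloor>) \<le> B" using B by simp
    have NE: "N \<le> card A' * E"
    proof -
      have "real (card A) \<le> real (nat \<lfloor>B\<rfloor>) * card A'"
        using b0(2) by (simp add: A'_def flip: of_nat_mult)
      also have "\<dots> \<le> B * card A'" using nB by (intro mult_right_mono) auto
      finally have "card A * T' \<le> B * card A' * T'" using T' by (intro mult_right_mono) auto
      then show ?thesis using cardA by (simp add: E_def mult_ac)
    qed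
    have BE: "24 * (B * E) < N"
    proof -
      have "24 * (B * E) = 192 * Y" by (simp add: E_def T'_def Y_def power2_eq_square)
      then show ?thesis using False by simp
    qed
    have E4: "4 * E \<le> N"
    proof -
      have "1 * E \<le> B * E" using B E by (intro mult_right_mono) auto
      then show ?thesis using BE E by linarith
    qed
    \<comment> \<open>The closeness to integers that the induction hypothesis supplies.\<close>
    define \<epsilon> where "\<epsilon> = B / N ^ (d + 1)"
    have Npow: "real N \<le> real N ^ (d + 1)" using N by (intro self_le_power) auto
    have Npos: "0 < real N ^ (d + 1)" using N by simp
    have "\<exists>(g::nat) (a::int). 1 \<le> g \<and> g \<le> 2 * E \<and> \<bar>g * (b0 * real (d + 2) * \<beta>) - a\<bar> * N \<le> 32 * \<epsilon> * E\<^sup>2"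
    proof (rule recurrence_denominator[OF _ NE E E4])
      show "A' \<subseteq> {..<N}" by (auto simp: A'_def A_def)
      show "0 \<le> \<epsilon>" using B by (simp add: \<epsilon>_def)
      have "8 * (B * E) \<le> real N ^ (d + 1)" using BE Npow B E by (smt (verit) mult_nonneg_nonneg)
      then show "8 * \<epsilon> * E \<le> 1" using Npos by (simp add: \<epsilon>_def field_simps)
      fix h assume "h \<in> A'"
      then obtain a :: int where "\<bar>b0 * (real (d + 2) * h * \<beta>) - a\<bar> * N ^ (d + 1) \<le> B"
        using b[of h] by (auto simp: A'_def)
      then have "\<bar>b0 * (real (d + 2) * h * \<beta>) - a\<bar> \<le> \<epsilon>"
        using Npos unfolding \<epsilon>_def by (simp only: pos_le_divide_eq of_nat_power)
      then show "\<exists>a::int. \<bar>b0 * real (d + 2) * \<beta> * h - a\<bar> \<le> \<epsilon>"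
        by (intro exI[of _ a]) (simp add: mult_ac)
    qed
    then obtain g :: nat and a :: int where g: "1 \<le> g" "g \<le> 2 * E"
        "\<bar>g * (b0 * real (d + 2) * \<beta>) - a\<bar> * N \<le> 32 * \<epsilon> * E\<^sup>2"
      by blast
    have b0B: "real b0 \<le> B"
      using b0(1) by (intro order.trans[OF _ nB]) simp
    let ?b = "g * b0 * (d + 2)"
    have "1 \<le> ?b" using g(1) b0(1) by (simp add: Suc_le_eq)
    moreover have "?b \<le> K' * T ^ K'"
    proof -
      have "real ?b = real g * real b0 * real (d + 2)" by (simp only: of_nat_mult)
      also have "\<dots> \<le> 2 * E * B * real (d + 2)"
        using g(2) b0B B E by (intro mult_right_mono mult_mono) auto
      also have "\<dots> = 16 * real (d + 2) * Y"
        by (simp add: E_def T'_def Y_def power2_eq_square)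
      also have "\<dots> \<le> K' * T ^ K'" using Z Zle ZK by linarith
      finally show ?thesis .
    qed
    moreover have "\<bar>?b * \<beta> - a\<bar> * N ^ (d + 2) \<le> K' * T ^ K'"
    proof -
      have "real ?b * \<beta> = g * (b0 * real (d + 2) * \<beta>)" "real N ^ (d + 2) = N * real N ^ (d + 1)"
        by (simp_all only: of_nat_mult mult_ac power_add power_one_right power2_eq_square)
      then have "\<bar>?b * \<beta> - a\<bar> * N ^ (d + 2) = (\<bar>g * (b0 * real (d + 2) * \<beta>) - a\<bar> * N) * N ^ (d + 1)"
        by (simp only: of_nat_power mult.assoc)
      also have "\<dots> \<le> 32 * \<epsilon> * E\<^sup>2 * N ^ (d + 1)"
        using g(3) by (intro mult_right_mono) auto
      also have "\<dots> = 32 * (\<epsilon> * N ^ (d + 1)) * E\<^sup>2"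
        by (simp only: mult_ac)
      also have "\<dots> = 32 * B * E\<^sup>2"
        using N by (simp add: \<epsilon>_def)
      also have "\<dots> = 2048 * (T\<^sup>2 * B) * Y"
        by (simp add: E_def T'_def Y_def power2_eq_square)
      also have "\<dots> \<le> 2048 * Y * Y"
      proof -
        have "T\<^sup>2 * B \<le> Y" unfolding Y_def using B2 T2 by (intro mult_left_mono) auto
        then show ?thesis using Y by (intro mult_right_mono mult_left_mono) auto
      qed
      also have "\<dots> \<le> Z * Z" using Z Y by (intro mult_mono) auto
      also have "\<dots> \<le> K' * T ^ K'" using Zle ZK by (simp add: power2_eq_square)
      finally show ?thesis .
    qed
    ultimately show ?thesis by blast
  qed
qed

text \<open>In this form no rational approximation of \<open>\<beta>\<close> is given in advance:
  the size of the sum produces one, with a denominator that is polynomial in \<open>T\<close> and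
  does not grow with \<open>N\<close>. The induction starts with a linear phase, for which
  Kusmin-Landau bounds the sum by the inverse distance of \<open>\<beta>\<close> to the
  integers.\<close>

theorem weyl_inverse:
  "\<exists>K::nat. 1 \<le> K \<and> (\<forall>(T::real) (N::nat) m (\<beta>::real) F. 1 \<le> T \<longrightarrow> 1 \<le> N \<longrightarrow> m \<le> N \<longrightarrow> polyphase d \<beta> F \<longrightarrow>
      N \<le> cmod (\<Sum>l<m. ee (F l)) * T \<longrightarrow>
      (\<exists>(b::nat) (a::int). (1::nat) \<le> b \<and> b \<le> K * T ^ K \<and> \<bar>b * \<beta> - a\<bar> * N ^ (d + 1) \<le> K * T ^ K))"
proof (induction d)
  case 0
  have "\<exists>(b::nat) (a::int). (1::nat) \<le> b \<and> b \<le> T \<and> \<bar>b * \<beta> - a\<bar> * N \<le> T"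
    if T: "1 \<le> T" and N: "1 \<le> N" and F: "polyphase 0 \<beta> F" and S: "N \<le> cmod (\<Sum>l<m. ee (F l)) * T"
    for T \<beta> :: real and N m :: nat and F
  proof -
    define a where "a = round \<beta>"
    define l where "l = \<bar>\<beta> - a\<bar>"
    have l2: "l \<le> 1 / 2"
      unfolding l_def a_def using of_int_round_abs_le[of \<beta>] by (simp add: abs_minus_commute)
    have "l * N \<le> T"
    proof (cases "l = 0")
      case False
      then have l: "0 < l" by (simp add: l_def)
      have FI: "F k - (F 0 + \<beta> * k) \<in> \<int>" for k
      proof (induction k)
        case (Suc k)
        have "F (Suc k) - F k - \<beta> \<in> \<int>" using F by simp
        from Ints_add[OF this Suc] show ?case by (simp add: algebra_simps)
      qed simp
      have "(\<Sum>k<m. ee (F k)) = (\<Sum>k\<in>{0..<m}. ee (F 0 + \<beta> * k))"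
        using ee_cong[OF FI] by (simp add: atLeast0LessThan)
      also have "cmod \<dots> \<le> 1 / l"
      \<comment> \<open>\<open>\<beta>\<close> lies in the unit interval to the right or to the left
        of its nearest integer \<open>a\<close>.\<close>
      proof (rule kusmin_landau[of l 0 m "if \<beta> > a then a else a - 1"])
        fix j show "real_of_int (if \<beta> > a then a else a - 1) + l \<le> F 0 + \<beta> * Suc j - (F 0 + \<beta> * j) \<and>
          F 0 + \<beta> * Suc j - (F 0 + \<beta> * j) \<le> real_of_int (if \<beta> > a then a else a - 1) + 1 - l"
          using l2 by (auto simp: l_def algebra_simps)
      qed (use l in \<open>auto simp: algebra_simps\<close>)
      finally have "N \<le> 1 / l * T"
        using S T by (smt (verit) mult_right_mono)
      then show ?thesis using l by (simp add: field_simps)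
    qed (use T in auto)
    then show ?thesis using T by (intro exI[of _ 1] exI[of _ a]) (simp add: l_def)
  qed
  then show ?case by (intro exI[of _ 1]) simp
next
  case (Suc d)
  then obtain K :: nat where K: "1 \<le> K" and IH: "\<And>(T::real) (N::nat) m (\<beta>::real) F. 1 \<le> T \<Longrightarrow> 1 \<le> N \<Longrightarrow> m \<le> N \<Longrightarrow>
      polyphase d \<beta> F \<Longrightarrow> N \<le> cmod (\<Sum>l<m. ee (F l)) * T \<Longrightarrow>
      (\<exists>(b::nat) (a::int). (1::nat) \<le> b \<and> b \<le> K * T ^ K \<and> \<bar>b * \<beta> - a\<bar> * N ^ (d + 1) \<le> K * T ^ K)"
    by blast
  define C0 where "C0 = K\<^sup>2 * 64 ^ K"
  define K' where "K' = (2048 * (d + 2) * C0) ^ (d + 2) + (4 * K + 2) * (d + 2)"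
  have C0: "1 \<le> C0" using K by (simp add: C0_def)
  have "1 \<le> K'" using C0 by (simp add: K'_def)
  with weyl_inverse_step[OF K IH, of _ _ _ _ _] show ?case
    unfolding C0_def[symmetric] K'_def[symmetric] by (intro exI[of _ K']) (auto simp del: polyphase.simps)
qed

section \<open>Polynomial phases of rational time\<close>

text \<open>Only two coefficients matter: the top one cancels in differencing and is an integer on a
  progression modulo \<open>q\<close>, so the next one becomes the leading coefficient.\<close>

lemma affine_power_sum_coeffs:
  fixes c :: "nat \<Rightarrow> real" and u w :: real
  obtains E where "\<And>y. (\<Sum>m\<le>D. c m * (u * y + w) ^ m) = (\<Sum>i\<le>D. E i * y ^ i)"
    and "E D = c D * u ^ D" and "\<And>d. D = Suc d \<Longrightarrow> E d = u ^ d * (c d + D * c D * w)"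
proof
  define E where "E i = (\<Sum>m\<le>D. c m * (real (m choose i) * u ^ i * w ^ (m - i)))" for i
  show "(\<Sum>m\<le>D. c m * (u * y + w) ^ m) = (\<Sum>i\<le>D. E i * y ^ i)" for y
  proof -
    have "(\<Sum>m\<le>D. c m * (u * y + w) ^ m) = (\<Sum>m\<le>D. \<Sum>i\<le>D. c m * (real (m choose i) * u ^ i * w ^ (m - i)) * y ^ i)"
    proof (intro sum.cong refl)
      fix m assume m: "m \<in> {..D}"
      have "c m * (u * y + w) ^ m = (\<Sum>i\<le>m. c m * (real (m choose i) * u ^ i * w ^ (m - i)) * y ^ i)"
        by (simp add: binomial_ring sum_distrib_left power_mult_distrib mult_ac)
      also have "\<dots> = (\<Sum>i\<le>D. c m * (real (m choose i) * u ^ i * w ^ (m - i)) * y ^ i)"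
        using m by (intro sum.mono_neutral_left) auto
      finally show "c m * (u * y + w) ^ m = (\<Sum>i\<le>D. c m * (real (m choose i) * u ^ i * w ^ (m - i)) * y ^ i)" .
    qed
    also have "\<dots> = (\<Sum>i\<le>D. E i * y ^ i)"
      by (subst sum.swap) (simp add: E_def sum_distrib_right)
    finally show ?thesis .
  qed
  have "E D = (\<Sum>m\<in>{D}. c m * (real (m choose D) * u ^ D * w ^ (m - D)))"
    unfolding E_def by (rule sum.mono_neutral_right) auto
  then show "E D = c D * u ^ D" by simp
  show "E d = u ^ d * (c d + D * c D * w)" if "D = Suc d" for d
  proof -
    have "E d = (\<Sum>m\<in>{d, Suc d}. c m * (real (m choose d) * u ^ d * w ^ (m - d)))"
      unfolding E_def that by (rule sum.mono_neutral_right) auto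
    then show ?thesis by (simp add: that algebra_simps)
  qed
qed

lemma polyphase_polynomial:
  assumes "\<And>l. F l = (\<Sum>i\<le>Suc d. c i * real l ^ i)"
  shows "polyphase d (c (Suc d)) F"
  using assms
proof (induction d arbitrary: c F)
  case 0
  then show ?case by (simp add: algebra_simps)
next
  case (Suc d)
  have "polyphase d (real (d + 2) * real h * c (Suc (Suc d))) (\<lambda>l. F (l + h) - F l)" for h
  proof -
    obtain E where E: "\<And>y. (\<Sum>m\<le>Suc (Suc d). c m * (1 * y + real h) ^ m) = (\<Sum>i\<le>Suc (Suc d). E i * y ^ i)"
      "E (Suc (Suc d)) = c (Suc (Suc d)) * 1 ^ Suc (Suc d)"
      "\<And>d'. Suc (Suc d) = Suc d' \<Longrightarrow> E d' = 1 ^ d' * (c d' + Suc (Suc d) * c (Suc (Suc d)) * real h)"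
      by (rule affine_power_sum_coeffs[where D = "Suc (Suc d)" and c = c and u = 1 and w = "real h"]) blast
    have "polyphase d ((\<lambda>i. E i - c i) (Suc d)) (\<lambda>l. F (l + h) - F l)"
    proof (rule Suc.IH)
      fix l
      have "F (l + h) - F l = (\<Sum>i\<le>Suc (Suc d). E i * real l ^ i) - (\<Sum>i\<le>Suc (Suc d). c i * real l ^ i)"
        using E(1)[of "real l"] by (simp only: Suc.prems of_nat_add mult_1)
      also have "\<dots> = (\<Sum>i\<le>Suc d. (E i - c i) * real l ^ i)"
        by (simp only: sum.atMost_Suc[of _ "Suc d"] E(2) left_diff_distrib sum_subtractf power_one mult_1_right)
      finally show "F (l + h) - F l = (\<Sum>i\<le>Suc d. (E i - c i) * real l ^ i)" .
    qed
    moreover have "E (Suc d) - c (Suc d) = real (d + 2) * real h * c (Suc (Suc d))"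
      using E(3)[of "Suc d"] by simp
    ultimately show ?thesis by simp
  qed
  then show ?case by simp
qed

text \<open>The phase \<open>- P (j + \<theta>) * p / q\<close> with
  \<open>A m = - p * \<alpha> m\<close>. The argument is real so that it can be evaluated at both
  signs of \<open>j\<close> and along progressions.\<close>

definition qphase :: "(nat \<Rightarrow> int) \<Rightarrow> nat \<Rightarrow> nat \<Rightarrow> real \<Rightarrow> real \<Rightarrow> real" where
  "qphase A n q \<theta> y = (\<Sum>m\<le>n. real_of_int (A m) / real q * (y + \<theta>) ^ m)"

text \<open>On a progression modulo \<open>q\<close> the power \<open>n\<close> has an integer coefficient, so that the phase has degree
  \<open>n - 1\<close> modulo 1, with a leading coefficient that is linear in \<open>\<theta>\<close>.\<close>

lemma polyphase_qphase_progression: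
  fixes s :: int and x \<theta> :: real
  assumes n: "3 \<le> n" and q: "0 < q"
  shows "\<exists>z::int. polyphase (n - 2) (real_of_int (int n * A n * int q ^ (n - 2)) * \<theta> + z)
      (\<lambda>l. qphase A n q \<theta> (s + real (q * l + t)) + x * real (q * l + t))"
proof -
  obtain d where d: "n = Suc (Suc d)" "1 \<le> d" using n by (cases n; cases "n - 1") auto
  obtain E where E: "\<And>y::real. (\<Sum>m\<le>n. real_of_int (A m) / q * (q * y + (s + t + \<theta>)) ^ m) = (\<Sum>i\<le>n. E i * y ^ i)"
    "E n = real_of_int (A n) / q * real q ^ n"
    "\<And>d. n = Suc d \<Longrightarrow> E d = real q ^ d * (real_of_int (A d) / q + n * (real_of_int (A n) / q) * (s + t + \<theta>))"
    by (rule affine_power_sum_coeffs[where D = n and c = "\<lambda>m. real_of_int (A m) / q" and u = "real q" and w = "s + t + \<theta>"]) blast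
  \<comment> \<open>The linear term \<open>x * j\<close> touches only the coefficients 0 and 1. By
    \<open>3 \<le> n\<close> the coefficient of order \<open>n - 1\<close> is not among them, and
    this is what makes the later bounds uniform in \<open>x\<close>.\<close>
  define c where "c i = E i + (if i = 0 then x * t else if i = 1 then x * q else 0)" for i
  define z :: int where "z = int q ^ d * (A (Suc d) + n * A n * (s + t))"
  have cE: "c (Suc d) = real_of_int (int n * A n * int q ^ (n - 2)) * \<theta> + z"
  proof -
    have "real q ^ Suc d * (a / q + n * (b / q) * w) = real q ^ d * (a + n * b * w)" for a b w :: real
      using q by (simp add: field_simps)
    then have "E (Suc d) = real q ^ d * (A (Suc d) + n * real_of_int (A n) * (s + t + \<theta>))"
      using E(3)[of "Suc d"] d(1) by simp
    moreover have "n - 2 = d" "c (Suc d) = E (Suc d)" using d by (auto simp: c_def)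
    ultimately show ?thesis by (simp add: z_def algebra_simps)
  qed
  have En: "E n \<in> \<int>"
    using E(2) q d by simp
  have "polyphase d (c (Suc d)) (\<lambda>l. \<Sum>i\<le>Suc d. c i * real l ^ i)"
    by (rule polyphase_polynomial) simp
  then have "polyphase d (c (Suc d)) (\<lambda>l. qphase A n q \<theta> (s + real (q * l + t)) + x * real (q * l + t))"
  proof (rule polyphase_cong_Ints)
    fix l
    have "qphase A n q \<theta> (s + real (q * l + t)) = (\<Sum>i\<le>n. E i * real l ^ i)"
      unfolding E(1)[symmetric] qphase_def by (simp add: algebra_simps)
    also have "\<dots> = E n * real l ^ n + (\<Sum>i\<le>Suc d. E i * real l ^ i)"
      by (simp add: d)
    also have "(\<Sum>i\<le>Suc d. E i * real l ^ i) = (\<Sum>i\<le>Suc d. c i * real l ^ i)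
        - (\<Sum>i\<le>Suc d. (if i = 0 then x * t else if i = 1 then x * q else 0) * real l ^ i)"
      by (simp only: c_def distrib_right sum.distrib)
    also have "(\<Sum>i\<le>Suc d. (if i = 0 then x * t else if i = 1 then x * q else 0) * real l ^ i)
        = (\<Sum>i\<in>{0, 1}. (if i = 0 then x * t else if i = 1 then x * q else 0) * real l ^ i)"
      by (rule sum.mono_neutral_right) auto
    also have "\<dots> = x * real (q * l + t)"
      by (simp add: algebra_simps)
    finally have "qphase A n q \<theta> (s + real (q * l + t)) + x * real (q * l + t) - (\<Sum>i\<le>Suc d. c i * real l ^ i) = E n * real l ^ n"
      by simp
    also have "\<dots> \<in> \<int>" using En by auto
    finally show "qphase A n q \<theta> (s + real (q * l + t)) + x * real (q * l + t) - (\<Sum>i\<le>Suc d. c i * real l ^ i) \<in> \<int>" .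
  qed
  then show ?thesis using cE d by (intro exI[of _ z]) simp
qed

text \<open>\<open>(m - t + q - 1) div q\<close> is the ceiling of \<open>(m - t) / q\<close>;
  truncated subtraction makes it 0 when \<open>t\<close> is at least \<open>m\<close>.\<close>

lemma sum_mod_classes:
  fixes f :: "nat \<Rightarrow> 'a::comm_monoid_add"
  assumes "0 < q"
  shows "(\<Sum>j<m. f j) = (\<Sum>t<q. \<Sum>l<(m - t + q - 1) div q. f (q * l + t))"
proof -
  define k where "k t = (m - t + q - 1) div q" for t
  have iff: "l < k t \<longleftrightarrow> q * l + t < m" for l t
  proof -
    have "l < k t \<longleftrightarrow> Suc l * q \<le> m - t + q - 1"
      using assms by (simp add: k_def less_eq_div_iff_mult_less_eq flip: Suc_le_eq)
    also have "\<dots> \<longleftrightarrow> q * l + t < m"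
      using assms by (auto simp: mult.commute)
    finally show ?thesis .
  qed
  show ?thesis unfolding k_def[symmetric]
    by (subst sum.Sigma, simp, simp, rule sum.reindex_bij_witness[of _ "\<lambda>(t, l). q * l + t" "\<lambda>j. (j mod q, j div q)"])
       (use assms in \<open>auto simp: iff\<close>)
qed

text \<open>One of the \<open>q\<close> classes carries at least the share \<open>1 / q\<close> of
  the sum, so \<open>T\<close> becomes \<open>q * T\<close>, while \<open>N\<close> stays because a
  class has at most \<open>N\<close> terms. The integer left over in the leading coefficient moves
  into \<open>a\<close>; thus the constant depends on none of \<open>s\<close>, \<open>x\<close> and
  \<open>\<theta>\<close>.\<close>

lemma weyl_inverse_qphase:
  fixes A :: "nat \<Rightarrow> int"
  assumes n: "3 \<le> n" and q: "0 < q"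
  shows "\<exists>K::nat. 1 \<le> K \<and> (\<forall>(T::real) (N::nat) m (x::real) (s::int) (\<theta>::real). 1 \<le> T \<longrightarrow> 1 \<le> N \<longrightarrow> m \<le> N \<longrightarrow>
      N \<le> cmod (\<Sum>j<m. ee (qphase A n q \<theta> (s + real j) + x * real j)) * T \<longrightarrow>
      (\<exists>(b::nat) (a::int). (1::nat) \<le> b \<and> b \<le> K * T ^ K \<and>
        \<bar>b * (real_of_int (int n * A n * int q ^ (n - 2)) * \<theta>) - a\<bar> * real N ^ (n - 1) \<le> K * T ^ K))"
proof -
  obtain K :: nat where K: "1 \<le> K" and W: "\<And>(T::real) (N::nat) m (\<beta>::real) F. 1 \<le> T \<Longrightarrow> 1 \<le> N \<Longrightarrow> m \<le> N \<Longrightarrow>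
      polyphase (n - 2) \<beta> F \<Longrightarrow> N \<le> cmod (\<Sum>l<m. ee (F l)) * T \<Longrightarrow>
      (\<exists>(b::nat) (a::int). (1::nat) \<le> b \<and> b \<le> K * T ^ K \<and> \<bar>b * \<beta> - a\<bar> * N ^ (n - 2 + 1) \<le> K * T ^ K)"
    using weyl_inverse[of "n - 2"] by blast
  define K' where "K' = K * q ^ K + K"
  have "\<exists>(b::nat) (a::int). (1::nat) \<le> b \<and> b \<le> K' * T ^ K' \<and>
        \<bar>b * (real_of_int (int n * A n * int q ^ (n - 2)) * \<theta>) - a\<bar> * real N ^ (n - 1) \<le> K' * T ^ K'"
    if T: "1 \<le> T" and N: "1 \<le> N" and m: "m \<le> N"
      and S: "N \<le> cmod (\<Sum>j<m. ee (qphase A n q \<theta> (s + real j) + x * real j)) * T"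
    for T x \<theta> :: real and N m :: nat and s :: int
  proof -
    let ?F = "\<lambda>t l. qphase A n q \<theta> (s + real (q * l + t)) + x * real (q * l + t)"
    let ?m = "\<lambda>t. (m - t + q - 1) div q"
    have Seq: "(\<Sum>j<m. ee (qphase A n q \<theta> (s + real j) + x * real j)) = (\<Sum>t<q. \<Sum>l<?m t. ee (?F t l))"
      by (rule sum_mod_classes[OF q])
    have "\<exists>t<q. N \<le> cmod (\<Sum>l<?m t. ee (?F t l)) * (q * T)"
    proof (rule ccontr)
      assume "\<not> ?thesis"
      then have *: "cmod (\<Sum>l<?m t. ee (?F t l)) * (q * T) < N" if "t < q" for t
        using that by (meson not_le)
      have "N * q \<le> cmod (\<Sum>t<q. \<Sum>l<?m t. ee (?F t l)) * T * q"
        unfolding Seq[symmetric] of_nat_mult using S by (rule mult_right_mono) simp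
      also have "\<dots> \<le> (\<Sum>t<q. cmod (\<Sum>l<?m t. ee (?F t l))) * T * q"
        using T by (intro mult_right_mono norm_sum) auto
      also have "\<dots> = (\<Sum>t<q. cmod (\<Sum>l<?m t. ee (?F t l)) * (q * T))"
        by (simp only: sum_distrib_right mult.assoc mult.commute[of "real q"])
      also have "\<dots> < (\<Sum>t<q. real N)"
        using * q by (intro sum_strict_mono) auto
      finally show False by (simp add: mult.commute)
    qed
    then obtain t where t: "t < q" "N \<le> cmod (\<Sum>l<?m t. ee (?F t l)) * (q * T)" by blast
    obtain z :: int where z: "polyphase (n - 2) (real_of_int (int n * A n * int q ^ (n - 2)) * \<theta> + z) (?F t)"
      using polyphase_qphase_progression[OF n q, of A \<theta> s t x] by blast
    have qT: "1 \<le> q * T" using q T mult_mono[of 1 "real q" 1 T] by simp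
    have "?m t \<le> N"
    proof -
      have "m * 1 \<le> m * q" using q by (intro mult_le_mono2) simp
      then have "m - t + q - 1 < Suc m * q"
        using q by (simp only: mult_Suc)
      then have "?m t < Suc m"
        using q by (simp add: less_mult_imp_div_less)
      then show ?thesis using m by simp
    qed
    from W[OF qT N this z t(2)] obtain b :: nat and a :: int where b: "1 \<le> b" "b \<le> K * (q * T) ^ K"
      "\<bar>b * (real_of_int (int n * A n * int q ^ (n - 2)) * \<theta> + z) - a\<bar> * N ^ (n - 2 + 1) \<le> K * (q * T) ^ K"
      by blast
    have "K * (q * T) ^ K = real (K * q ^ K) * T ^ K" by (simp add: power_mult_distrib)
    also have "\<dots> \<le> K' * T ^ K'"
      using T by (intro mult_mono power_increasing of_nat_mono) (auto simp: K'_def)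
    finally have KK: "K * (q * T) ^ K \<le> K' * T ^ K'" .
    have "\<bar>b * (real_of_int (int n * A n * int q ^ (n - 2)) * \<theta>) - real_of_int (a - b * z)\<bar> * real N ^ (n - 1)
       = \<bar>b * (real_of_int (int n * A n * int q ^ (n - 2)) * \<theta> + z) - a\<bar> * real N ^ (n - 2 + 1)"
    proof -
      have "n - 2 + 1 = n - 1" using n by simp
      moreover have "b * (real_of_int (int n * A n * int q ^ (n - 2)) * \<theta>) - real_of_int (a - b * z) =
          b * (real_of_int (int n * A n * int q ^ (n - 2)) * \<theta> + z) - a"
        by (simp add: algebra_simps)
      ultimately show ?thesis by (simp only:)
    qed
    then show ?thesis using b KK
      by (intro exI[of _ b] exI[of _ "a - int b * z"]) auto
  qed
  moreover have "1 \<le> K'" using K by (simp add: K'_def)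
  ultimately show ?thesis by blast
qed

section \<open>Slowly varying phases\<close>

lemma mono_threshold:
  fixes \<delta> :: "nat \<Rightarrow> real"
  assumes "a \<le> b" and mono: "\<And>j k. a \<le> j \<Longrightarrow> j \<le> k \<Longrightarrow> k < b \<Longrightarrow> \<delta> j \<le> \<delta> k"
  obtains c where "a \<le> c" "c \<le> b" "\<And>j. a \<le> j \<Longrightarrow> j < c \<Longrightarrow> \<delta> j < t" "\<And>j. c \<le> j \<Longrightarrow> j < b \<Longrightarrow> t \<le> \<delta> j"
proof -
  let ?P = "\<lambda>j. a \<le> j \<and> (j = b \<or> j < b \<and> t \<le> \<delta> j)"
  define c where "c = (LEAST j. ?P j)"
  have b: "?P b" using assms(1) by simp
  have c: "?P c" unfolding c_def using b by (rule LeastI)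
  have cb: "c \<le> b" unfolding c_def using b by (rule Least_le)
  show ?thesis
  proof
    show "a \<le> c" "c \<le> b" using c cb by auto
    show "\<delta> j < t" if "a \<le> j" "j < c" for j
      using not_less_Least[of j ?P] that cb unfolding c_def[symmetric] by auto
    show "t \<le> \<delta> j" if "c \<le> j" "j < b" for j
      using c mono[of c j] that by auto
  qed
qed

text \<open>Van der Corput's second derivative test for slopes near the single integer 0. Slopes
  that grow by \<open>l\<close> per step spend at most \<open>2 * \<kappa> / l + 1\<close> steps
  within \<open>\<kappa>\<close> of 0, where the trivial bound is used; on either side Kusmin-Landau
  gives \<open>1 / \<kappa>\<close>. The numbers \<open>5/8\<close> and \<open>3/8\<close> keep the
  slopes at distance \<open>\<kappa>\<close> from 1 and -1.\<close>

lemma second_difference_test_pos: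
  fixes \<phi> :: "nat \<Rightarrow> real"
  defines "\<delta> \<equiv> \<lambda>j. \<phi> (Suc j) - \<phi> j"
  assumes k: "0 < \<kappa>" "\<kappa> \<le> 3/8" and l: "0 < l"
    and d: "\<And>j. a \<le> j \<Longrightarrow> j < b \<Longrightarrow> \<bar>\<delta> j\<bar> \<le> 5/8"
    and dd: "\<And>j. a \<le> j \<Longrightarrow> Suc j < b \<Longrightarrow> l \<le> \<delta> (Suc j) - \<delta> j"
  shows "cmod (\<Sum>j\<in>{a..<b}. ee (\<phi> j)) \<le> 2 / \<kappa> + 2 * \<kappa> / l + 1"
proof (cases "a \<le> b")
  case False
  then show ?thesis using k l by (simp add: add_nonneg_nonneg)
next
  case True
  have growth: "real (k - j) * l \<le> \<delta> k - \<delta> j" if "a \<le> j" "j \<le> k" "k < b" for j k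
    using that(2,3)
  proof (induction k rule: dec_induct)
    case (step m)
    then show ?case using dd[of m] that(1) by (simp add: Suc_diff_le algebra_simps)
  qed simp
  have mono: "\<delta> j \<le> \<delta> k" if "a \<le> j" "j \<le> k" "k < b" for j k
  proof -
    have "0 \<le> real (k - j) * l" using l by simp
    then show ?thesis using growth[OF that] by linarith
  qed
  obtain c1 where c1: "a \<le> c1" "c1 \<le> b" "\<And>j. a \<le> j \<Longrightarrow> j < c1 \<Longrightarrow> \<delta> j < - \<kappa>" "\<And>j. c1 \<le> j \<Longrightarrow> j < b \<Longrightarrow> - \<kappa> \<le> \<delta> j"
    using mono_threshold[OF True, of \<delta> "- \<kappa>"] mono by blast
  obtain c2 where c2: "a \<le> c2" "c2 \<le> b" "\<And>j. a \<le> j \<Longrightarrow> j < c2 \<Longrightarrow> \<delta> j < \<kappa>" "\<And>j. c2 \<le> j \<Longrightarrow> j < b \<Longrightarrow> \<kappa> \<le> \<delta> j"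
    using mono_threshold[OF True, of \<delta> \<kappa>] mono by blast
  have c12: "c1 \<le> c2"
  proof (rule ccontr)
    assume "\<not> ?thesis"
    then have "\<delta> c2 < - \<kappa>" "\<kappa> \<le> \<delta> c2" using c1(3)[of c2] c2(1) c2(4)[of c2] c1(2) by auto
    then show False using k by simp
  qed
  have "{a..<b} = {a..<c1} \<union> {c1..<c2} \<union> {c2..<b}"
    using c1 c2 c12 by auto
  then have "(\<Sum>j\<in>{a..<b}. ee (\<phi> j)) = (\<Sum>j\<in>{a..<c1}. ee (\<phi> j)) + (\<Sum>j\<in>{c1..<c2}. ee (\<phi> j)) + (\<Sum>j\<in>{c2..<b}. ee (\<phi> j))"
    using c1(1,2) c2(1,2) c12 by (simp add: sum.atLeastLessThan_concat)
  also have "cmod \<dots> \<le> 1 / \<kappa> + (2 * \<kappa> / l + 1) + 1 / \<kappa>"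
  proof (intro order.trans[OF norm_triangle_ineq] add_mono)
    show "cmod (\<Sum>j\<in>{a..<c1}. ee (\<phi> j)) \<le> 1 / \<kappa>"
    proof (rule kusmin_landau[where z = "-1"])
      fix j assume j: "a \<le> j" "j < c1"
      show "real_of_int (- 1) + \<kappa> \<le> \<phi> (Suc j) - \<phi> j \<and> \<phi> (Suc j) - \<phi> j \<le> real_of_int (- 1) + 1 - \<kappa>"
        using c1(3)[OF j] d[of j] j c1(2) k by (auto simp: \<delta>_def)
    next
      show "(\<forall>j. a \<le> j \<and> Suc j < c1 \<longrightarrow> \<phi> (Suc j) - \<phi> j \<le> \<phi> (Suc (Suc j)) - \<phi> (Suc j)) \<or>
        (\<forall>j. a \<le> j \<and> Suc j < c1 \<longrightarrow> \<phi> (Suc (Suc j)) - \<phi> (Suc j) \<le> \<phi> (Suc j) - \<phi> j)"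
        using mono[of j "Suc j" for j] c1(2) by (auto simp: \<delta>_def)
    qed (use k in auto)
    show "cmod (\<Sum>j\<in>{c2..<b}. ee (\<phi> j)) \<le> 1 / \<kappa>"
    proof (rule kusmin_landau[where z = 0])
      fix j assume j: "c2 \<le> j" "j < b"
      show "real_of_int 0 + \<kappa> \<le> \<phi> (Suc j) - \<phi> j \<and> \<phi> (Suc j) - \<phi> j \<le> real_of_int 0 + 1 - \<kappa>"
        using c2(4)[OF j] d[of j] j c2(1) k by (auto simp: \<delta>_def)
    next
      show "(\<forall>j. c2 \<le> j \<and> Suc j < b \<longrightarrow> \<phi> (Suc j) - \<phi> j \<le> \<phi> (Suc (Suc j)) - \<phi> (Suc j)) \<or>
        (\<forall>j. c2 \<le> j \<and> Suc j < b \<longrightarrow> \<phi> (Suc (Suc j)) - \<phi> (Suc j) \<le> \<phi> (Suc j) - \<phi> j)"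
        using mono[of j "Suc j" for j] c2(1) by (auto simp: \<delta>_def)
    qed (use k in auto)
    have "cmod (\<Sum>j\<in>{c1..<c2}. ee (\<phi> j)) \<le> (\<Sum>j\<in>{c1..<c2}. 1)"
      by (rule order.trans[OF norm_sum]) simp
    also have "\<dots> = real (c2 - c1)" by simp
    also have "\<dots> \<le> 2 * \<kappa> / l + 1"
    proof (cases "c1 = c2")
      case False
      then have *: "c1 \<le> c2 - 1" "c2 - 1 < b" "c2 - 1 < c2" using c12 c2 by auto
      have "real (c2 - 1 - c1) * l \<le> \<delta> (c2 - 1) - \<delta> c1"
        using growth[of c1 "c2 - 1"] c1 * by auto
      also have "\<dots> \<le> 2 * \<kappa>"
        using c2(3)[of "c2 - 1"] c1(4)[of c1] c1(1) * by auto
      finally have "real (c2 - 1 - c1) \<le> 2 * \<kappa> / l" using l by (simp add: pos_le_divide_eq)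
      then show ?thesis using False c12 by linarith
    qed (use k l in auto)
    finally show "cmod (\<Sum>j\<in>{c1..<c2}. ee (\<phi> j)) \<le> 2 * \<kappa> / l + 1" .
  qed
  finally show ?thesis by simp
qed

lemma second_difference_test:
  fixes \<phi> :: "nat \<Rightarrow> real"
  defines "\<delta> \<equiv> \<lambda>j. \<phi> (Suc j) - \<phi> j"
  assumes s: "\<sigma> = 1 \<or> \<sigma> = (-1::real)" and l: "0 < l"
    and d: "\<And>j. a \<le> j \<Longrightarrow> j < b \<Longrightarrow> \<bar>\<delta> j\<bar> \<le> 5/8"
    and dd: "\<And>j. a \<le> j \<Longrightarrow> Suc j < b \<Longrightarrow> l \<le> \<sigma> * (\<delta> (Suc j) - \<delta> j)"
  shows "cmod (\<Sum>j\<in>{a..<b}. ee (\<phi> j)) \<le> 4 / sqrt l + 7"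
proof -
  \<comment> \<open>Balances \<open>2 / \<kappa>\<close> against \<open>2 * \<kappa> / l\<close>;
    the cap \<open>3/8\<close> costs only an additive constant.\<close>
  define \<kappa> where "\<kappa> = min (sqrt l) (3/8)"
  have k: "0 < \<kappa>" "\<kappa> \<le> 3/8" using l by (auto simp: \<kappa>_def)
  have "cmod (\<Sum>j\<in>{a..<b}. ee (\<phi> j)) \<le> 2 / \<kappa> + 2 * \<kappa> / l + 1"
    using s
  proof
    assume "\<sigma> = 1"
    then show ?thesis using d dd unfolding \<delta>_def
      by (intro second_difference_test_pos k l) auto
  next
    assume s: "\<sigma> = -1"
    have "cmod (\<Sum>j\<in>{a..<b}. ee (- \<phi> j)) \<le> 2 / \<kappa> + 2 * \<kappa> / l + 1"
    proof (rule second_difference_test_pos[OF k l])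
      fix j assume "a \<le> j" "j < b"
      from d[OF this] show "\<bar>- \<phi> (Suc j) - - \<phi> j\<bar> \<le> 5 / 8" by (simp add: \<delta>_def abs_minus_commute)
    next
      fix j assume "a \<le> j" "Suc j < b"
      from dd[OF this] s show "l \<le> - \<phi> (Suc (Suc j)) - - \<phi> (Suc j) - (- \<phi> (Suc j) - - \<phi> j)"
        by (simp add: \<delta>_def)
    qed
    moreover have "(\<Sum>j\<in>{a..<b}. ee (- \<phi> j)) = cnj (\<Sum>j\<in>{a..<b}. ee (\<phi> j))"
      by (simp add: ee_minus)
    ultimately show ?thesis by (simp only: complex_mod_cnj)
  qed
  also have "2 / \<kappa> \<le> 2 / sqrt l + 6"
    using l by (auto simp: \<kappa>_def min_def)
  also have "2 * \<kappa> / l \<le> 2 / sqrt l"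
  proof -
    have "2 * \<kappa> / l \<le> 2 * sqrt l / l" using l by (intro divide_right_mono) (auto simp: \<kappa>_def)
    also have "\<dots> = 2 / sqrt l" using l by (simp add: real_div_sqrt field_simps)
    finally show ?thesis .
  qed
  finally show ?thesis by simp
qed

text \<open>These are sums of sines over \<open>j\<close>, bounded uniformly in \<open>y\<close>
  although the sums of the single exponentials are not. Up to \<open>1 / y\<close> each term is at
  most a multiple of \<open>y\<close>; beyond it both exponentials have slopes at distance
  \<open>y\<close> from the integers, and Kusmin-Landau applies.\<close>

lemma symmetric_sine_sum:
  fixes y :: real
  assumes y: "\<bar>y\<bar> \<le> 1/2"
  shows "cmod (\<Sum>j\<in>{U<..V}. (ee (j * y) - ee (- (j * y))) / of_nat j) \<le> 4 * pi + 4"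
proof -
  have pos: "cmod (\<Sum>j\<in>{U<..V}. (ee (j * y) - ee (- (j * y))) / of_nat j) \<le> 4 * pi + 4"
    if y: "0 < y" "y \<le> 1/2" for y :: real
  proof -
    define W where "W = nat \<lfloor>1 / y\<rfloor>"
    have y2: "2 \<le> 1 / y" using y by (simp add: field_simps)
    have W: "real W \<le> 1 / y" "1 / (2 * y) \<le> W" "0 < W"
    proof -
      have "real W = \<lfloor>1 / y\<rfloor>" using y by (simp add: W_def)
      moreover have "1 / (2 * y) = (1 / y) / 2" by simp
      ultimately show "real W \<le> 1 / y" "1 / (2 * y) \<le> W" using y2 by linarith+
      then show "0 < W" using y by (metis less_le_trans of_nat_0_less_iff zero_less_divide_1_iff mult_pos_pos zero_less_numeral)
    qed
    define f where "f j = (ee (j * y) - ee (- (j * y))) / of_nat j" for j :: nat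
    have "{U<..V} = {U<..min V W} \<union> {max U W<..V}" "{U<..min V W} \<inter> {max U W<..V} = {}" by auto
    then have "(\<Sum>j\<in>{U<..V}. f j) = (\<Sum>j\<in>{U<..min V W}. f j) + (\<Sum>j\<in>{max U W<..V}. f j)"
      by (metis finite_greaterThanAtMost sum.union_disjoint)
    also have "cmod \<dots> \<le> 4 * pi + (2 + 2)"
    proof (intro order.trans[OF norm_triangle_ineq] add_mono)
      have "cmod (\<Sum>j\<in>{U<..min V W}. f j) \<le> (\<Sum>j\<in>{U<..min V W}. 4 * pi * y)"
      proof (intro order.trans[OF norm_sum] sum_mono)
        fix j assume j: "j \<in> {U<..min V W}"
        have "cmod (ee (j * y) - ee (- (j * y))) \<le> 2 * pi * \<bar>j * y - - (j * y)\<bar>"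
          by (rule norm_ee_diff_le)
        also have "\<dots> = 4 * pi * y * j" using y by simp
        finally show "cmod (f j) \<le> 4 * pi * y" using j by (simp add: f_def norm_divide field_simps)
      qed
      also have "\<dots> \<le> real W * (4 * pi * y)"
        using y by (simp only: sum_constant) (intro mult_right_mono, auto)
      also have "\<dots> \<le> 1 / y * (4 * pi * y)"
        using W y by (intro mult_right_mono) auto
      also have "\<dots> = 4 * pi" using y by simp
      finally show "cmod (\<Sum>j\<in>{U<..min V W}. f j) \<le> 4 * pi" .
      have "cmod (\<Sum>j\<in>{max U W<..V}. ee (s * (j * y)) / of_nat j) \<le> 2" if s: "s = 1 \<or> s = -1" for s :: real
      proof -
        have "cmod (\<Sum>j\<in>{max U W<..V}. ee (s * (j * y)) / of_nat j) \<le> (1 / y) / real (max U W)"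
        proof (rule norm_sum_over_le)
          fix k
          have "{max U W<..k} = {Suc (max U W)..<Suc k}" by auto
          moreover have "cmod (\<Sum>j\<in>{Suc (max U W)..<Suc k}. ee (s * (j * y))) \<le> 1 / y"
            by (rule kusmin_landau[where z = "if s = 1 then 0 else -1"])
               (use y s in \<open>auto simp: algebra_simps\<close>)
          ultimately show "cmod (\<Sum>j\<in>{max U W<..k}. ee (s * (j * y))) \<le> 1 / y" by simp
        qed (use W in auto)
        also have "\<dots> \<le> (1 / y) / (1 / (2 * y))"
          using W y by (intro divide_left_mono mult_pos_pos) (auto simp: max_def)
        also have "\<dots> = 2" using y by simp
        finally show ?thesis .
      qed
      from this[of 1] this[of "-1"]
      show "cmod (\<Sum>j\<in>{max U W<..V}. f j) \<le> 2 + 2"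
        unfolding f_def diff_divide_distrib sum_subtractf
        by (intro order.trans[OF norm_triangle_ineq4] add_mono) auto
    qed
    finally show ?thesis unfolding f_def by simp
  qed
  show ?thesis
  proof (cases y "0::real" rule: linorder_cases)
    case less
    have "(\<Sum>j\<in>{U<..V}. (ee (j * y) - ee (- (j * y))) / of_nat j) =
        - (\<Sum>j\<in>{U<..V}. (ee (j * (- y)) - ee (- (j * (- y)))) / of_nat j)"
      by (subst sum_negf[symmetric], intro sum.cong refl) (simp add: minus_divide_left)
    then show ?thesis using pos[of "- y"] less y by (simp only: norm_minus_cancel)
  next
    case equal
    then show ?thesis by (simp add: add_nonneg_nonneg)
  next
    case greater
    then show ?thesis using pos[of y] y by simp
  qed
qed

section \<open>Differences of a polynomial at two nearby shifts\<close>

lemma poly_mvt_between: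
  fixes p :: "real poly"
  obtains x where "min a b \<le> x" "x \<le> max a b" "poly p b - poly p a = (b - a) * poly (pderiv p) x"
proof -
  consider "a < b" | "b < a" | "a = b" by linarith
  then show ?thesis
  proof cases
    case 1
    from poly_MVT[OF this, of p] obtain x where "a < x" "x < b" "poly p b - poly p a = (b - a) * poly (pderiv p) x"
      by blast
    then show ?thesis using that[of x] by (auto simp: min_def max_def)
  next
    case 2
    from poly_MVT[OF this, of p] obtain x where "b < x" "x < a" "poly p a - poly p b = (a - b) * poly (pderiv p) x"
      by blast
    then show ?thesis using that[of x] by (auto simp: min_def max_def algebra_simps)
  qed (use that[of a] in auto)
qed

text \<open>The window from \<open>j - 2\<close> to \<open>j + 5\<close> contains all mean value
  points that arise between \<open>j\<close> and \<open>j + 2\<close> after shifts by at most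
  2.\<close>

lemma poly_growth:
  fixes S :: "real poly"
  assumes "S \<noteq> 0"
  obtains C c :: real and j0 :: nat and \<sigma> :: real where "0 < C" "0 < c" "\<sigma> = 1 \<or> \<sigma> = -1"
    "\<And>j y. j0 \<le> j \<Longrightarrow> real j - 2 \<le> y \<Longrightarrow> y \<le> real j + 5 \<Longrightarrow>
      \<bar>poly S y\<bar> \<le> C * real j ^ degree S \<and> c * real j ^ degree S \<le> \<sigma> * poly S y"
proof -
  define D where "D = degree S"
  define M where "M = (\<Sum>i\<le>D. \<bar>coeff S i\<bar>)"
  define L where "L = \<bar>lead_coeff S\<bar>"
  have L: "0 < L" using assms by (simp add: L_def)
  have LM: "L \<le> M" unfolding L_def M_def D_def by (rule member_le_sum) auto
  define \<sigma> where "\<sigma> = sgn (lead_coeff S)"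
  have s: "\<sigma> = 1 \<or> \<sigma> = -1" "\<sigma> * lead_coeff S = L" "\<bar>\<sigma>\<bar> = 1"
    using assms by (auto simp: \<sigma>_def L_def sgn_if)
  \<comment> \<open>From here on the lower terms amount to at most half of the leading one; the
    summand 4 makes \<open>y\<close> comparable to \<open>j\<close>.\<close>
  define j0 where "j0 = nat \<lceil>2 * M / L\<rceil> + 4"
  show ?thesis
  proof (rule that[of "M * 6 ^ D" "L / 2 / 2 ^ D" \<sigma> j0])
    show "0 < M * 6 ^ D" "0 < L / 2 / 2 ^ D" using L LM by auto
    show "\<sigma> = 1 \<or> \<sigma> = -1" by (fact s(1))
    fix j y assume j: "j0 \<le> j" and y: "real j - 2 \<le> y" "y \<le> real j + 5"
    have j4: "4 \<le> real j" "2 * M / L + 4 \<le> j" using j unfolding j0_def by linarith+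
    have y1: "1 \<le> y" "2 * M / L \<le> y" "y \<le> 6 * j" "real j / 2 \<le> y"
      using j4 y by linarith+
    have P: "poly S y = (\<Sum>i\<le>D. coeff S i * y ^ i)" by (simp add: poly_altdef D_def)
    have "\<bar>poly S y\<bar> \<le> (\<Sum>i\<le>D. \<bar>coeff S i\<bar> * (6 * real j) ^ D)"
      unfolding P
    proof (intro order.trans[OF sum_abs] sum_mono)
      fix i assume "i \<in> {..D}"
      have "y ^ i \<le> (6 * real j) ^ i" using y1 by (intro power_mono) auto
      also have "\<dots> \<le> (6 * real j) ^ D" using \<open>i \<in> {..D}\<close> j4 by (intro power_increasing) auto
      finally show "\<bar>coeff S i * y ^ i\<bar> \<le> \<bar>coeff S i\<bar> * (6 * real j) ^ D"
        using y1 by (simp add: abs_mult mult_left_mono)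
    qed
    also have "\<dots> = M * 6 ^ D * real j ^ D"
      by (simp only: M_def sum_distrib_right power_mult_distrib mult.assoc)
    finally have upper: "\<bar>poly S y\<bar> \<le> M * 6 ^ D * real j ^ D" .
    have "L / 2 * y ^ D \<le> \<sigma> * poly S y"
    proof (cases D)
      case 0
      then show ?thesis using s(2) L by (simp add: P D_def)
    next
      case (Suc d)
      have "\<bar>\<sigma> * (\<Sum>i\<le>d. coeff S i * y ^ i)\<bar> \<le> M * y ^ d"
      proof -
        have "\<bar>\<sigma> * (\<Sum>i\<le>d. coeff S i * y ^ i)\<bar> \<le> (\<Sum>i\<le>d. \<bar>coeff S i\<bar> * y ^ d)"
          unfolding abs_mult s(3) mult_1
        proof (intro order.trans[OF sum_abs] sum_mono)
          fix i assume "i \<in> {..d}"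
          then have "y ^ i \<le> y ^ d" using y1 by (intro power_increasing) auto
          then show "\<bar>coeff S i * y ^ i\<bar> \<le> \<bar>coeff S i\<bar> * y ^ d"
            using y1 by (simp add: abs_mult mult_left_mono)
        qed
        also have "\<dots> \<le> M * y ^ d"
          unfolding sum_distrib_right[symmetric] M_def Suc using y1 by (intro mult_right_mono sum_mono2) auto
        finally show ?thesis .
      qed
      also have "M * y ^ d \<le> L / 2 * y * y ^ d"
        using y1 L by (intro mult_right_mono) (auto simp: field_simps)
      finally have "- (L / 2 * y ^ D) \<le> \<sigma> * (\<Sum>i\<le>d. coeff S i * y ^ i)" by (simp add: Suc mult_ac)
      moreover have "\<sigma> * poly S y = L * y ^ D + \<sigma> * (\<Sum>i\<le>d. coeff S i * y ^ i)"
        using s(2) by (simp add: P Suc D_def[symmetric] algebra_simps)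
      ultimately show ?thesis by simp
    qed
    moreover have "L / 2 / 2 ^ D * real j ^ D \<le> L / 2 * y ^ D"
    proof -
      have "L / 2 * (real j / 2) ^ D \<le> L / 2 * y ^ D"
        using y1 L by (intro mult_left_mono power_mono) auto
      then show ?thesis by (simp add: power_divide)
    qed
    ultimately show "\<bar>poly S y\<bar> \<le> M * 6 ^ D * real j ^ degree S \<and> L / 2 / 2 ^ D * real j ^ degree S \<le> \<sigma> * poly S y"
      using upper by (simp add: D_def)
  qed
qed

text \<open>Models \<open>R j = Q (j + \<theta>) - Q (j + r)\<close> with \<open>Q\<close> of degree
  \<open>d + 3\<close> and \<open>\<Delta> = \<bar>\<theta> - r\<bar>\<close>, which grows like
  \<open>\<Delta>\<close> times the derivative of \<open>Q\<close>. Size and slope are bounded from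
  above, the second difference from below with a fixed sign, as the second difference test
  requires.\<close>

definition slow_phase :: "real \<Rightarrow> real \<Rightarrow> real \<Rightarrow> nat \<Rightarrow> nat \<Rightarrow> real \<Rightarrow> (nat \<Rightarrow> real) \<Rightarrow> bool" where
  "slow_phase C c \<Delta> d j0 \<sigma> R \<longleftrightarrow> (\<sigma> = 1 \<or> \<sigma> = -1) \<and> (\<forall>j\<ge>j0. \<bar>R j\<bar> \<le> C * \<Delta> * real j ^ (d + 2) \<and>
     \<bar>R (Suc j) - R j\<bar> \<le> C * \<Delta> * real j ^ (d + 1) \<and>
     c * \<Delta> * real j ^ d \<le> \<sigma> * (R (Suc (Suc j)) - 2 * R (Suc j) + R j))"

lemma slow_phaseD:
  assumes "slow_phase C c \<Delta> d j0 \<sigma> R" "j0 \<le> j"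
  shows "\<bar>R j\<bar> \<le> C * \<Delta> * real j ^ (d + 2)" "\<bar>R (Suc j) - R j\<bar> \<le> C * \<Delta> * real j ^ (d + 1)"
    "c * \<Delta> * real j ^ d \<le> \<sigma> * (R (Suc (Suc j)) - 2 * R (Suc j) + R j)"
  using assms unfolding slow_phase_def by blast+

text \<open>Mean values are taken once in the shift from \<open>r\<close> to
  \<open>\<theta>\<close>, which yields the factor \<open>\<theta> - r\<close>, and once for each
  difference in \<open>j\<close>. The growth of the first three derivatives of \<open>Q\<close> then
  gives constants that are uniform in \<open>\<theta>\<close> and \<open>r\<close>.\<close>

lemma slow_phase_poly_difference:
  fixes Q :: "real poly"
  assumes deg: "degree Q = d + 3"
  shows "\<exists>C c j0 \<sigma>. 0 < C \<and> 0 < c \<and> (\<forall>\<theta> r. \<bar>\<theta>\<bar> \<le> 2 \<longrightarrow> \<bar>r\<bar> \<le> 2 \<longrightarrow> \<theta> \<noteq> r \<longrightarrow>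
     slow_phase C c \<bar>\<theta> - r\<bar> d j0 (\<sigma> * sgn (\<theta> - r)) (\<lambda>j. poly Q (real j + \<theta>) - poly Q (real j + r)))"
proof -
  define Q1 where "Q1 = pderiv Q"
  define Q2 where "Q2 = pderiv Q1"
  define Q3 where "Q3 = pderiv Q2"
  have degs: "degree Q1 = d + 2" "degree Q2 = d + 1" "degree Q3 = d"
    using deg by (simp_all add: Q1_def Q2_def Q3_def degree_pderiv)
  have nz: "Q1 \<noteq> 0" "Q2 \<noteq> 0" "Q3 \<noteq> 0"
    using degs by (auto simp: Q3_def pderiv_eq_0_iff)
  obtain C1 c1 j1 \<sigma>1 where g1: "0 < C1" "\<And>j y. j1 \<le> j \<Longrightarrow> real j - 2 \<le> y \<Longrightarrow> y \<le> real j + 5 \<Longrightarrow>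
      \<bar>poly Q1 y\<bar> \<le> C1 * real j ^ degree Q1 \<and> c1 * real j ^ degree Q1 \<le> \<sigma>1 * poly Q1 y"
    by (rule poly_growth[OF nz(1)]) blast
  obtain C2 c2 j2 \<sigma>2 where g2: "0 < C2" "\<And>j y. j2 \<le> j \<Longrightarrow> real j - 2 \<le> y \<Longrightarrow> y \<le> real j + 5 \<Longrightarrow>
      \<bar>poly Q2 y\<bar> \<le> C2 * real j ^ degree Q2 \<and> c2 * real j ^ degree Q2 \<le> \<sigma>2 * poly Q2 y"
    by (rule poly_growth[OF nz(2)]) blast
  obtain C3 c3 j3 \<sigma>3 where g3: "0 < c3" "\<sigma>3 = 1 \<or> \<sigma>3 = -1" "\<And>j y. j3 \<le> j \<Longrightarrow> real j - 2 \<le> y \<Longrightarrow> y \<le> real j + 5 \<Longrightarrow>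
      \<bar>poly Q3 y\<bar> \<le> C3 * real j ^ degree Q3 \<and> c3 * real j ^ degree Q3 \<le> \<sigma>3 * poly Q3 y"
    by (rule poly_growth[OF nz(3)]) blast
  have "slow_phase (C1 + C2) c3 \<bar>\<theta> - r\<bar> d (j1 + j2 + j3) (\<sigma>3 * sgn (\<theta> - r)) (\<lambda>j. poly Q (real j + \<theta>) - poly Q (real j + r))"
    if b: "\<bar>\<theta>\<bar> \<le> 2" "\<bar>r\<bar> \<le> 2" "\<theta> \<noteq> r" for \<theta> r
  proof -
    define G where "G = pcompose Q [:\<theta>, 1:] - pcompose Q [:r, 1:]"
    define G1 where "G1 = pderiv G"
    define G2 where "G2 = pderiv G1"
    have G: "poly G y = poly Q (y + \<theta>) - poly Q (y + r)"
      "poly G1 y = poly Q1 (y + \<theta>) - poly Q1 (y + r)"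
      "poly G2 y = poly Q2 (y + \<theta>) - poly Q2 (y + r)" for y
      by (simp_all add: G_def G1_def G2_def Q1_def Q2_def poly_pcompose pderiv_diff pderiv_pcompose pderiv_pCons add.commute)
    have sg: "sgn (\<theta> - r) * (\<theta> - r) = \<bar>\<theta> - r\<bar>" by (simp add: sgn_if)
    show ?thesis
      unfolding slow_phase_def
    proof (intro conjI allI impI)
      show "\<sigma>3 * sgn (\<theta> - r) = 1 \<or> \<sigma>3 * sgn (\<theta> - r) = - 1"
        using g3(2) b(3) by (auto simp: sgn_if)
      fix j assume j: "j1 + j2 + j3 \<le> j"
      obtain x where x: "min (j + r) (j + \<theta>) \<le> x" "x \<le> max (j + r) (j + \<theta>)"
        "poly Q (j + \<theta>) - poly Q (j + r) = (j + \<theta> - (j + r)) * poly Q1 x"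
        unfolding Q1_def by (rule poly_mvt_between)
      have "\<bar>poly Q1 x\<bar> \<le> C1 * real j ^ (d + 2)"
        using g1(2)[of j x] x(1,2) b j degs by auto
      also have "\<dots> \<le> (C1 + C2) * real j ^ (d + 2)"
        using g2(1) by (intro mult_right_mono) auto
      finally have "\<bar>\<theta> - r\<bar> * \<bar>poly Q1 x\<bar> \<le> \<bar>\<theta> - r\<bar> * ((C1 + C2) * real j ^ (d + 2))"
        by (intro mult_left_mono) auto
      then show "\<bar>poly Q (j + \<theta>) - poly Q (j + r)\<bar> \<le> (C1 + C2) * \<bar>\<theta> - r\<bar> * real j ^ (d + 2)"
        unfolding x(3) by (simp add: abs_mult mult_ac)
      obtain x1 where x1: "min (real j) (real j + 1) \<le> x1" "x1 \<le> max (real j) (real j + 1)"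
        "poly G (real j + 1) - poly G (real j) = (real j + 1 - real j) * poly G1 x1"
        unfolding G1_def by (rule poly_mvt_between)
      obtain x2 where x2: "min (x1 + r) (x1 + \<theta>) \<le> x2" "x2 \<le> max (x1 + r) (x1 + \<theta>)"
        "poly Q1 (x1 + \<theta>) - poly Q1 (x1 + r) = (x1 + \<theta> - (x1 + r)) * poly Q2 x2"
        unfolding Q2_def by (rule poly_mvt_between)
      have "\<bar>poly Q2 x2\<bar> \<le> C2 * real j ^ (d + 1)"
        using g2(2)[of j x2] x1(1,2) x2(1,2) b j degs by auto
      also have "\<dots> \<le> (C1 + C2) * real j ^ (d + 1)"
        using g1(1) by (intro mult_right_mono) auto
      finally have "\<bar>\<theta> - r\<bar> * \<bar>poly Q2 x2\<bar> \<le> \<bar>\<theta> - r\<bar> * ((C1 + C2) * real j ^ (d + 1))"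
        by (intro mult_left_mono) auto
      moreover have "poly Q (Suc j + \<theta>) - poly Q (Suc j + r) - (poly Q (j + \<theta>) - poly Q (j + r)) = (\<theta> - r) * poly Q2 x2"
        using x1(3) x2(3) by (simp add: G add_ac)
      ultimately show "\<bar>poly Q (Suc j + \<theta>) - poly Q (Suc j + r) - (poly Q (j + \<theta>) - poly Q (j + r))\<bar>
          \<le> (C1 + C2) * \<bar>\<theta> - r\<bar> * real j ^ (d + 1)"
        by (simp add: abs_mult mult_ac)
      define H where "H = pcompose G [:1, 1:] - G"
      have H: "poly H y = poly G (y + 1) - poly G y" "poly (pderiv H) y = poly G1 (y + 1) - poly G1 y" for y
        by (simp_all add: H_def G1_def poly_pcompose pderiv_diff pderiv_pcompose pderiv_pCons add.commute)
      obtain z where z: "min (real j) (real j + 1) \<le> z" "z \<le> max (real j) (real j + 1)"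
        "poly H (real j + 1) - poly H (real j) = (real j + 1 - real j) * poly (pderiv H) z"
        by (rule poly_mvt_between)
      obtain z1 where z1: "min z (z + 1) \<le> z1" "z1 \<le> max z (z + 1)"
        "poly G1 (z + 1) - poly G1 z = (z + 1 - z) * poly G2 z1"
        unfolding G2_def by (rule poly_mvt_between)
      obtain z2 where z2: "min (z1 + r) (z1 + \<theta>) \<le> z2" "z2 \<le> max (z1 + r) (z1 + \<theta>)"
        "poly Q2 (z1 + \<theta>) - poly Q2 (z1 + r) = (z1 + \<theta> - (z1 + r)) * poly Q3 z2"
        unfolding Q3_def by (rule poly_mvt_between)
      have "c3 * real j ^ d \<le> \<sigma>3 * poly Q3 z2"
        using g3(3)[of j z2] z(1,2) z1(1,2) z2(1,2) b j degs by auto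
      then have "\<bar>\<theta> - r\<bar> * (c3 * real j ^ d) \<le> \<bar>\<theta> - r\<bar> * (\<sigma>3 * poly Q3 z2)"
        by (intro mult_left_mono) auto
      also have "\<dots> = \<sigma>3 * sgn (\<theta> - r) * ((\<theta> - r) * poly Q3 z2)"
        by (simp add: sg[symmetric] mult_ac)
      also have "(\<theta> - r) * poly Q3 z2 = poly Q (Suc (Suc j) + \<theta>) - poly Q (Suc (Suc j) + r) -
          2 * (poly Q (Suc j + \<theta>) - poly Q (Suc j + r)) + (poly Q (j + \<theta>) - poly Q (j + r))"
        using z(3) z1(3) z2(3) by (simp add: G H add_ac)
      finally show "c3 * \<bar>\<theta> - r\<bar> * real j ^ d \<le> \<sigma>3 * sgn (\<theta> - r) * (poly Q (Suc (Suc j) + \<theta>) - poly Q (Suc (Suc j) + r) -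
          2 * (poly Q (Suc j + \<theta>) - poly Q (Suc j + r)) + (poly Q (j + \<theta>) - poly Q (j + r)))"
        by (simp add: mult_ac)
    qed
  qed
  then show ?thesis using g1(1) g2(1) g3(1)
    by (intro exI[of _ "C1 + C2"] exI[of _ c3] exI[of _ "j1 + j2 + j3"] exI[of _ \<sigma>3]) auto
qed

section \<open>Slow phases combined with a linear phase\<close>

lemma sum_Ioc_split:
  fixes f :: "nat \<Rightarrow> 'a::comm_monoid_add"
  assumes "a \<le> b" "b \<le> c"
  shows "(\<Sum>j\<in>{a<..c}. f j) = (\<Sum>j\<in>{a<..b}. f j) + (\<Sum>j\<in>{b<..c}. f j)"
proof -
  have "{a<..c} = {a<..b} \<union> {b<..c}" using assms by auto
  then show ?thesis by (simp only:) (rule sum.union_disjoint, auto)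
qed

lemma sum_dyadic:
  fixes f :: "nat \<Rightarrow> 'a::comm_monoid_add"
  assumes "a \<le> b"
  shows "(\<Sum>j\<in>{2 ^ a<..2 ^ b}. f j) = (\<Sum>k\<in>{a..<b}. \<Sum>j\<in>{2 ^ k<..2 ^ Suc k}. f j)"
  using assms
proof (induction b rule: dec_induct)
  case (step b)
  have "(\<Sum>j\<in>{2 ^ a<..2 ^ Suc b}. f j) = (\<Sum>j\<in>{2 ^ a<..2 ^ b}. f j) + (\<Sum>j\<in>{2 ^ b<..2 ^ Suc b}. f j)"
    using step.hyps by (intro sum_Ioc_split power_increasing) auto
  then show ?case using step by simp
qed simp

lemma sum_inverse_power_two_le:
  "(\<Sum>k\<in>{a..<b}. 1 / 2 ^ (k - a) :: real) \<le> 2"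
proof (cases "a \<le> b")
  case True
  have eq: "(\<Sum>k\<in>{a..<b}. 1 / 2 ^ (k - a) :: real) = 2 - 2 / 2 ^ (b - a)"
    using True
  proof (induction b rule: dec_induct)
    case (step m)
    then show ?case by (simp add: Suc_diff_le field_simps)
  qed simp
  then show ?thesis by simp
qed simp

text \<open>In the block at \<open>U = 2 ^ k\<close> the second difference is at least
  \<open>c * \<Delta> * U ^ d\<close>, so after division by \<open>U\<close> the main term is of
  order \<open>1 / sqrt (\<Delta> * U ^ (d + 2))\<close>. It decays geometrically once
  \<open>\<Delta> * U ^ (d + 2)\<close> has reached 1, which is the hypothesis
  \<open>large\<close>.\<close>

lemma slow_sum_tail:
  assumes R: "slow_phase C c \<Delta> d j0 \<sigma> R" and pos: "0 < c" "0 < \<Delta>" and j0: "j0 \<le> 2 ^ a"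
    and large: "1 \<le> \<Delta> * (2 ^ a) ^ (d + 2)"
    and step: "\<And>j. 2 ^ a \<le> j \<Longrightarrow> j \<le> 2 ^ b \<Longrightarrow> \<bar>R (Suc j) - R j\<bar> \<le> 1/8" and y: "\<bar>y\<bar> \<le> 1/2"
  shows "cmod (\<Sum>j\<in>{2 ^ a<..2 ^ b}. ee (R j + j * y) / of_nat j) \<le> 8 / sqrt c + 14"
proof (cases "a \<le> b")
  case True
  have block: "cmod (\<Sum>j\<in>{2 ^ k<..2 ^ Suc k}. ee (R j + j * y) / of_nat j) \<le> (4 / sqrt c + 7) * (1 / 2 ^ (k - a))"
    if k: "k \<in> {a..<b}" for k
  proof -
    define U :: nat where "U = 2 ^ k"
    define l where "l = c * \<Delta> * real U ^ d"
    have U: "0 < U" "2 ^ a \<le> U" "2 * U \<le> 2 ^ b"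
      using k power_increasing[of a k "2::nat"] power_increasing[of "Suc k" b "2::nat"] by (auto simp: U_def)
    have l: "0 < l" using pos U by (simp add: l_def)
    have sR: "\<sigma> = 1 \<or> \<sigma> = -1" using R by (simp add: slow_phase_def)
    have "cmod (\<Sum>j\<in>{U<..2 * U}. ee (R j + j * y) / of_nat j) \<le> (4 / sqrt l + 7) / U"
    proof (rule norm_sum_over_le[OF _ U(1)])
      fix m assume m: "m \<le> 2 * U"
      have "cmod (\<Sum>j\<in>{Suc U..<Suc m}. ee (R j + j * y)) \<le> 4 / sqrt l + 7"
      proof (rule second_difference_test[OF sR l])
        fix j assume j: "Suc U \<le> j" "j < Suc m"
        then have "\<bar>R (Suc j) - R j\<bar> \<le> 1/8" using U m by (intro step) auto
        moreover have "R (Suc j) + Suc j * y - (R j + j * y) = (R (Suc j) - R j) + y"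
          by (simp add: algebra_simps)
        ultimately show "\<bar>R (Suc j) + Suc j * y - (R j + j * y)\<bar> \<le> 5/8" using y by linarith
      next
        fix j assume j: "Suc U \<le> j" "Suc j < Suc m"
        have "l \<le> c * \<Delta> * real j ^ d"
          unfolding l_def using j pos by (intro mult_left_mono power_mono) auto
        also have "\<dots> \<le> \<sigma> * (R (Suc (Suc j)) - 2 * R (Suc j) + R j)"
          using slow_phaseD(3)[OF R, of j] j j0 U(2) by linarith
        also have "R (Suc (Suc j)) - 2 * R (Suc j) + R j = R (Suc (Suc j)) + Suc (Suc j) * y - (R (Suc j) + Suc j * y) -
            (R (Suc j) + Suc j * y - (R j + j * y))"
          by (simp add: algebra_simps)
        finally show "l \<le> \<sigma> * (R (Suc (Suc j)) + Suc (Suc j) * y - (R (Suc j) + Suc j * y) -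
            (R (Suc j) + Suc j * y - (R j + j * y)))" .
      qed
      moreover have "{U<..m} = {Suc U..<Suc m}" by auto
      ultimately show "cmod (\<Sum>j\<in>{U<..m}. ee (R j + j * y)) \<le> 4 / sqrt l + 7" by simp
    qed
    also have "\<dots> = 4 / (sqrt l * U) + 7 / U" by (simp add: add_divide_distrib)
    also have "\<dots> \<le> 4 / (sqrt c * 2 ^ (k - a)) + 7 / 2 ^ (k - a)"
    proof (intro add_mono)
      have Uk: "real U = 2 ^ a * 2 ^ (k - a)" using k by (simp add: U_def flip: power_add)
      have "(2 ^ (k - a))\<^sup>2 \<le> ((2::real) ^ (k - a)) ^ (d + 2)"
        by (intro power_increasing) auto
      also have "\<dots> = 1 * (2 ^ (k - a)) ^ (d + 2)" by simp
      also have "\<dots> \<le> (\<Delta> * (2 ^ a) ^ (d + 2)) * (2 ^ (k - a)) ^ (d + 2)"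
        using large by (rule mult_right_mono) simp
      also have "\<dots> = \<Delta> * real U ^ (d + 2)" by (simp only: Uk power_mult_distrib mult.assoc)
      finally have "c * (2 ^ (k - a))\<^sup>2 \<le> c * (\<Delta> * real U ^ (d + 2))"
        using pos by (intro mult_left_mono) auto
      also have "\<dots> = l * (real U)\<^sup>2" by (simp add: l_def power_add power2_eq_square)
      finally have "sqrt (c * (2 ^ (k - a))\<^sup>2) \<le> sqrt (l * (real U)\<^sup>2)" by (rule real_sqrt_le_mono)
      then have "sqrt c * 2 ^ (k - a) \<le> sqrt l * U" by (simp add: real_sqrt_mult)
      then show "4 / (sqrt l * U) \<le> 4 / (sqrt c * 2 ^ (k - a))"
        using pos l U by (intro divide_left_mono mult_pos_pos) auto
      have "2 ^ (k - a) \<le> real U" unfolding Uk by simp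
      then show "7 / real U \<le> 7 / 2 ^ (k - a)"
        using U by (intro divide_left_mono) auto
    qed
    also have "\<dots> = (4 / sqrt c + 7) * (1 / 2 ^ (k - a))" by (simp add: field_simps)
    finally show ?thesis by (simp add: U_def)
  qed
  have "cmod (\<Sum>j\<in>{2 ^ a<..2 ^ b}. ee (R j + j * y) / of_nat j) \<le>
      (\<Sum>k\<in>{a..<b}. (4 / sqrt c + 7) * (1 / 2 ^ (k - a)))"
    unfolding sum_dyadic[OF True] by (rule order.trans[OF norm_sum], rule sum_mono, rule block)
  also have "\<dots> = (4 / sqrt c + 7) * (\<Sum>k\<in>{a..<b}. 1 / 2 ^ (k - a))"
    by (simp only: sum_distrib_left)
  also have "\<dots> \<le> (4 / sqrt c + 7) * 2"
    using pos by (intro mult_left_mono sum_inverse_power_two_le) auto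
  finally show ?thesis by simp
next
  case False
  then have "(2::nat) ^ b \<le> 2 ^ a" by (intro power_increasing) auto
  then show ?thesis using pos by simp
qed

text \<open>Here \<open>y\<close> may be arbitrarily small, and then only the cancellation between
  \<open>j\<close> and \<open>- j\<close> helps. The range is cut where the size
  \<open>\<Delta> * j ^ (d + 2)\<close> of the phases reaches 1: before the cut both phases are
  dropped and a sine sum remains, after it each sign is bounded on its own.\<close>

lemma slow_sum_near:
  assumes R: "slow_phase C c \<Delta> d j0 \<sigma> R" "slow_phase C c \<Delta> d j0 \<sigma>' R'"
    and pos: "0 < C" "0 < c" "0 < \<Delta>" and j0: "j0 \<le> 2 ^ a" and ab: "a \<le> b"
    and step: "\<And>j. 2 ^ a \<le> j \<Longrightarrow> j \<le> 2 ^ b \<Longrightarrow> \<bar>R (Suc j) - R j\<bar> \<le> 1/8"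
      "\<And>j. 2 ^ a \<le> j \<Longrightarrow> j \<le> 2 ^ b \<Longrightarrow> \<bar>R' (Suc j) - R' j\<bar> \<le> 1/8" and y: "\<bar>y\<bar> \<le> 1/2"
  shows "cmod (\<Sum>j\<in>{2 ^ a<..2 ^ b}. (ee (R j + j * y) - ee (R' j + - (j * y))) / of_nat j) \<le>
    4 * pi * C * 2 ^ (d + 2) + (4 * pi + 4) + 2 * (8 / sqrt c + 14)"
proof -
  \<comment> \<open>The least such scale is where the phases cease to be small, or \<open>b\<close>
    if they never do.\<close>
  let ?P = "\<lambda>k. a \<le> k \<and> (k = b \<or> k < b \<and> 1 \<le> \<Delta> * (2 ^ k) ^ (d + 2))"
  define s where "s = (LEAST k. ?P k)"
  have Pb: "?P b" using ab by simp
  have Ps: "?P s" unfolding s_def using Pb by (rule LeastI)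
  have sb: "s \<le> b" unfolding s_def using Pb by (rule Least_le)
  have small: "\<Delta> * (2 ^ s) ^ (d + 2) \<le> 2 ^ (d + 2)" if as: "a < s"
  proof -
    obtain s' where s': "s = Suc s'" using as by (cases s) auto
    have "\<not> ?P s'" using not_less_Least[of s' ?P] unfolding s_def[symmetric] s' by simp
    then have "\<Delta> * (2 ^ s') ^ (d + 2) \<le> 1" using as s' sb by auto
    then have "\<Delta> * (2 ^ s') ^ (d + 2) * 2 ^ (d + 2) \<le> 1 * 2 ^ (d + 2)" by (intro mult_right_mono) auto
    then show ?thesis by (simp only: s' power_Suc power_mult_distrib mult_ac mult_1)
  qed
  define f where "f j = (ee (R j + j * y) - ee (R' j + - (j * y))) / of_nat j" for j :: nat
  have le: "(2::nat) ^ a \<le> 2 ^ s" "(2::nat) ^ s \<le> 2 ^ b" using Ps sb by (auto intro: power_increasing)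
  have "(\<Sum>j\<in>{2 ^ a<..2 ^ b}. f j) = (\<Sum>j\<in>{2 ^ a<..2 ^ s}. f j) + (\<Sum>j\<in>{2 ^ s<..2 ^ b}. f j)"
    by (rule sum_Ioc_split[OF le])
  also have "cmod \<dots> \<le> (4 * pi * C * 2 ^ (d + 2) + (4 * pi + 4)) + 2 * (8 / sqrt c + 14)"
  proof (intro order.trans[OF norm_triangle_ineq] add_mono)
    show "cmod (\<Sum>j\<in>{2 ^ a<..2 ^ s}. f j) \<le> 4 * pi * C * 2 ^ (d + 2) + (4 * pi + 4)"
    proof (cases "a < s")
      case True
      define J :: nat where "J = 2 ^ s"
      have "(\<Sum>j\<in>{2 ^ a<..J}. f j) = (\<Sum>j\<in>{2 ^ a<..J}. f j - (ee (j * y) - ee (- (j * y))) / of_nat j)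
         + (\<Sum>j\<in>{2 ^ a<..J}. (ee (j * y) - ee (- (j * y))) / of_nat j)"
        by (simp add: sum_subtractf)
      also have "cmod \<dots> \<le> 4 * pi * C * 2 ^ (d + 2) + (4 * pi + 4)"
      proof (intro order.trans[OF norm_triangle_ineq] add_mono symmetric_sine_sum y)
        \<comment> \<open>Dropping the phases changes term \<open>j\<close> by at most
          \<open>4 * pi * C * \<Delta> * j ^ (d + 1)\<close>. Over \<open>J\<close> terms this is a
          multiple of \<open>\<Delta> * J ^ (d + 2)\<close>, which the minimality of
          \<open>s\<close> bounds.\<close>
        have "cmod (\<Sum>j\<in>{2 ^ a<..J}. f j - (ee (j * y) - ee (- (j * y))) / of_nat j) \<le>
            (\<Sum>j\<in>{2 ^ a<..J}. 4 * pi * C * \<Delta> * real J ^ (d + 1))"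
        proof (intro order.trans[OF norm_sum] sum_mono)
          fix j assume j: "j \<in> {2 ^ a<..J}"
          have j0': "j0 \<le> j" "0 < j" using j j0 by auto
          have "f j - (ee (j * y) - ee (- (j * y))) / of_nat j =
              ((ee (R j + j * y) - ee (j * y)) - (ee (R' j + - (j * y)) - ee (- (j * y)))) / of_nat j"
            by (simp add: f_def diff_divide_distrib)
          also have "cmod \<dots> \<le> (2 * pi * (C * \<Delta> * real j ^ (d + 2)) + 2 * pi * (C * \<Delta> * real j ^ (d + 2))) / j"
          proof -
            have "cmod (ee (R j + j * y) - ee (j * y)) \<le> 2 * pi * (C * \<Delta> * real j ^ (d + 2))"
              using slow_phaseD(1)[OF R(1) j0'(1)]
              by (intro order.trans[OF norm_ee_diff_le] mult_left_mono) auto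
            moreover have "cmod (ee (R' j + - (j * y)) - ee (- (j * y))) \<le> 2 * pi * (C * \<Delta> * real j ^ (d + 2))"
              using slow_phaseD(1)[OF R(2) j0'(1)]
              by (intro order.trans[OF norm_ee_diff_le] mult_left_mono) auto
            ultimately show ?thesis
              unfolding norm_divide norm_of_nat
              by (rule divide_right_mono[OF norm_triangle_le_diff[OF add_mono]]) simp
          qed
          also have "\<dots> = 4 * pi * C * \<Delta> * real j ^ (d + 1)"
            using j0' by (simp add: field_simps)
          also have "\<dots> \<le> 4 * pi * C * \<Delta> * real J ^ (d + 1)"
            using j pos by (intro mult_left_mono power_mono) auto
          finally show "cmod (f j - (ee (j * y) - ee (- (j * y))) / of_nat j) \<le> 4 * pi * C * \<Delta> * real J ^ (d + 1)" .
        qed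
        also have "\<dots> \<le> J * (4 * pi * C * \<Delta> * real J ^ (d + 1))"
          using pos by (simp only: sum_constant) (intro mult_right_mono, auto)
        also have "\<dots> = 4 * pi * C * (\<Delta> * (2 ^ s) ^ (d + 2))"
          by (simp add: J_def)
        also have "\<dots> \<le> 4 * pi * C * 2 ^ (d + 2)"
          using small[OF True] pos by (intro mult_left_mono) auto
        finally show "cmod (\<Sum>j\<in>{2 ^ a<..J}. f j - (ee (j * y) - ee (- (j * y))) / of_nat j) \<le> 4 * pi * C * 2 ^ (d + 2)" .
      qed
      finally show ?thesis by (simp add: J_def)
    next
      case False
      then have "s = a" using Ps by auto
      then show ?thesis using pos by (simp add: add_nonneg_nonneg)
    qed
    have "cmod (\<Sum>j\<in>{2 ^ s<..2 ^ b}. ee (R j + j * y) / of_nat j) \<le> 8 / sqrt c + 14 \<and>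
        cmod (\<Sum>j\<in>{2 ^ s<..2 ^ b}. ee (R' j + j * (- y)) / of_nat j) \<le> 8 / sqrt c + 14"
    proof (cases "s = b")
      case False
      then have "1 \<le> \<Delta> * (2 ^ s) ^ (d + 2)" using Ps by auto
      note large = this
      have st: "\<bar>R (Suc j) - R j\<bar> \<le> 1/8" "\<bar>R' (Suc j) - R' j\<bar> \<le> 1/8" if "2 ^ s \<le> j" "j \<le> 2 ^ b" for j
        using step[OF order.trans[OF le(1) that(1)] that(2)] by auto
      have y': "\<bar>- y\<bar> \<le> 1/2" using y by simp
      have j0s: "j0 \<le> 2 ^ s" using j0 le(1) by (rule order.trans)
      show ?thesis
        using slow_sum_tail[OF R(1) pos(2,3) j0s large st(1) y] slow_sum_tail[OF R(2) pos(2,3) j0s large st(2) y'] by blast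
    qed (use pos in auto)
    then show "cmod (\<Sum>j\<in>{2 ^ s<..2 ^ b}. f j) \<le> 2 * (8 / sqrt c + 14)"
      unfolding f_def diff_divide_distrib sum_subtractf
      by (intro order.trans[OF norm_triangle_ineq4]) auto
  qed
  finally show ?thesis by (simp add: f_def)
qed

text \<open>\<open>y\<close> dominates the slope of \<open>R\<close>, so all slopes keep the
  distance \<open>\<bar>y\<bar> / 2\<close> from the integers and Kusmin-Landau works for one sign
  of \<open>j\<close> alone. The bound is small as soon as \<open>U\<close> is much larger than
  \<open>1 / \<bar>y\<bar>\<close>.\<close>

lemma slow_sum_far:
  assumes R: "slow_phase C c \<Delta> d j0 \<sigma> R" and pos: "0 < c" "0 < \<Delta>" and U: "j0 \<le> U" "0 < U"
    and step: "\<And>j. U \<le> j \<Longrightarrow> j \<le> V \<Longrightarrow> \<bar>R (Suc j) - R j\<bar> \<le> \<bar>y\<bar> / 4" and y: "\<bar>y\<bar> \<le> 1/2" "y \<noteq> 0"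
  shows "cmod (\<Sum>j\<in>{U<..V}. ee (R j + j * y) / of_nat j) \<le> 2 / (\<bar>y\<bar> * U)"
proof -
  have "cmod (\<Sum>j\<in>{U<..V}. ee (R j + j * y) / of_nat j) \<le> (1 / (\<bar>y\<bar> / 2)) / U"
  proof (rule norm_sum_over_le[OF _ U(2)])
    fix m assume m: "m \<le> V"
    have diff: "R (Suc j) + Suc j * y - (R j + j * y) = (R (Suc j) - R j) + y" for j
      by (simp add: algebra_simps)
    have "cmod (\<Sum>j\<in>{Suc U..<Suc m}. ee (R j + j * y)) \<le> 1 / (\<bar>y\<bar> / 2)"
    proof (rule kusmin_landau[where z = "if 0 < y then 0 else -1"])
      show "0 < \<bar>y\<bar> / 2" using y by simp
      fix j assume j: "Suc U \<le> j" "j < Suc m"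
      then have "\<bar>R (Suc j) - R j\<bar> \<le> \<bar>y\<bar> / 4" using m by (intro step) auto
      then show "real_of_int (if 0 < y then 0 else -1) + \<bar>y\<bar> / 2 \<le> R (Suc j) + Suc j * y - (R j + j * y) \<and>
         R (Suc j) + Suc j * y - (R j + j * y) \<le> real_of_int (if 0 < y then 0 else -1) + 1 - \<bar>y\<bar> / 2"
        unfolding diff using y by (auto simp: abs_if split: if_splits)
    next
      have *: "0 \<le> \<sigma> * (R (Suc (Suc j)) - 2 * R (Suc j) + R j)" if "Suc U \<le> j" for j
      proof -
        have "0 \<le> c * \<Delta> * real j ^ d" using pos by simp
        also have "\<dots> \<le> \<sigma> * (R (Suc (Suc j)) - 2 * R (Suc j) + R j)"
          using that U(1) by (intro slow_phaseD(3)[OF R]) simp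
        finally show ?thesis .
      qed
      have "\<sigma> = 1 \<or> \<sigma> = -1" using R by (simp add: slow_phase_def)
      then show "(\<forall>j. Suc U \<le> j \<and> Suc j < Suc m \<longrightarrow> R (Suc j) + Suc j * y - (R j + j * y) \<le> R (Suc (Suc j)) + Suc (Suc j) * y - (R (Suc j) + Suc j * y)) \<or>
        (\<forall>j. Suc U \<le> j \<and> Suc j < Suc m \<longrightarrow> R (Suc (Suc j)) + Suc (Suc j) * y - (R (Suc j) + Suc j * y) \<le> R (Suc j) + Suc j * y - (R j + j * y))"
        unfolding diff using * by (auto simp: algebra_simps)
    qed
    moreover have "{U<..m} = {Suc U..<Suc m}" by auto
    ultimately show "cmod (\<Sum>j\<in>{U<..m}. ee (R j + j * y)) \<le> 1 / (\<bar>y\<bar> / 2)" by simp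
  qed
  then show ?thesis by simp
qed

section \<open>Complete sums and runs of well approximable scales\<close>

lemma ee_eq_1_iff: "ee t = 1 \<longleftrightarrow> t \<in> \<int>"
proof
  assume "ee t = 1"
  then have "sin (pi * t) = 0" using norm_ee_diff_one[of t] by simp
  then obtain i :: int where "pi * t = of_int i * pi" using sin_zero_iff_int2 by blast
  then have "t = of_int i" by simp
  then show "t \<in> \<int>" by simp
qed (rule ee_int)

lemma ee_mult_nat: "ee (t * real k) = ee t ^ k"
  by (induction k) (simp_all add: distrib_left ee_add)

lemma sum_roots_of_unity:
  fixes l :: int
  assumes "0 < M"
  shows "(\<Sum>k<M. ee (of_int l * real k / real M)) = (if int M dvd l then of_nat M else 0)"
proof -
  define w where "w = ee (of_int l / real M)"
  have wk: "ee (of_int l * real k / real M) = w ^ k" for k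
    unfolding w_def ee_mult_nat[symmetric] by simp
  have wM: "w ^ M = 1"
    unfolding w_def ee_mult_nat[symmetric] using assms by (simp add: ee_int)
  show ?thesis
  proof (cases "int M dvd l")
    case True
    then obtain m where "l = int M * m" by (auto elim: dvdE)
    then have "w = 1" using assms by (simp add: w_def ee_int)
    then show ?thesis using True by (simp add: wk)
  next
    case False
    have "w \<noteq> 1"
    proof
      assume "w = 1"
      then have "of_int l / real M \<in> \<int>" by (simp add: w_def ee_eq_1_iff)
      then obtain z where "of_int l / real M = of_int z" by (auto elim: Ints_cases)
      then have "real_of_int l = of_int (z * int M)" using assms by (simp add: field_simps)
      then have "l = z * int M" by (simp only: of_int_eq_iff)
      then show False using False by simp
    qed
    then show ?thesis using False wM by (simp add: wk sum_gp_strict)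
  qed
qed

definition dft :: "(int \<Rightarrow> complex) \<Rightarrow> nat \<Rightarrow> nat \<Rightarrow> complex" where
  "dft \<psi> M k = (\<Sum>i<M. \<psi> (int i) * ee (- (real i * real k / real M))) / of_nat M"

text \<open>Stated for all integers \<open>j\<close>, since the terms with \<open>- j\<close> are
  expanded with the same coefficients.\<close>

lemma dft_inversion:
  assumes M: "0 < M" and per: "\<And>j. \<psi> (j + int M) = \<psi> j"
  shows "\<psi> j = (\<Sum>k<M. dft \<psi> M k * ee (of_int j * real k / real M))"
proof -
  have per': "\<psi> (j + int M * int m) = \<psi> j" for j m
  proof (induction m)
    case (Suc m)
    then show ?case using per[of "j + int M * int m"] by (simp add: algebra_simps)
  qed simp
  have per_dvd: "\<psi> j = \<psi> i" if dvd: "int M dvd j - i" for i j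
  proof -
    obtain z where z: "j - i = int M * z" using dvd by (auto elim: dvdE)
    show ?thesis
    proof (cases "0 \<le> z")
      case True
      then show ?thesis using per'[of i "nat z"] z by (simp add: algebra_simps)
    next
      case False
      then show ?thesis using per'[of j "nat (- z)"] z by (simp add: algebra_simps)
    qed
  qed
  define i0 where "i0 = nat (j mod int M)"
  have i0: "i0 < M" "int i0 = j mod int M" using M by (auto simp: i0_def nat_less_iff)
  have uniq: "int M dvd j - int i \<longleftrightarrow> i = i0" if "i < M" for i
  proof -
    have "int M dvd j - int i \<longleftrightarrow> j mod int M = int i mod int M"
      by (rule mod_eq_dvd_iff[symmetric])
    also have "\<dots> \<longleftrightarrow> i = i0" using that i0(2) by auto
    finally show ?thesis .
  qed
  have "(\<Sum>k<M. dft \<psi> M k * ee (of_int j * real k / real M)) =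
      (\<Sum>k<M. \<Sum>i<M. \<psi> (int i) * ee (of_int (j - int i) * real k / real M) / of_nat M)"
  proof (intro sum.cong refl)
    fix k
    have "ee (of_int (j - int i) * real k / real M) = ee (- (real i * real k / real M)) * ee (of_int j * real k / real M)" for i
      unfolding ee_add[symmetric] by (simp add: diff_divide_distrib algebra_simps)
    then show "dft \<psi> M k * ee (of_int j * real k / real M) =
        (\<Sum>i<M. \<psi> (int i) * ee (of_int (j - int i) * real k / real M) / of_nat M)"
      by (simp add: dft_def sum_divide_distrib sum_distrib_right mult.assoc)
  qed
  also have "\<dots> = (\<Sum>i<M. \<psi> (int i) / of_nat M * (\<Sum>k<M. ee (of_int (j - int i) * real k / real M)))"
    by (subst sum.swap) (simp add: sum_distrib_left)
  also have "\<dots> = (\<Sum>i<M. if i = i0 then \<psi> (int i) else 0)"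
    unfolding sum_roots_of_unity[OF M] using uniq M by (intro sum.cong) auto
  also have "\<dots> = \<psi> (int i0)" using i0 by simp
  also have "\<dots> = \<psi> j"
  proof -
    have "int M dvd j - int i0" using i0(1) uniq by blast
    then show ?thesis by (rule per_dvd[symmetric])
  qed
  finally show ?thesis ..
qed

lemma norm_dft_le_1:
  assumes "0 < M" "\<And>j. cmod (\<psi> j) \<le> 1"
  shows "cmod (dft \<psi> M k) \<le> 1"
proof -
  have "cmod (\<Sum>i<M. \<psi> (int i) * ee (- (real i * real k / real M))) \<le> (\<Sum>i<M. 1)"
    using assms(2) by (intro order.trans[OF norm_sum] sum_mono) (simp add: norm_mult)
  then show ?thesis using assms(1) by (simp add: dft_def norm_divide)
qed

text \<open>With \<open>Y = j * b + a\<close> the phase is a polynomial in \<open>Y / b\<close> with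
  denominators \<open>q\<close>. The step \<open>q * b ^ n\<close> in \<open>j\<close> moves
  \<open>Y\<close> by \<open>q * b ^ Suc n\<close>, which clears \<open>q\<close> and every power of
  \<open>b\<close> up to the \<open>n\<close>-th.\<close>

lemma qphase_periodic:
  assumes q: "0 < q" and b: "0 < b"
  shows "ee (qphase A n q (of_int a / real b) (of_int (j + int (q * b ^ n)))) = ee (qphase A n q (of_int a / real b) (of_int j))"
proof (rule ee_cong)
  define Y where "Y = j * int b + a"
  define h where "h = int (q * b ^ Suc n)"
  have "real_of_int (A m) / real q * (of_int (j + int (q * b ^ n)) + of_int a / real b) ^ m -
      real_of_int (A m) / real q * (of_int j + of_int a / real b) ^ m \<in> \<int>" if m: "m \<le> n" for m
  proof -
    have "h dvd (Y + h) ^ m - Y ^ m"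
      using power_diff_sumr2[of "Y + h" m Y] by simp
    then obtain z where z: "(Y + h) ^ m - Y ^ m = h * z" by (auto elim: dvdE)
    have hq: "real_of_int h = real q * real b ^ Suc n"
      by (simp add: h_def)
    have e1: "of_int (j + int (q * b ^ n)) + of_int a / real b = of_int (Y + h) / real b"
      using b by (simp add: Y_def h_def field_simps)
    have e2: "of_int j + of_int a / real b = of_int Y / real b"
      using b by (simp add: Y_def field_simps)
    have "real_of_int (A m) / real q * (of_int (Y + h) / real b) ^ m - real_of_int (A m) / real q * (of_int Y / real b) ^ m =
        real_of_int (A m) / real q * of_int ((Y + h) ^ m - Y ^ m) / real b ^ m"
      by (simp add: power_divide diff_divide_distrib right_diff_distrib)
    also have "\<dots> = real_of_int (A m * z) * (real b ^ Suc n / real b ^ m)"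
      using q by (simp add: z hq del: power_Suc)
    also have "real b ^ Suc n / real b ^ m = of_int (int b ^ (Suc n - m))"
    proof -
      have "real b ^ Suc n = real b ^ (Suc n - m) * real b ^ m"
        using m by (simp only: power_add[symmetric]) simp
      then show ?thesis using b by (simp only: of_int_power of_int_of_nat_eq) simp
    qed
    finally show ?thesis unfolding e1 e2 by (simp only: of_int_mult[symmetric] Ints_of_int)
  qed
  then show "qphase A n q (of_int a / real b) (of_int (j + int (q * b ^ n))) - qphase A n q (of_int a / real b) (of_int j) \<in> \<int>"
    unfolding qphase_def sum_subtractf[symmetric] by (intro Ints_sum) auto
qed

text \<open>Inverse Weyl at \<open>\<theta> = a / b\<close> over one full period, with
  \<open>T\<close> the inverse of the normalised sum \<open>c\<close>: some \<open>b1\<close>,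
  polynomial in \<open>1 / c\<close>, brings \<open>b1 * D * a / b\<close> close to an integer. If
  it is an integer, coprimality makes \<open>b\<close> divide \<open>b1 * D\<close>. Otherwise it
  misses the integers by at least \<open>1 / b\<close>, and since the period is at least
  \<open>b\<close>, the factor \<open>M ^ (n - 1)\<close> is at least \<open>b\<^sup>2\<close>;
  again \<open>b\<close> is bounded by a power of \<open>1 / c\<close>.\<close>

lemma complete_sum_bound:
  fixes A :: "nat \<Rightarrow> int"
  assumes n: "3 \<le> n" and q: "0 < q" and An: "A n \<noteq> 0"
  shows "\<exists>(K::nat) C. 1 \<le> K \<and> 0 < C \<and> (\<forall>(a::int) (b::nat) x. 1 \<le> b \<longrightarrow> coprime a (int b) \<longrightarrow>
     (cmod (\<Sum>i<q * b ^ n. ee (qphase A n q (of_int a / real b) (real i) + x * real i)) / (q * b ^ n)) ^ K * b \<le> C)"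
proof -
  define D where "D = int n * A n * int q ^ (n - 2)"
  have D0: "D \<noteq> 0" using n q An by (simp add: D_def)
  obtain K :: nat where K: "1 \<le> K" and W: "\<And>(T::real) (N::nat) m (x::real) (s::int) (\<theta>::real). 1 \<le> T \<Longrightarrow> 1 \<le> N \<Longrightarrow> m \<le> N \<Longrightarrow>
      N \<le> cmod (\<Sum>j<m. ee (qphase A n q \<theta> (s + real j) + x * real j)) * T \<Longrightarrow>
      (\<exists>(b::nat) (a::int). (1::nat) \<le> b \<and> b \<le> K * T ^ K \<and>
        \<bar>b * (real_of_int D * \<theta>) - a\<bar> * real N ^ (n - 1) \<le> K * T ^ K)"
    using weyl_inverse_qphase[OF n q, of A] unfolding D_def by blast
  have "c ^ K * b \<le> real_of_int \<bar>D\<bar> * K"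
    if b: "1 \<le> b" and cop: "coprime a (int b)"
      and c: "c = cmod (\<Sum>i<q * b ^ n. ee (qphase A n q (of_int a / real b) (real i) + x * real i)) / (q * b ^ n)"
    for a :: int and b :: nat and c x :: real
  proof (cases "c = 0")
    case True
    then show ?thesis using K by (simp add: power_0_left)
  next
    case False
    define M where "M = q * b ^ n"
    have M: "1 \<le> M" "b \<le> M"
    proof -
      have "1 * b ^ 1 \<le> q * b ^ n" using q b n by (intro mult_le_mono power_increasing) auto
      then show "b \<le> M" by (simp only: M_def mult_1 power_one_right)
      then show "1 \<le> M" using b by linarith
    qed
    have "0 \<le> c" unfolding c by simp
    with False have c0: "0 < c" by linarith
    have cM: "c * M = cmod (\<Sum>i<M. ee (qphase A n q (of_int a / real b) (real i) + x * real i))"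
      using c M(1) b q by (simp add: M_def)
    also have "\<dots> \<le> (\<Sum>i<M. 1)" by (rule order.trans[OF norm_sum]) simp
    finally have "c \<le> 1" using M(1) by simp
    then have T: "1 \<le> 1 / c" using c0 by simp
    have "real M \<le> cmod (\<Sum>i<M. ee (qphase A n q (of_int a / real b) (of_int 0 + real i) + x * real i)) * (1 / c)"
      using cM[symmetric] c0 by simp
    from W[OF T M(1) order.refl this] obtain b1 :: nat and a1 :: int where b1: "1 \<le> b1" "b1 \<le> K * (1 / c) ^ K"
      "\<bar>b1 * (real_of_int D * (of_int a / real b)) - a1\<bar> * real M ^ (n - 1) \<le> K * (1 / c) ^ K"
      by blast
    have D1: "1 \<le> \<bar>D\<bar>" using D0 by simp
    have KT: "0 \<le> K * (1 / c) ^ K" using c0 by simp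
    have bD: "b \<le> real_of_int \<bar>D\<bar> * (K * (1 / c) ^ K)"
    proof (cases "int b1 * D * a = a1 * int b")
      case True
      then have "int b dvd int b1 * D * a" by simp
      then have "int b dvd int b1 * D" using cop by (simp add: coprime_commute coprime_dvd_mult_left_iff)
      then have "int b \<le> \<bar>int b1 * D\<bar>" using dvd_imp_le_int[of "int b1 * D" "int b"] D0 b1(1) by simp
      then have "real_of_int (int b) \<le> real_of_int \<bar>int b1 * D\<bar>" by (simp only: of_int_le_iff)
      also have "\<dots> = real_of_int \<bar>D\<bar> * b1" by (simp add: abs_mult)
      also have "\<dots> \<le> real_of_int \<bar>D\<bar> * (K * (1 / c) ^ K)" using b1(2) by (intro mult_left_mono) auto
      finally show ?thesis by simp
    next
      case False
      then have "1 \<le> \<bar>int b1 * D * a - a1 * int b\<bar>" by linarith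
      then have "1 \<le> real_of_int \<bar>int b1 * D * a - a1 * int b\<bar>" by linarith
      also have "\<dots> = \<bar>b1 * (real_of_int D * (of_int a / real b)) - a1\<bar> * b"
        using b by (simp add: abs_mult[of _ "real b", symmetric, simplified] field_simps)
      finally have 1: "1 \<le> \<bar>b1 * (real_of_int D * (of_int a / real b)) - a1\<bar> * b" .
      have "real b * real b \<le> real M ^ 2" using M(2) by (simp add: power2_eq_square mult_mono)
      also have "\<dots> \<le> real M ^ (n - 1)" using M(1) n by (intro power_increasing) auto
      finally have 2: "real b * real b \<le> real M ^ (n - 1)" .
      have "real b \<le> (\<bar>b1 * (real_of_int D * (of_int a / real b)) - a1\<bar> * b) * b"
        using mult_right_mono[OF 1, of "real b"] by simp
      also have "\<dots> = \<bar>b1 * (real_of_int D * (of_int a / real b)) - a1\<bar> * (real b * real b)" by simp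
      also have "\<dots> \<le> \<bar>b1 * (real_of_int D * (of_int a / real b)) - a1\<bar> * real M ^ (n - 1)"
        using 2 by (intro mult_left_mono) auto
      also have "\<dots> \<le> K * (1 / c) ^ K" by (fact b1(3))
      also have "\<dots> \<le> real_of_int \<bar>D\<bar> * (K * (1 / c) ^ K)"
        using mult_right_mono[of 1 "real_of_int \<bar>D\<bar>", OF _ KT] D1 by simp
      finally show ?thesis .
    qed
    have "c ^ K * b \<le> c ^ K * (real_of_int \<bar>D\<bar> * (K * (1 / c) ^ K))"
      using bD c0 by (intro mult_left_mono) auto
    also have "\<dots> = real_of_int \<bar>D\<bar> * K"
      using c0 by (simp add: power_one_over)
    finally show ?thesis .
  qed
  moreover have "0 < real_of_int \<bar>D\<bar> * K" using D0 K by simp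
  ultimately show ?thesis using K
    by (intro exI[of _ K] exI[of _ "real_of_int \<bar>D\<bar> * K"] conjI allI impI) auto
qed

section \<open>A run of scales with a common fraction\<close>

lemma slow_phase_weaken:
  assumes "slow_phase C c \<Delta> d j0 \<sigma> R" "C \<le> C'" "c' \<le> c" "j0 \<le> j0'" "0 \<le> \<Delta>"
  shows "slow_phase C' c' \<Delta> d j0' \<sigma> R"
  unfolding slow_phase_def
proof (intro conjI allI impI)
  show "\<sigma> = 1 \<or> \<sigma> = - 1" using assms(1) by (simp add: slow_phase_def)
  fix j assume "j0' \<le> j"
  then have j: "j0 \<le> j" using assms(4) by simp
  have mono: "u * \<Delta> * real j ^ e \<le> v * \<Delta> * real j ^ e" if "u \<le> v" for u v e
    using that assms(5) by (intro mult_right_mono) auto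
  show "\<bar>R j\<bar> \<le> C' * \<Delta> * real j ^ (d + 2)"
    by (rule order.trans[OF slow_phaseD(1)[OF assms(1) j] mono[OF assms(2)]])
  show "\<bar>R (Suc j) - R j\<bar> \<le> C' * \<Delta> * real j ^ (d + 1)"
    by (rule order.trans[OF slow_phaseD(2)[OF assms(1) j] mono[OF assms(2)]])
  show "c' * \<Delta> * real j ^ d \<le> \<sigma> * (R (Suc (Suc j)) - 2 * R (Suc j) + R j)"
    by (rule order.trans[OF mono[OF assms(3)] slow_phaseD(3)[OF assms(1) j]])
qed

definition qpoly :: "(nat \<Rightarrow> int) \<Rightarrow> nat \<Rightarrow> nat \<Rightarrow> real poly" where
  "qpoly A n q = (\<Sum>m\<le>n. monom (real_of_int (A m) / real q) m)"

lemma poly_qpoly: "poly (qpoly A n q) (y + \<theta>) = qphase A n q \<theta> y"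
  by (simp add: qpoly_def qphase_def poly_sum poly_monom)

lemma degree_qpoly:
  assumes "A n \<noteq> 0" "0 < q"
  shows "degree (qpoly A n q) = n"
proof (rule antisym)
  show "degree (qpoly A n q) \<le> n"
    unfolding qpoly_def by (intro degree_sum_le) (auto intro: order.trans[OF degree_monom_le])
  have "coeff (qpoly A n q) n = real_of_int (A n) / real q"
    by (simp add: qpoly_def coeff_sum)
  then show "n \<le> degree (qpoly A n q)" using assms by (intro le_degree) simp
qed

text \<open>The periodic factor of period \<open>M = q * b ^ n\<close> splits into \<open>M\<close>
  frequencies, each of which moves the linear phase by \<open>\<kappa> / M\<close>. At most one of
  the moved phases is closer than \<open>1 / (2 * M)\<close> to 0; it costs a constant times a
  Fourier coefficient, hence a negative power of \<open>b\<close>. Each other frequency costs at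
  most \<open>8 * M / U\<close>, which stays negligible after summation because
  \<open>b ^ (4 * n) \<le> 2 ^ k\<close>. The exponent \<open>l - 1\<close> belongs to the last
  block of the run, which starts at \<open>2 ^ (l - 1)\<close>.\<close>

lemma major_run_bound:
  fixes A :: "nat \<Rightarrow> int"
  assumes n: "3 \<le> n" and q: "0 < q" and An: "A n \<noteq> 0"
  shows "\<exists>(k0::nat) \<gamma> B. 0 < \<gamma> \<and> 0 < B \<and> (\<forall>\<theta> (a::int) (b::nat) k l x. \<bar>\<theta>\<bar> \<le> 1 \<longrightarrow> 1 \<le> b \<longrightarrow> coprime a (int b) \<longrightarrow>
     \<theta> \<noteq> a / b \<longrightarrow> \<bar>\<theta> - a / b\<bar> \<le> 1 \<longrightarrow> k0 \<le> k \<longrightarrow> k < l \<longrightarrow> b ^ (4 * n) \<le> 2 ^ k \<longrightarrow>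
     (\<theta> - a / b)\<^sup>2 * (2 ^ (l - 1)) ^ (2 * n - 3) \<le> 1 \<longrightarrow>
     cmod (\<Sum>j\<in>{2 ^ k<..2 ^ l}. (ee (qphase A n q \<theta> (real j) + x * real j) - ee (qphase A n q \<theta> (- real j) - x * real j)) / of_nat j)
       \<le> B * real b powr (- \<gamma>))"
proof -
  obtain d where d: "n = d + 3" using n by (metis add.commute le_Suc_ex)
  define Q where "Q = qpoly A n q"
  \<comment> \<open>Reflection turns the values at \<open>- j + \<theta>\<close> into values at
    \<open>j - \<theta>\<close>, so the negative side is a slow phase with the shifts
    \<open>- \<theta>\<close> and \<open>- r\<close>.\<close>
  define Q' where "Q' = pcompose Q [:0, -1:]"
  have degQ: "degree Q = d + 3" "degree Q' = d + 3"
    using degree_qpoly[where A = A, OF An q] d by (simp_all add: Q_def Q'_def degree_pcompose)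
  have Q'_eq: "poly Q' y = poly Q (- y)" for y
    by (simp add: Q'_def poly_pcompose)
  obtain C1 c1 j1 \<sigma>1 where s1: "0 < C1" "0 < c1" "\<And>\<theta> r. \<bar>\<theta>\<bar> \<le> 2 \<Longrightarrow> \<bar>r\<bar> \<le> 2 \<Longrightarrow> \<theta> \<noteq> r \<Longrightarrow>
     slow_phase C1 c1 \<bar>\<theta> - r\<bar> d j1 (\<sigma>1 * sgn (\<theta> - r)) (\<lambda>j. poly Q (real j + \<theta>) - poly Q (real j + r))"
    using slow_phase_poly_difference[OF degQ(1)] by blast
  obtain C2 c2 j2 \<sigma>2 where s2: "0 < C2" "0 < c2" "\<And>\<theta> r. \<bar>\<theta>\<bar> \<le> 2 \<Longrightarrow> \<bar>r\<bar> \<le> 2 \<Longrightarrow> \<theta> \<noteq> r \<Longrightarrow>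
     slow_phase C2 c2 \<bar>\<theta> - r\<bar> d j2 (\<sigma>2 * sgn (\<theta> - r)) (\<lambda>j. poly Q' (real j + \<theta>) - poly Q' (real j + r))"
    using slow_phase_poly_difference[OF degQ(2)] by blast
  define C where "C = C1 + C2"
  define c where "c = min c1 c2"
  define j0 where "j0 = j1 + j2"
  have Cc: "0 < C" "0 < c" using s1 s2 by (auto simp: C_def c_def)
  define C4 where "C4 = 4 * pi * C * 2 ^ (d + 2) + (4 * pi + 4) + 2 * (8 / sqrt c + 14)"
  have C4: "0 < C4" using Cc by (auto simp: C4_def intro!: add_pos_pos)
  obtain K :: nat and C5 where K: "1 \<le> K" "0 < C5" and complete: "\<And>(a::int) (b::nat) x. 1 \<le> b \<Longrightarrow> coprime a (int b) \<Longrightarrow>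
     (cmod (\<Sum>i<q * b ^ n. ee (qphase A n q (of_int a / real b) (real i) + x * real i)) / (q * b ^ n)) ^ K * b \<le> C5"
    using complete_sum_bound[where A = A, OF n q An] by blast
  define \<gamma> where "\<gamma> = 1 / real K"
  have \<gamma>: "0 < \<gamma>" "\<gamma> \<le> 1" using K by (auto simp: \<gamma>_def)
  \<comment> \<open>The square of the constant in \<open>S\<close> below. Since
    \<open>C6 * b ^ (2 * n)\<close> is compared with \<open>U\<close> through its square,
    \<open>k0\<close> must put \<open>C6\<^sup>2\<close> below \<open>U\<close>.\<close>
  define C6 where "C6 = (8 * C * q * 2 ^ (d + 1))\<^sup>2"
  obtain k0 where k0: "real j0 + C6\<^sup>2 < 2 ^ k0"
    using real_arch_pow[of 2 "real j0 + C6\<^sup>2"] by auto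
  have "real j0 < 2 ^ k0" "C6\<^sup>2 < 2 ^ k0"
    using k0 zero_le_power2[of C6] by linarith+
  then have "real j0 \<le> real (2 ^ k0)" and C6k0: "C6\<^sup>2 \<le> 2 ^ k0" by simp_all
  then have j0k0: "j0 \<le> 2 ^ k0" by (simp only: of_nat_le_iff)
  have "cmod (\<Sum>j\<in>{2 ^ k<..2 ^ l}. (ee (qphase A n q \<theta> (real j) + x * real j) - ee (qphase A n q \<theta> (- real j) - x * real j)) / of_nat j)
       \<le> (C4 * C5 powr \<gamma> + 8 * (real q)\<^sup>2) * real b powr (- \<gamma>)"
    if \<theta>: "\<bar>\<theta>\<bar> \<le> 1" and b: "1 \<le> b" and cop: "coprime a (int b)" and r: "r = a / b" and ne: "\<theta> \<noteq> r" and close: "\<bar>\<theta> - r\<bar> \<le> 1"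
      and k: "k0 \<le> k" and kl: "k < l" and bk: "b ^ (4 * n) \<le> 2 ^ k" and small: "(\<theta> - r)\<^sup>2 * (2 ^ (l - 1)) ^ (2 * n - 3) \<le> 1"
    for \<theta> x r :: real and a :: int and b k l :: nat
  proof -
    define \<Delta> where "\<Delta> = \<bar>\<theta> - r\<bar>"
    have \<Delta>: "0 < \<Delta>" using ne by (simp add: \<Delta>_def)
    define R where "R j = poly Q (real j + \<theta>) - poly Q (real j + r)" for j
    define R' where "R' j = poly Q' (real j + (- \<theta>)) - poly Q' (real j + (- r))" for j
    define \<sigma> where "\<sigma> = \<sigma>1 * sgn (\<theta> - r)"
    define \<sigma>' where "\<sigma>' = \<sigma>2 * sgn (- \<theta> - - r)"
    have r2: "\<bar>r\<bar> \<le> 2" using \<theta> close by linarith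
    have "slow_phase C1 c1 \<Delta> d j1 \<sigma> R"
      unfolding \<Delta>_def \<sigma>_def R_def using s1(3)[of \<theta> r] \<theta> r2 ne by simp
    then have R: "slow_phase C c \<Delta> d j0 \<sigma> R"
      by (rule slow_phase_weaken) (use s2 \<Delta> in \<open>auto simp: C_def c_def j0_def\<close>)
    have "slow_phase C2 c2 \<bar>- \<theta> - - r\<bar> d j2 \<sigma>' R'"
      unfolding \<sigma>'_def R'_def using \<theta> r2 ne by (intro s2(3)) auto
    moreover have "\<bar>- \<theta> - - r\<bar> = \<Delta>" by (simp add: \<Delta>_def)
    ultimately have "slow_phase C2 c2 \<Delta> d j2 \<sigma>' R'" by simp
    then have R': "slow_phase C c \<Delta> d j0 \<sigma>' R'"
      by (rule slow_phase_weaken) (use s1 \<Delta> in \<open>auto simp: C_def c_def j0_def\<close>)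
    define M where "M = q * b ^ n"
    have M: "0 < M" "1 \<le> real M" using q b by (simp_all add: M_def Suc_le_eq flip: of_nat_mult of_nat_power)
    define U :: nat where "U = 2 ^ k"
    have U: "0 < U" "j0 \<le> U" "C6\<^sup>2 \<le> U"
    proof -
      have P: "(2::nat) ^ k0 \<le> 2 ^ k" "(2::real) ^ k0 \<le> 2 ^ k" using k by (auto intro: power_increasing)
      show "j0 \<le> U" unfolding U_def by (rule order.trans[OF j0k0 P(1)])
      show "C6\<^sup>2 \<le> U" unfolding U_def of_nat_power of_nat_numeral by (rule order.trans[OF C6k0 P(2)])
    qed (simp add: U_def)
    have bU: "real b ^ (4 * n) \<le> U" using bk unfolding U_def by (simp only: of_nat_power[symmetric] of_nat_le_iff)
    \<comment> \<open>All slopes of the slow phases stay below a quarter of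
      \<open>1 / (2 * M)\<close>, the distance that separates far frequencies from 0. Squared, the
      claim involves \<open>\<Delta>\<^sup>2\<close> and \<open>2 ^ (l - 1)\<close> to the power
      \<open>2 * n - 4\<close>; the hypothesis has one power more, and this pays for the constant
      and for \<open>b ^ (2 * n)\<close>.\<close>
    have step: "C * \<Delta> * real j ^ (d + 1) \<le> 1 / (8 * real M)" if j: "j \<le> 2 ^ l" for j
    proof -
      define S where "S = C * \<Delta> * (2 ^ l) ^ (d + 1) * (8 * real M)"
      have l: "(2::real) ^ l = 2 * 2 ^ (l - 1)" using kl by (cases l) auto
      have "S\<^sup>2 = C6 * (\<Delta>\<^sup>2 * (2 ^ (l - 1)) ^ (2 * d + 2)) * real b ^ (2 * n)"
      proof -
        have e: "2 * d + 2 = (d + 1) * 2" "2 * n = n * 2" by simp_all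
        have "S = 8 * C * q * 2 ^ (d + 1) * (\<Delta> * (2 ^ (l - 1)) ^ (d + 1)) * real b ^ n"
          unfolding S_def M_def l by (simp only: power_mult_distrib of_nat_mult of_nat_power mult_ac)
        then show ?thesis
          unfolding C6_def e by (simp only: power_mult_distrib power_mult)
      qed
      also have "\<dots> \<le> C6 * (1 / U) * real b ^ (2 * n)"
      proof (intro mult_right_mono mult_left_mono)
        have "\<Delta>\<^sup>2 * (2 ^ (l - 1)) ^ (2 * d + 2) * (2 ^ (l - 1)) = (\<theta> - r)\<^sup>2 * (2 ^ (l - 1)) ^ (2 * n - 3)"
        proof -
          have "2 * n - 3 = Suc (2 * d + 2)" using d by simp
          then show ?thesis by (simp only: \<Delta>_def power2_abs power_Suc mult_ac)
        qed
        then have 1: "\<Delta>\<^sup>2 * (2 ^ (l - 1)) ^ (2 * d + 2) * (2 ^ (l - 1)) \<le> 1" using small by simp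
        have "real U \<le> 2 ^ (l - 1)" unfolding U_def of_nat_power using kl by (auto intro: power_increasing)
        then have "\<Delta>\<^sup>2 * (2 ^ (l - 1)) ^ (2 * d + 2) * U \<le> \<Delta>\<^sup>2 * (2 ^ (l - 1)) ^ (2 * d + 2) * (2 ^ (l - 1))"
          by (intro mult_left_mono) auto
        then have "\<Delta>\<^sup>2 * (2 ^ (l - 1)) ^ (2 * d + 2) * U \<le> 1" using 1 by linarith
        then show "\<Delta>\<^sup>2 * (2 ^ (l - 1)) ^ (2 * d + 2) \<le> 1 / U" using U by (simp only: pos_le_divide_eq of_nat_0_less_iff)
      qed (auto simp: C6_def)
      also have "\<dots> \<le> 1"
      proof -
        have "(C6 * real b ^ (2 * n))\<^sup>2 = C6\<^sup>2 * real b ^ (4 * n)"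
          by (simp add: power_mult_distrib flip: power_mult)
        also have "\<dots> \<le> real U * real U" using U bU by (intro mult_mono) auto
        finally have "(C6 * real b ^ (2 * n))\<^sup>2 \<le> (real U)\<^sup>2" by (simp add: power2_eq_square)
        then have "C6 * real b ^ (2 * n) \<le> U" by (rule power2_le_imp_le) simp
        then show ?thesis using U by (simp add: field_simps)
      qed
      finally have "S\<^sup>2 \<le> 1\<^sup>2" by simp
      then have "S \<le> 1" by (rule power2_le_imp_le) simp
      have "C * \<Delta> * real j ^ (d + 1) \<le> C * \<Delta> * (2 ^ l) ^ (d + 1)"
      proof (intro mult_left_mono power_mono)
        have "real j \<le> real (2 ^ l)" using j by (simp only: of_nat_le_iff)
        then show "real j \<le> 2 ^ l" by simp
      qed (use Cc \<Delta> in auto)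
      also have "\<dots> \<le> 1 / (8 * real M)"
        using \<open>S \<le> 1\<close> M unfolding S_def by (simp add: field_simps)
      finally show ?thesis .
    qed
    have stepR: "\<bar>R (Suc j) - R j\<bar> \<le> 1 / (8 * real M)" "\<bar>R' (Suc j) - R' j\<bar> \<le> 1 / (8 * real M)"
      if "U \<le> j" "j \<le> 2 ^ l" for j
    proof -
      have "j0 \<le> j" using that U by simp
      then show "\<bar>R (Suc j) - R j\<bar> \<le> 1 / (8 * real M)" "\<bar>R' (Suc j) - R' j\<bar> \<le> 1 / (8 * real M)"
        using slow_phaseD(2)[OF R] slow_phaseD(2)[OF R'] step[OF that(2)] order.trans by blast+
    qed
    define \<psi> where "\<psi> i = ee (qphase A n q r (of_int i))" for i :: int
    have per: "\<psi> (i + int M) = \<psi> i" for i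
      unfolding \<psi>_def M_def r using q b by (intro qphase_periodic) auto
    \<comment> \<open>The phase \<open>x + \<kappa> / M\<close> reduced modulo 1; the removed
      integer has no effect at integers \<open>j\<close>.\<close>
    define y where "y \<kappa> = x + real \<kappa> / M - round (x + real \<kappa> / M)" for \<kappa> :: nat
    have y: "\<bar>y \<kappa>\<bar> \<le> 1/2" for \<kappa>
      using of_int_round_abs_le[of "x + real \<kappa> / M"] by (simp add: y_def abs_minus_commute)
    define G where "G \<kappa> = (\<Sum>j\<in>{2 ^ k<..2 ^ l}. (ee (R j + j * y \<kappa>) - ee (R' j + - (j * y \<kappa>))) / of_nat j)" for \<kappa>
    have expand1: "ee (qphase A n q \<theta> (real j) + x * real j) = (\<Sum>\<kappa><M. dft \<psi> M \<kappa> * ee (R j + j * y \<kappa>))" for j :: nat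
    proof -
      have "qphase A n q \<theta> (real j) = qphase A n q r (real j) + R j"
        by (simp add: R_def Q_def poly_qpoly)
      then have "ee (qphase A n q \<theta> (real j) + x * real j) = \<psi> (int j) * ee (R j + x * real j)"
        by (simp add: \<psi>_def ee_add mult_ac)
      also have "\<psi> (int j) = (\<Sum>\<kappa><M. dft \<psi> M \<kappa> * ee (of_int (int j) * real \<kappa> / real M))"
        by (rule dft_inversion[where \<psi> = \<psi> and M = M, OF M(1) per])
      also have "\<dots> * ee (R j + x * real j) = (\<Sum>\<kappa><M. dft \<psi> M \<kappa> * ee (R j + j * y \<kappa>))"
        unfolding sum_distrib_right
      proof (intro sum.cong refl)
        fix \<kappa>
        have "(of_int (int j) * real \<kappa> / real M + (R j + x * real j)) - (R j + j * y \<kappa>) = of_int (int j * round (x + real \<kappa> / M))"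
          by (simp add: y_def algebra_simps)
        then have "ee (of_int (int j) * real \<kappa> / real M + (R j + x * real j)) = ee (R j + j * y \<kappa>)"
          by (intro ee_cong) (simp only: Ints_of_int)
        then show "dft \<psi> M \<kappa> * ee (of_int (int j) * real \<kappa> / real M) * ee (R j + x * real j) = dft \<psi> M \<kappa> * ee (R j + j * y \<kappa>)"
          by (simp only: mult.assoc ee_add[symmetric])
      qed
      finally show ?thesis .
    qed
    have expand2: "ee (qphase A n q \<theta> (- real j) - x * real j) = (\<Sum>\<kappa><M. dft \<psi> M \<kappa> * ee (R' j + - (j * y \<kappa>)))" for j :: nat
    proof -
      have "qphase A n q \<theta> (- real j) = qphase A n q r (- real j) + R' j"
        by (simp add: R'_def Q'_eq Q_def flip: poly_qpoly)
      then have "ee (qphase A n q \<theta> (- real j) - x * real j) = \<psi> (- int j) * ee (R' j - x * real j)"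
        by (simp add: \<psi>_def ee_add[symmetric] algebra_simps)
      also have "\<psi> (- int j) = (\<Sum>\<kappa><M. dft \<psi> M \<kappa> * ee (of_int (- int j) * real \<kappa> / real M))"
        by (rule dft_inversion[where \<psi> = \<psi> and M = M, OF M(1) per])
      also have "\<dots> * ee (R' j - x * real j) = (\<Sum>\<kappa><M. dft \<psi> M \<kappa> * ee (R' j + - (j * y \<kappa>)))"
        unfolding sum_distrib_right
      proof (intro sum.cong refl)
        fix \<kappa>
        have "(of_int (- int j) * real \<kappa> / real M + (R' j - x * real j)) - (R' j + - (j * y \<kappa>)) = of_int (- int j * round (x + real \<kappa> / M))"
          by (simp add: y_def algebra_simps)
        then have "ee (of_int (- int j) * real \<kappa> / real M + (R' j - x * real j)) = ee (R' j + - (j * y \<kappa>))"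
          by (intro ee_cong) (simp only: Ints_of_int)
        then show "dft \<psi> M \<kappa> * ee (of_int (- int j) * real \<kappa> / real M) * ee (R' j - x * real j) = dft \<psi> M \<kappa> * ee (R' j + - (j * y \<kappa>))"
          by (simp only: mult.assoc ee_add[symmetric])
      qed
      finally show ?thesis .
    qed
    have total: "(\<Sum>j\<in>{2 ^ k<..2 ^ l}. (ee (qphase A n q \<theta> (real j) + x * real j) - ee (qphase A n q \<theta> (- real j) - x * real j)) / of_nat j)
        = (\<Sum>\<kappa><M. dft \<psi> M \<kappa> * G \<kappa>)"
      unfolding expand1 expand2 G_def sum_distrib_left
      by (subst sum.swap) (simp add: sum_subtractf[symmetric] sum_divide_distrib right_diff_distrib)
    define \<beta> where "\<beta> = C5 powr \<gamma> * real b powr (- \<gamma>)"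
    \<comment> \<open>A coefficient is a normalised complete sum with linear phase
      \<open>- \<kappa> / M\<close>; the exponent \<open>\<gamma> = 1 / K\<close> takes the root in
      the complete sum bound.\<close>
    have dft_le: "cmod (dft \<psi> M \<kappa>) \<le> \<beta>" for \<kappa>
    proof -
      define e where "e = cmod (dft \<psi> M \<kappa>)"
      have eqS: "(\<Sum>i<M. \<psi> (int i) * ee (- (real i * real \<kappa> / real M))) =
          (\<Sum>i<q * b ^ n. ee (qphase A n q (of_int a / real b) (real i) + (- (real \<kappa> / M)) * real i))"
        unfolding \<psi>_def ee_add r M_def[symmetric] by (intro sum.cong) (auto simp: mult_ac)
      have "e = cmod (\<Sum>i<q * b ^ n. ee (qphase A n q (of_int a / real b) (real i) + (- (real \<kappa> / M)) * real i)) / (q * b ^ n)"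
        by (simp only: e_def dft_def norm_divide norm_of_nat eqS) (simp add: M_def)
      then have "e ^ K * b \<le> C5" using complete[OF b cop, of "- (real \<kappa> / M)"] by simp
      then have eK: "e ^ K \<le> C5 / b" using b by (simp add: field_simps)
      have e0: "0 \<le> e" by (simp add: e_def)
      have "e \<le> (C5 / b) powr \<gamma>"
      proof (cases "e = 0")
        case False
        then have "e = (e ^ K) powr \<gamma>"
          using e0 K by (simp add: \<gamma>_def powr_powr flip: powr_realpow)
        also have "\<dots> \<le> (C5 / b) powr \<gamma>" using eK \<gamma> e0 by (intro powr_mono2) auto
        finally show ?thesis .
      qed simp
      also have "\<dots> = \<beta>" using K b by (simp add: \<beta>_def powr_divide powr_minus field_simps)
      finally show ?thesis by (simp add: e_def)
    qed
    have dft1: "cmod (dft \<psi> M \<kappa>) \<le> 1" for \<kappa>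
      by (rule norm_dft_le_1[OF M(1)]) (simp add: \<psi>_def)
    have near: "cmod (G \<kappa>) \<le> C4" for \<kappa>
      unfolding G_def C4_def
    proof (rule slow_sum_near[OF R R' Cc \<Delta> _ _ _ _ y])
      show "j0 \<le> 2 ^ k" using U by (simp add: U_def)
      show "k \<le> l" using kl by simp
      have "1 / (8 * real M) \<le> 1 / 8" using M by (intro divide_left_mono) auto
      then show "\<bar>R (Suc j) - R j\<bar> \<le> 1 / 8" "\<bar>R' (Suc j) - R' j\<bar> \<le> 1 / 8" if "2 ^ k \<le> j" "j \<le> 2 ^ l" for j
        using stepR[of j] that order.trans by (auto simp: U_def)
    qed
    have far: "cmod (G \<kappa>) \<le> 8 * M / U" if yk: "1 / (2 * M) \<le> \<bar>y \<kappa>\<bar>" for \<kappa>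
    proof -
      have y0: "y \<kappa> \<noteq> 0" "- y \<kappa> \<noteq> 0" using yk M by auto
      have st: "1 / (8 * real M) \<le> \<bar>y \<kappa>\<bar> / 4" using yk M by (simp add: field_simps)
      have f1: "cmod (\<Sum>j\<in>{U<..2 ^ l}. ee (R j + j * y \<kappa>) / of_nat j) \<le> 2 / (\<bar>y \<kappa>\<bar> * U)"
      proof (rule slow_sum_far[OF R Cc(2) \<Delta> U(2,1) _ y y0(1)])
        fix j assume "U \<le> j" "j \<le> 2 ^ l"
        from stepR(1)[OF this] st show "\<bar>R (Suc j) - R j\<bar> \<le> \<bar>y \<kappa>\<bar> / 4" by linarith
      qed
      have f2: "cmod (\<Sum>j\<in>{U<..2 ^ l}. ee (R' j + j * (- y \<kappa>)) / of_nat j) \<le> 2 / (\<bar>- y \<kappa>\<bar> * U)"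
      proof (rule slow_sum_far[OF R' Cc(2) \<Delta> U(2,1) _ _ y0(2)])
        fix j assume "U \<le> j" "j \<le> 2 ^ l"
        from stepR(2)[OF this] st show "\<bar>R' (Suc j) - R' j\<bar> \<le> \<bar>- y \<kappa>\<bar> / 4" by simp
      qed (use y[of \<kappa>] in simp)
      have "G \<kappa> = (\<Sum>j\<in>{U<..2 ^ l}. ee (R j + j * y \<kappa>) / of_nat j) - (\<Sum>j\<in>{U<..2 ^ l}. ee (R' j + j * (- y \<kappa>)) / of_nat j)"
        by (simp add: G_def U_def diff_divide_distrib sum_subtractf)
      then have "cmod (G \<kappa>) \<le> 2 / (\<bar>y \<kappa>\<bar> * U) + 2 / (\<bar>- y \<kappa>\<bar> * U)"
        by (simp only:) (rule order.trans[OF norm_triangle_ineq4 add_mono[OF f1 f2]])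
      also have "\<dots> = 4 / (\<bar>y \<kappa>\<bar> * U)" by simp
      also have "\<dots> \<le> 4 / ((1 / (2 * M)) * U)"
        using yk U M by (intro divide_left_mono mult_right_mono mult_pos_pos) auto
      also have "\<dots> = 8 * M / U" using M by simp
      finally show ?thesis .
    qed
    \<comment> \<open>The values \<open>y \<kappa>\<close> differ by multiples of
      \<open>1 / M\<close>, nonzero ones for distinct \<open>\<kappa>\<close> below
      \<open>M\<close>, so at most one of them is this close to 0.\<close>
    define X where "X = {\<kappa>. \<kappa> < M \<and> \<bar>y \<kappa>\<bar> < 1 / (2 * M)}"
    have cardX: "card X \<le> 1"
    proof -
      have "\<kappa> = \<kappa>'" if "\<kappa> \<in> X" "\<kappa>' \<in> X" for \<kappa> \<kappa>'
      proof -
        define z :: int where "z = int \<kappa> - int \<kappa>' - int M * (round (x + real \<kappa> / M) - round (x + real \<kappa>' / M))"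
        have zz: "of_int z = M * (y \<kappa> - y \<kappa>')"
          using M by (simp add: z_def y_def algebra_simps)
        have lt: "\<bar>y \<kappa> - y \<kappa>'\<bar> < 1 / M"
        proof -
          have "1 / real M = 1 / (2 * M) + 1 / (2 * M)" by simp
          then show ?thesis using that unfolding X_def by auto
        qed
        have "\<bar>real_of_int z\<bar> = M * \<bar>y \<kappa> - y \<kappa>'\<bar>" unfolding zz by (simp add: abs_mult)
        also have "\<dots> < M * (1 / M)" using lt M by (intro mult_strict_left_mono) auto
        also have "\<dots> = 1" using M by simp
        finally have "\<bar>real_of_int z\<bar> < 1" .
        then have "z = 0" by linarith
        then have "int M dvd int \<kappa> - int \<kappa>'" by (simp add: z_def)
        then have "int \<kappa> mod int M = int \<kappa>' mod int M" by (simp add: mod_eq_dvd_iff)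
        then show ?thesis using that by (simp add: X_def)
      qed
      then show ?thesis using card_le_Suc0_iff_eq[of X] by (auto simp: X_def)
    qed
    have "cmod (\<Sum>\<kappa><M. dft \<psi> M \<kappa> * G \<kappa>) \<le> (\<Sum>\<kappa><M. (if \<kappa> \<in> X then \<beta> * C4 else 0) + 8 * M / U)"
    proof (intro order.trans[OF norm_sum] sum_mono)
      fix \<kappa> assume \<kappa>: "\<kappa> \<in> {..<M}"
      show "cmod (dft \<psi> M \<kappa> * G \<kappa>) \<le> (if \<kappa> \<in> X then \<beta> * C4 else 0) + 8 * M / U"
      proof (cases "\<kappa> \<in> X")
        case True
        have "cmod (dft \<psi> M \<kappa> * G \<kappa>) \<le> \<beta> * C4"
          unfolding norm_mult using dft_le near C4 by (intro mult_mono) (auto simp: \<beta>_def)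
        then show ?thesis using True by (simp add: add_increasing2)
      next
        case False
        then have "cmod (G \<kappa>) \<le> 8 * M / U" using \<kappa> by (intro far) (auto simp: X_def)
        then have "cmod (dft \<psi> M \<kappa> * G \<kappa>) \<le> 1 * (8 * M / U)"
          unfolding norm_mult using dft1 by (intro mult_mono) auto
        then show ?thesis using False by simp
      qed
    qed
    also have "\<dots> = real (card X) * (\<beta> * C4) + M * (8 * M / U)"
    proof -
      have "{..<M} \<inter> X = X" by (auto simp: X_def)
      then show ?thesis by (simp add: sum.distrib sum.inter_restrict[symmetric])
    qed
    also have "\<dots> \<le> 1 * (\<beta> * C4) + 8 * (real q)\<^sup>2 * real b powr (- \<gamma>)"
    proof (intro add_mono mult_right_mono)
      show "real (card X) \<le> 1" using cardX by simp
      show "0 \<le> \<beta> * C4" using C4 by (simp add: \<beta>_def)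
      have "M * (8 * M / U) = 8 * (real q)\<^sup>2 * (real b ^ (2 * n) / U)"
        by (simp add: M_def power2_eq_square mult_2 power_add)
      also have "real b ^ (2 * n) / U \<le> real b ^ (2 * n) / real b ^ (4 * n)"
        using bU b U by (intro divide_left_mono) auto
      also have "\<dots> = 1 / real b ^ (2 * n)"
      proof -
        have "4 * n = 2 * n + 2 * n" by simp
        then show ?thesis using b by (simp only: power_add) simp
      qed
      also have "\<dots> \<le> 1 / real b ^ 1"
        using b n by (intro divide_left_mono power_increasing) auto
      also have "\<dots> = real b powr (- 1)" using b by (simp add: powr_minus inverse_eq_divide)
      also have "\<dots> \<le> real b powr (- \<gamma>)" using b \<gamma> by (intro powr_mono) auto
      finally show "M * (8 * M / U) \<le> 8 * (real q)\<^sup>2 * real b powr (- \<gamma>)"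
        by (simp add: mult_left_mono)
    qed
    also have "\<dots> = (C4 * C5 powr \<gamma> + 8 * (real q)\<^sup>2) * real b powr (- \<gamma>)"
      by (simp add: \<beta>_def algebra_simps)
    finally show ?thesis unfolding total .
  qed
  moreover have "0 < C4 * C5 powr \<gamma> + 8 * (real q)\<^sup>2" using C4 K by (intro add_pos_nonneg mult_pos_pos) auto
  ultimately show ?thesis using \<gamma>(1)
    by (intro exI[of _ k0] exI[of _ \<gamma>] exI[of _ "C4 * C5 powr \<gamma> + 8 * (real q)\<^sup>2"]) auto
qed

section \<open>Uniform convergence of the symmetric sums\<close>

lemma reduced_fraction:
  fixes a e :: int
  assumes "e \<noteq> 0"
  obtains a' :: int and b :: nat where "1 \<le> b" "coprime a' (int b)" "real b \<le> real_of_int \<bar>e\<bar>"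
    "real_of_int a / real_of_int e = real_of_int a' / real b"
proof -
  have "gcd a e \<noteq> 0" using assms by simp
  then obtain a1 e1 where ae: "a = a1 * gcd a e" "e = e1 * gcd a e" "coprime a1 e1"
    using gcd_coprime_exists[of a e] by blast
  have e1: "e1 \<noteq> 0" using ae(2) assms by auto
  have "\<bar>e1\<bar> * 1 \<le> \<bar>e1\<bar> * gcd a e" using \<open>gcd a e \<noteq> 0\<close> by (intro mult_left_mono) (auto simp: int_one_le_iff_zero_less)
  also have "\<dots> = \<bar>e\<bar>" by (subst (2) ae(2)) (simp add: abs_mult)
  finally have le: "\<bar>e1\<bar> \<le> \<bar>e\<bar>" by simp
  have "real_of_int a / real_of_int e = real_of_int (a1 * gcd a e) / real_of_int (e1 * gcd a e)"
    using ae by simp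
  also have "\<dots> = real_of_int a1 / real_of_int e1" using \<open>gcd a e \<noteq> 0\<close> by simp
  also have "\<dots> = real_of_int (sgn e1 * a1) / real (nat \<bar>e1\<bar>)"
    using e1 by (simp add: sgn_if)
  finally have "real_of_int a / real_of_int e = real_of_int (sgn e1 * a1) / real (nat \<bar>e1\<bar>)" .
  moreover have "coprime (sgn e1 * a1) (int (nat \<bar>e1\<bar>))"
    using ae(3) e1 by (simp add: sgn_if)
  ultimately show ?thesis using that[of "nat \<bar>e1\<bar>" "sgn e1 * a1"] e1 le by simp
qed

text \<open>With \<open>N = 2 ^ k\<close>: \<open>b\<close> is at most \<open>N\<close> to the power
  \<open>1 / (4 n)\<close>, and the distance is at most \<open>N\<close> to the power
  \<open>3/2 - n\<close>. The condition is squared to avoid half-integral exponents.\<close>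

definition well_approx :: "nat \<Rightarrow> real \<Rightarrow> nat \<Rightarrow> int \<Rightarrow> nat \<Rightarrow> bool" where
  "well_approx n \<theta> k a b \<longleftrightarrow> 1 \<le> b \<and> coprime a (int b) \<and> b ^ (4 * n) \<le> 2 ^ k \<and>
     (\<theta> - a / b)\<^sup>2 * (2 ^ k) ^ (2 * n - 3) \<le> 1"

text \<open>The kernel terms of \<open>j\<close> and \<open>- j\<close> together; the minus sign
  comes from the denominator \<open>- j\<close>.\<close>

definition osc :: "(nat \<Rightarrow> int) \<Rightarrow> nat \<Rightarrow> nat \<Rightarrow> real \<Rightarrow> real \<Rightarrow> nat \<Rightarrow> complex" where
  "osc A n q \<theta> x j = (ee (qphase A n q \<theta> (real j) + x * real j) - ee (qphase A n q \<theta> (- real j) - x * real j)) / of_nat j"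

text \<open>Contraposition of the inverse Weyl inequality with
  \<open>T = 2 powr (\<delta> * k)\<close>. The factor \<open>D\<close> of the leading coefficient
  goes into the denominator, and reducing the resulting fraction gives a pair that contradicts the
  hypothesis.\<close>

lemma minor_block_bound:
  fixes A :: "nat \<Rightarrow> int"
  assumes n: "3 \<le> n" and q: "0 < q" and An: "A n \<noteq> 0"
  shows "\<exists>(k1::nat) \<delta>. 0 < \<delta> \<and> (\<forall>\<theta> k x. k1 \<le> k \<longrightarrow> (\<nexists>a b. well_approx n \<theta> k a b) \<longrightarrow>
     cmod (\<Sum>j\<in>{2 ^ k<..2 ^ Suc k}. osc A n q \<theta> x j) \<le> 2 * 2 powr (- (\<delta> * real k)))"
proof -
  define D where "D = int n * A n * int q ^ (n - 2)"
  have D0: "D \<noteq> 0" using n q An by (simp add: D_def)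
  obtain K :: nat where K: "1 \<le> K" and W: "\<And>(T::real) (N::nat) m (x::real) (s::int) (\<theta>::real). 1 \<le> T \<Longrightarrow> 1 \<le> N \<Longrightarrow> m \<le> N \<Longrightarrow>
      N \<le> cmod (\<Sum>j<m. ee (qphase A n q \<theta> (s + real j) + x * real j)) * T \<Longrightarrow>
      (\<exists>(b::nat) (a::int). (1::nat) \<le> b \<and> b \<le> K * T ^ K \<and>
        \<bar>b * (real_of_int D * \<theta>) - a\<bar> * real N ^ (n - 1) \<le> K * T ^ K)"
    using weyl_inverse_qphase[OF n q, of A] unfolding D_def by blast
  define L where "L = real_of_int \<bar>D\<bar> * K"
  have L: "1 \<le> L" "K \<le> L"
  proof -
    have "1 * real K \<le> L" unfolding L_def using D0 by (intro mult_right_mono) auto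
    then show "K \<le> L" "1 \<le> L" using K by auto
  qed
  \<comment> \<open>Makes \<open>T ^ (4 * n * K)\<close> equal to \<open>h\<close>, the square root
    of \<open>N\<close>. The other factor \<open>h\<close> absorbs \<open>L ^ (4 * n)\<close>, so
    that \<open>(L * T ^ K) ^ (4 * n) \<le> N\<close> controls denominator and distance at
    once.\<close>
  define \<delta> where "\<delta> = 1 / (8 * real n * real K)"
  have \<delta>: "0 < \<delta>" using n K by (simp add: \<delta>_def)
  obtain k1 where k1: "L ^ (8 * n) < 2 ^ k1" using real_arch_pow[of 2 "L ^ (8 * n)"] by auto
  have "cmod (\<Sum>j\<in>{2 ^ k<..2 ^ Suc k}. osc A n q \<theta> x j) \<le> 2 * 2 powr (- (\<delta> * real k))"
    if k: "k1 \<le> k" and none: "\<nexists>a b. well_approx n \<theta> k a b" for \<theta> x :: real and k :: nat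
  proof -
    define T where "T = 2 powr (\<delta> * real k)"
    define N :: nat where "N = 2 ^ k"
    have T: "1 \<le> T" using \<delta> by (simp add: T_def ge_one_powr_ge_zero)
    have N: "1 \<le> N" by (simp add: N_def)
    define h where "h = 2 powr (real k / 2)"
    have hh: "h * h = N" by (simp add: h_def N_def powr_add[symmetric] powr_realpow)
    have h1: "1 \<le> h" by (simp add: h_def ge_one_powr_ge_zero)
    have T1: "T ^ (4 * n * K) = h"
    proof -
      have "T ^ (4 * n * K) = 2 powr (\<delta> * real k * real (4 * n * K))"
        unfolding T_def by (simp add: powr_powr flip: powr_realpow)
      also have "\<delta> * real k * real (4 * n * K) = real k / 2"
        using n K by (simp add: \<delta>_def field_simps)
      finally show ?thesis by (simp add: h_def)
    qed
    have Lh: "L ^ (4 * n) \<le> h"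
    proof (rule power2_le_imp_le)
      have "(L ^ (4 * n))\<^sup>2 = L ^ (8 * n)" by (simp flip: power_mult)
      also have "\<dots> \<le> 2 ^ k" by (rule order.trans[OF less_imp_le[OF k1]]) (simp add: k)
      finally show "(L ^ (4 * n))\<^sup>2 \<le> h\<^sup>2" using hh by (simp add: power2_eq_square N_def)
    qed (use h1 in simp)
    have bound: "cmod (\<Sum>j<m. ee (qphase A n q \<theta> (of_int s + real j) + y * real j)) \<le> N / T" if m: "m \<le> N" for m s y
    proof (rule ccontr)
      assume "\<not> ?thesis"
      then have "N \<le> cmod (\<Sum>j<m. ee (qphase A n q \<theta> (of_int s + real j) + y * real j)) * T"
        using T by (simp add: field_simps)
      from W[OF T N m this] obtain b1 :: nat and a1 :: int where b1: "1 \<le> b1" "b1 \<le> K * T ^ K"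
        "\<bar>b1 * (real_of_int D * \<theta>) - a1\<bar> * real N ^ (n - 1) \<le> K * T ^ K" by blast
      define e where "e = int b1 * D"
      have e0: "e \<noteq> 0" using b1 D0 by (simp add: e_def)
      obtain a :: int and b :: nat where ab: "1 \<le> b" "coprime a (int b)" "real b \<le> real_of_int \<bar>e\<bar>"
        "real_of_int a1 / real_of_int e = real_of_int a / real b"
        using reduced_fraction[OF e0] by blast
      have "real b \<le> real_of_int \<bar>D\<bar> * real b1" using ab(3) by (simp add: e_def abs_mult mult.commute)
      also have "\<dots> \<le> real_of_int \<bar>D\<bar> * (K * T ^ K)" using b1(2) by (intro mult_left_mono) auto
      finally have bL: "real b \<le> L * T ^ K" by (simp add: L_def)
      have "real b ^ (4 * n) \<le> (L * T ^ K) ^ (4 * n)" using bL by (intro power_mono) auto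
      also have "\<dots> = L ^ (4 * n) * T ^ (4 * n * K)" by (simp add: power_mult_distrib mult.commute flip: power_mult)
      also have "\<dots> \<le> h * h" unfolding T1 using Lh h1 by (intro mult_right_mono) auto
      finally have "real (b ^ (4 * n)) \<le> real (2 ^ k)" unfolding hh N_def by simp
      then have 1: "b ^ (4 * n) \<le> 2 ^ k" by (simp only: of_nat_le_iff)
      define t where "t = \<bar>\<theta> - a / b\<bar>"
      have "t * N ^ (n - 1) \<le> K * T ^ K"
      proof -
        have "b1 * (real_of_int D * \<theta>) - a1 = real_of_int e * (\<theta> - a / b)"
          unfolding ab(4)[symmetric] using e0 by (simp add: e_def field_simps)
        then have "\<bar>b1 * (real_of_int D * \<theta>) - a1\<bar> = \<bar>real_of_int e\<bar> * t"
          by (simp add: abs_mult t_def)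
        moreover have "1 \<le> \<bar>real_of_int e\<bar>" using e0 by linarith
        then have "1 * t \<le> \<bar>real_of_int e\<bar> * t" by (rule mult_right_mono) (simp add: t_def)
        ultimately have "t \<le> \<bar>b1 * (real_of_int D * \<theta>) - a1\<bar>" by simp
        then have "t * real N ^ (n - 1) \<le> \<bar>b1 * (real_of_int D * \<theta>) - a1\<bar> * real N ^ (n - 1)"
          by (intro mult_right_mono) auto
        then show ?thesis using b1(3) by simp
      qed
      also have "\<dots> \<le> L * T ^ K" using L(2) T by (intro mult_right_mono) auto
      finally have tN: "t * N ^ (n - 1) \<le> L * T ^ K" .
      \<comment> \<open>Of the exponent \<open>2 * n - 2\<close> one power of \<open>N\<close> is
        given away, which leaves the \<open>2 * n - 3\<close> of \<open>well_approx\<close>.\<close>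
      have "(t * N ^ (n - 1))\<^sup>2 \<le> (L * T ^ K)\<^sup>2" using tN by (rule power_mono) (simp add: t_def)
      also have "\<dots> \<le> (L * T ^ K) ^ (4 * n)"
      proof (rule power_increasing)
        have "1 * 1 \<le> L * T ^ K" using L T by (intro mult_mono) auto
        then show "1 \<le> L * T ^ K" by simp
      qed (use n in simp)
      also have "\<dots> = L ^ (4 * n) * T ^ (4 * n * K)" by (simp add: power_mult_distrib mult.commute flip: power_mult)
      also have "\<dots> \<le> h * h" unfolding T1 using Lh h1 by (intro mult_right_mono) auto
      finally have "t\<^sup>2 * (real N ^ (n - 1))\<^sup>2 \<le> 1 * real N" unfolding hh by (simp add: power_mult_distrib)
      also have "(real N ^ (n - 1))\<^sup>2 = real N ^ (2 * n - 3) * real N"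
      proof -
        have "(n - 1) * 2 = Suc (2 * n - 3)" using n by simp
        then show ?thesis by (simp only: power_mult[symmetric] power_Suc mult.commute)
      qed
      finally have "t\<^sup>2 * real N ^ (2 * n - 3) * N \<le> 1 * real N" by (simp only: mult.assoc)
      then have "t\<^sup>2 * real N ^ (2 * n - 3) \<le> 1" using N by (subst (asm) mult_le_cancel_right_pos) auto
      then have "well_approx n \<theta> k a b"
        using ab 1 by (simp add: well_approx_def t_def N_def)
      then show False using none by blast
    qed
    have one: "cmod (\<Sum>j\<in>{N<..2 * N}. ee (qphase A n q \<theta> (real j) + x * real j) / of_nat j) \<le> (N / T) / N"
    proof (rule norm_sum_over_le)
      fix r assume r: "r \<le> 2 * N"
      have "(\<Sum>j\<in>{N<..r}. ee (qphase A n q \<theta> (real j) + x * real j)) =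
          (\<Sum>i<r - N. ee (x * real (Suc N)) * ee (qphase A n q \<theta> (of_int (int (Suc N)) + real i) + x * real i))"
        by (rule sum.reindex_bij_witness[of _ "\<lambda>i. Suc N + i" "\<lambda>j. j - Suc N"])
           (auto simp: ee_add[symmetric] algebra_simps of_nat_diff)
      also have "\<dots> = ee (x * real (Suc N)) * (\<Sum>i<r - N. ee (qphase A n q \<theta> (of_int (int (Suc N)) + real i) + x * real i))"
        by (simp only: sum_distrib_left)
      finally show "cmod (\<Sum>j\<in>{N<..r}. ee (qphase A n q \<theta> (real j) + x * real j)) \<le> N / T"
        using bound[of "r - N" "int (Suc N)" x] r by (simp only: norm_mult norm_ee) simp
    qed (use N in simp)
    have two: "cmod (\<Sum>j\<in>{N<..2 * N}. ee (qphase A n q \<theta> (- real j) - x * real j) / of_nat j) \<le> (N / T) / N"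
    proof (rule norm_sum_over_le)
      fix r assume r: "r \<le> 2 * N"
      \<comment> \<open>Read backwards, the frequencies \<open>- j\<close> are consecutive integers
        increasing from \<open>- r\<close>.\<close>
      have "(\<Sum>j\<in>{N<..r}. ee (qphase A n q \<theta> (- real j) - x * real j)) =
          (\<Sum>i<r - N. ee (- x * real r) * ee (qphase A n q \<theta> (of_int (- int r) + real i) + x * real i))"
        by (rule sum.reindex_bij_witness[of _ "\<lambda>i. r - i" "\<lambda>j. r - j"])
           (auto simp: ee_add[symmetric] algebra_simps of_nat_diff)
      also have "\<dots> = ee (- x * real r) * (\<Sum>i<r - N. ee (qphase A n q \<theta> (of_int (- int r) + real i) + x * real i))"
        by (simp only: sum_distrib_left)
      finally show "cmod (\<Sum>j\<in>{N<..r}. ee (qphase A n q \<theta> (- real j) - x * real j)) \<le> N / T"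
        using bound[of "r - N" "- int r" x] r by (simp only: norm_mult norm_ee) simp
    qed (use N in simp)
    have "cmod (\<Sum>j\<in>{2 ^ k<..2 ^ Suc k}. osc A n q \<theta> x j) \<le> (N / T) / N + (N / T) / N"
      unfolding osc_def diff_divide_distrib sum_subtractf
      using one two by (intro order.trans[OF norm_triangle_ineq4] add_mono) (simp_all add: N_def)
    also have "\<dots> = 2 * (1 / T)" using N by simp
    also have "1 / T = 2 powr (- (\<delta> * real k))" by (simp add: T_def powr_minus inverse_eq_divide)
    finally show ?thesis .
  qed
  then show ?thesis using \<delta> by blast
qed

text \<open>Distinct reduced fractions are at least \<open>1 / (b * b')\<close> apart, and
  \<open>b * b'\<close> is at most the square root of \<open>2 ^ k\<close>. Both distances to
  \<open>\<theta>\<close> are at most \<open>2 ^ k\<close> to the power \<open>-3/2\<close>, too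
  small to bridge the gap when \<open>k\<close> is at least 2.\<close>

lemma well_approx_unique:
  assumes n: "3 \<le> n" and k: "2 \<le> k" and w: "well_approx n \<theta> k a b" "well_approx n \<theta> k a' b'"
  shows "a = a'" "b = b'"
proof -
  have aux: "(b::nat) ^ 4 \<le> 2 ^ k" "(\<theta> - a / b)\<^sup>2 * (2 ^ k) ^ 3 \<le> 1" if "well_approx n \<theta> k a b" for a b
  proof -
    have "b ^ 4 \<le> b ^ (4 * n)" using that n by (intro power_increasing) (auto simp: well_approx_def)
    then show "b ^ 4 \<le> 2 ^ k" using that by (simp add: well_approx_def)
    have "(\<theta> - a / b)\<^sup>2 * (2 ^ k) ^ 3 \<le> (\<theta> - a / b)\<^sup>2 * (2 ^ k) ^ (2 * n - 3)"
      using n by (intro mult_left_mono power_increasing) auto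
    then show "(\<theta> - a / b)\<^sup>2 * (2 ^ k) ^ 3 \<le> 1" using that by (simp add: well_approx_def)
  qed
  have b: "1 \<le> b" "1 \<le> b'" "coprime a (int b)" "coprime a' (int b')" using w by (auto simp: well_approx_def)
  have eq: "a * int b' = a' * int b"
  proof (rule ccontr)
    assume "a * int b' \<noteq> a' * int b"
    then have "1 \<le> \<bar>a * int b' - a' * int b\<bar>" by linarith
    then have "1 \<le> real_of_int \<bar>a * int b' - a' * int b\<bar>" by linarith
    also have "\<dots> = real b * real b' * \<bar>a / b - a' / b'\<bar>"
    proof -
      have "real_of_int (a * int b' - a' * int b) = real b * real b' * (a / b - a' / b')"
        using b by (simp add: field_simps)
      then show ?thesis by (simp only: of_int_abs abs_mult abs_of_nat)
    qed
    finally have "1\<^sup>2 \<le> (real b * real b' * \<bar>a / b - a' / b'\<bar>)\<^sup>2" by (intro power_mono) auto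
    then have 1: "1 \<le> (real b * real b')\<^sup>2 * (a / b - a' / b')\<^sup>2" by (simp add: power_mult_distrib)
    have 2: "(real b * real b')\<^sup>2 \<le> 2 ^ k"
    proof (rule power2_le_imp_le)
      have "((real b * real b')\<^sup>2)\<^sup>2 = real (b ^ 4) * real (b' ^ 4)"
        by (simp add: power_mult_distrib flip: power_mult)
      also have "\<dots> \<le> real (2 ^ k) * real (2 ^ k)"
        using aux(1)[OF w(1)] aux(1)[OF w(2)] by (intro mult_mono) (simp_all only: of_nat_le_iff of_nat_0_le_iff)
      finally show "((real b * real b')\<^sup>2)\<^sup>2 \<le> ((2::real) ^ k)\<^sup>2" by (simp add: power2_eq_square)
    qed simp
    define u v where "u = \<theta> - a / b" and "v = \<theta> - a' / b'"
    have "(a / b - a' / b')\<^sup>2 = (v - u)\<^sup>2" by (simp add: u_def v_def)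
    also have "\<dots> \<le> 2 * (u\<^sup>2 + v\<^sup>2)"
      using zero_le_power2[of "u + v"] by (simp add: power2_eq_square algebra_simps)
    finally have 3: "(a / b - a' / b')\<^sup>2 \<le> 2 * (u\<^sup>2 + v\<^sup>2)" .
    define P :: real where "P = 2 ^ k"
    have P: "4 \<le> P" using power_increasing[OF k, of "2::real"] by (simp add: P_def)
    have "P ^ 2 * 1 \<le> P ^ 2 * ((real b * real b')\<^sup>2 * (a / b - a' / b')\<^sup>2)"
      using 1 by (intro mult_left_mono) auto
    also have "\<dots> \<le> P ^ 2 * (P * (2 * (u\<^sup>2 + v\<^sup>2)))"
      using 2 3 P by (intro mult_left_mono mult_mono) (auto simp: P_def)
    also have "\<dots> = 2 * (u\<^sup>2 * P ^ 3 + v\<^sup>2 * P ^ 3)" by (simp add: power2_eq_square power3_eq_cube algebra_simps)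
    also have "\<dots> \<le> 4" using aux(2)[OF w(1)] aux(2)[OF w(2)] by (simp add: u_def v_def P_def)
    finally have "P\<^sup>2 \<le> 4" by simp
    moreover have "4 * 4 \<le> P * P" using P by (intro mult_mono) auto
    ultimately show False by (simp add: power2_eq_square)
  qed
  have "int b dvd a * int b'" "int b' dvd a' * int b" by (simp_all add: eq) (simp add: eq[symmetric])
  then have "int b dvd int b'" "int b' dvd int b"
    using b by (simp_all add: coprime_commute coprime_dvd_mult_right_iff)
  then show "b = b'" by (simp add: dvd_antisym)
  then show "a = a'" using eq b by simp
qed

text \<open>For arbitrary finite sets, since neither the minor scales nor the first scales of the
  runs need be consecutive.\<close>

lemma finite_geometric_tail:
  fixes \<delta> \<epsilon> :: real
  assumes "0 < \<delta>" "0 < \<epsilon>"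
  shows "\<exists>k0. \<forall>S. finite S \<longrightarrow> S \<subseteq> {k0..} \<longrightarrow> (\<Sum>k\<in>S. 2 powr (- (\<delta> * real k))) \<le> \<epsilon>"
proof -
  define w :: real where "w = 2 powr (- \<delta>)"
  have w: "0 < w" "w < 1" using assms(1) by (auto simp: w_def powr_less_one)
  have wk: "2 powr (- (\<delta> * real k)) = w ^ k" for k
    by (simp add: w_def powr_powr flip: powr_realpow)
  have "summable (\<lambda>k. w ^ k)" using w by (intro summable_geometric) auto
  then obtain k0 where k0: "\<And>m n. m \<ge> k0 \<Longrightarrow> norm (\<Sum>k\<in>{m..<n}. w ^ k) < \<epsilon>"
    using assms(2) unfolding summable_Cauchy by blast
  have "(\<Sum>k\<in>S. 2 powr (- (\<delta> * real k))) \<le> \<epsilon>" if "finite S" "S \<subseteq> {k0..}" for S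
  proof -
    have "S \<subseteq> {k0..<Suc (Max (insert 0 S))}"
      using that by (auto simp: less_Suc_eq_le)
    then have "(\<Sum>k\<in>S. w ^ k) \<le> (\<Sum>k\<in>{k0..<Suc (Max (insert 0 S))}. w ^ k)"
      using w by (intro sum_mono2) auto
    also have "\<dots> \<le> \<epsilon>" using k0[of k0 "Suc (Max (insert 0 S))"] by (simp only: real_norm_def) linarith
    finally show ?thesis by (simp only: wk)
  qed
  then show ?thesis by blast
qed

lemma irrational_distance:
  fixes \<theta> :: real and m :: nat
  assumes "\<theta> \<notin> \<rat>"
  shows "\<exists>\<eta>>0. \<forall>(a::int) (b::nat). 1 \<le> b \<longrightarrow> b \<le> m \<longrightarrow> \<eta> \<le> \<bar>\<theta> - a / b\<bar>"
proof (induction m)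
  case 0
  then show ?case by (intro exI[of _ 1]) simp
next
  case (Suc m)
  then obtain \<eta> where \<eta>: "0 < \<eta>" "\<And>(a::int) (b::nat). 1 \<le> b \<Longrightarrow> b \<le> m \<Longrightarrow> \<eta> \<le> \<bar>\<theta> - a / b\<bar>"
    by blast
  define \<eta>' where "\<eta>' = \<bar>Suc m * \<theta> - round (Suc m * \<theta>)\<bar> / Suc m"
  have "Suc m * \<theta> \<noteq> round (Suc m * \<theta>)"
  proof
    assume "Suc m * \<theta> = round (Suc m * \<theta>)"
    then have "\<theta> = real_of_int (round (Suc m * \<theta>)) / Suc m" by (simp add: field_simps)
    then show False using assms by (metis Rats_divide Rats_of_int Rats_of_nat)
  qed
  then have "0 < \<eta>'" by (simp add: \<eta>'_def)
  moreover have "\<eta>' \<le> \<bar>\<theta> - a / real (Suc m)\<bar>" for a :: int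
  proof -
    have "\<bar>Suc m * \<theta> - round (Suc m * \<theta>)\<bar> \<le> \<bar>Suc m * \<theta> - a\<bar>"
      using round_diff_minimal[of "Suc m * \<theta>" a] by (simp add: abs_minus_commute)
    also have "\<dots> = Suc m * \<bar>\<theta> - a / real (Suc m)\<bar>"
    proof -
      have "Suc m * \<theta> - a = Suc m * (\<theta> - a / real (Suc m))" by (simp add: field_simps)
      then show ?thesis by (simp only: abs_mult abs_of_nat)
    qed
    finally show ?thesis by (simp add: \<eta>'_def field_simps)
  qed
  ultimately show ?case using \<eta>
    by (intro exI[of _ "min \<eta> \<eta>'"]) (auto simp: le_Suc_eq min_le_iff_disj)
qed

theorem symmetric_sums_uniformly_Cauchy:
  fixes A :: "nat \<Rightarrow> int" and \<theta> :: real
  assumes n: "3 \<le> n" and q: "0 < q" and An: "A n \<noteq> 0" and \<theta>: "\<bar>\<theta>\<bar> \<le> 1" "\<theta> \<notin> \<rat>" and \<epsilon>: "0 < \<epsilon>"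
  shows "\<exists>k0. \<forall>k l x. k0 \<le> k \<longrightarrow> k \<le> l \<longrightarrow> cmod (\<Sum>j\<in>{2 ^ k<..2 ^ l}. osc A n q \<theta> x j) \<le> \<epsilon>"
proof -
  obtain k1 \<delta> where minor: "0 < \<delta>" "\<And>\<theta> k x. k1 \<le> k \<Longrightarrow> (\<nexists>a b. well_approx n \<theta> k a b) \<Longrightarrow>
     cmod (\<Sum>j\<in>{2 ^ k<..2 ^ Suc k}. osc A n q \<theta> x j) \<le> 2 * 2 powr (- (\<delta> * real k))"
    using minor_block_bound[where A = A, OF n q An] by blast
  obtain k2 \<gamma> B where major: "0 < \<gamma>" "0 < B" "\<And>\<theta> (a::int) (b::nat) k l x. \<bar>\<theta>\<bar> \<le> 1 \<Longrightarrow> 1 \<le> b \<Longrightarrow> coprime a (int b) \<Longrightarrow>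
     \<theta> \<noteq> a / b \<Longrightarrow> \<bar>\<theta> - a / b\<bar> \<le> 1 \<Longrightarrow> k2 \<le> k \<Longrightarrow> k < l \<Longrightarrow> b ^ (4 * n) \<le> 2 ^ k \<Longrightarrow>
     (\<theta> - a / b)\<^sup>2 * (2 ^ (l - 1)) ^ (2 * n - 3) \<le> 1 \<Longrightarrow>
     cmod (\<Sum>j\<in>{2 ^ k<..2 ^ l}. osc A n q \<theta> x j) \<le> B * real b powr (- \<gamma>)"
    using major_run_bound[where A = A, OF n q An] unfolding osc_def by blast
  define \<gamma>' where "\<gamma>' = \<gamma> / (4 * n)"
  define B' where "B' = B * 2 powr \<gamma>'"
  have \<gamma>': "0 < \<gamma>'" using major(1) n by (simp add: \<gamma>'_def)
  have B': "0 < B'" using major(2) by (simp add: B'_def)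
  obtain k3 where k3: "\<And>S. finite S \<Longrightarrow> S \<subseteq> {k3..} \<Longrightarrow> (\<Sum>k\<in>S. 2 powr (- (\<delta> * real k))) \<le> \<epsilon> / 4"
    using finite_geometric_tail[OF minor(1), of "\<epsilon> / 4"] \<epsilon> by auto
  obtain k4 where k4: "\<And>S. finite S \<Longrightarrow> S \<subseteq> {k4..} \<Longrightarrow> (\<Sum>k\<in>S. 2 powr (- (\<gamma>' * real k))) \<le> \<epsilon> / 2 / B'"
    using finite_geometric_tail[OF \<gamma>', of "\<epsilon> / 2 / B'"] \<epsilon> B' by auto
  define m0 where "m0 = k1 + k2 + k3 + k4 + 2"
  \<comment> \<open>Fractions with denominator at most \<open>2 ^ m0\<close> keep the distance
    \<open>\<eta>\<close> from \<open>\<theta>\<close>, and from the scale \<open>k5\<close> on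
    \<open>well_approx\<close> demands more. Beyond \<open>k0\<close> only fractions with
    \<open>m0 \<le> \<kappa> b\<close> are left.\<close>
  from irrational_distance[OF \<theta>(2), of "2 ^ m0"] obtain \<eta> where \<eta>0: "0 < \<eta>"
    and \<eta>1: "\<forall>(a::int) (b::nat). (1::nat) \<le> b \<longrightarrow> b \<le> (2::nat) ^ m0 \<longrightarrow> \<eta> \<le> \<bar>\<theta> - a / b\<bar>"
    by (elim exE conjE)
  note \<eta> = \<eta>0 \<eta>1[rule_format]
  obtain k5 where k5: "1 / \<eta>\<^sup>2 < 2 ^ k5" using real_arch_pow[of 2 "1 / \<eta>\<^sup>2"] by auto
  define k0 where "k0 = m0 + k5"
  \<comment> \<open>The first scale that admits the denominator \<open>b\<close>. A run is charged
    to it even if it lies before \<open>k\<close>, so the charge does not depend on the summation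
    range.\<close>
  define \<kappa> where "\<kappa> b = (LEAST k. b ^ (4 * n) \<le> 2 ^ k)" for b :: nat
  have \<kappa>_ex: "\<exists>k. b ^ (4 * n) \<le> 2 ^ k" for b :: nat
    using less_exp[of "b ^ (4 * n)"] by (meson less_imp_le)
  have \<kappa>: "b ^ (4 * n) \<le> 2 ^ \<kappa> b" for b
    unfolding \<kappa>_def by (rule LeastI_ex[OF \<kappa>_ex])
  have \<kappa>_le: "\<kappa> b \<le> k" if "b ^ (4 * n) \<le> 2 ^ k" for b k
    unfolding \<kappa>_def using that by (rule Least_le)
  have approx_le: "(\<theta> - a / b)\<^sup>2 * (2 ^ j) ^ (2 * n - 3) \<le> 1" if "well_approx n \<theta> k a b" "j \<le> k" for a b j k
  proof -
    have "(\<theta> - a / b)\<^sup>2 * (2 ^ j) ^ (2 * n - 3) \<le> (\<theta> - a / b)\<^sup>2 * (2 ^ k) ^ (2 * n - 3)"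
      using that(2) by (intro mult_left_mono power_mono power_increasing) auto
    then show ?thesis using that(1) by (simp add: well_approx_def)
  qed
  have well_approx_down: "well_approx n \<theta> j a b" if "well_approx n \<theta> k a b" "j \<le> k" "b ^ (4 * n) \<le> 2 ^ j" for a b j k
    using that approx_le[OF that(1,2)] by (simp add: well_approx_def)
  have \<kappa>_ge: "m0 \<le> \<kappa> b" if "well_approx n \<theta> k a b" "k0 \<le> k" for a b k
  proof (rule ccontr)
    assume "\<not> ?thesis"
    then have "b ^ (4 * n) \<le> 2 ^ m0"
      by (intro order.trans[OF \<kappa>] power_increasing) auto
    moreover have "b \<le> b ^ (4 * n)" using that n by (intro self_le_power) (auto simp: well_approx_def)
    ultimately have "\<eta> \<le> \<bar>\<theta> - a / b\<bar>" using that by (intro \<eta>(2)) (auto simp: well_approx_def)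
    then have "\<eta>\<^sup>2 \<le> \<bar>\<theta> - a / b\<bar>\<^sup>2" using \<eta>(1) by (intro power_mono) auto
    then have "\<eta>\<^sup>2 \<le> (\<theta> - a / b)\<^sup>2" by simp
    then have "\<eta>\<^sup>2 * 2 ^ k5 \<le> (\<theta> - a / b)\<^sup>2 * (2 ^ k) ^ (2 * n - 3)"
    proof (rule mult_mono)
      have "(2::real) ^ k5 \<le> 2 ^ k" using that(2) by (intro power_increasing) (auto simp: k0_def)
      also have "\<dots> \<le> (2 ^ k) ^ (2 * n - 3)" using n by (intro self_le_power) auto
      finally show "(2::real) ^ k5 \<le> (2 ^ k) ^ (2 * n - 3)" .
    qed auto
    also have "\<dots> \<le> 1" using that by (simp add: well_approx_def)
    finally show False using k5 \<eta>(1) by (simp add: field_simps)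
  qed
  \<comment> \<open>By minimality \<open>b ^ (4 * n)\<close> exceeds
    \<open>2 ^ (\<kappa> b - 1)\<close>, so a negative power of \<open>b\<close> is geometrically
    small in \<open>\<kappa> b\<close>.\<close>
  have powr_\<kappa>: "B * real b powr (- \<gamma>) \<le> B' * 2 powr (- (\<gamma>' * real (\<kappa> b)))" if b: "1 \<le> b" and kb: "1 \<le> \<kappa> b" for b
  proof -
    have "\<not> b ^ (4 * n) \<le> 2 ^ (\<kappa> b - 1)" using \<kappa>_le[of b "\<kappa> b - 1"] kb by fastforce
    then have "2 ^ (\<kappa> b - 1) \<le> b ^ (4 * n)" by simp
    then have le: "(2::real) ^ (\<kappa> b - 1) \<le> real b ^ (4 * n)"
      by (metis of_nat_le_iff of_nat_numeral of_nat_power)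
    have "real b powr (- \<gamma>) = (real b ^ (4 * n)) powr (- \<gamma>')"
      using b n by (simp add: \<gamma>'_def powr_powr flip: powr_realpow)
    also have "\<dots> \<le> (2 ^ (\<kappa> b - 1)) powr (- \<gamma>')"
      using le \<gamma>' by (intro powr_mono2') auto
    also have "\<dots> = 2 powr (- (\<gamma>' * real (\<kappa> b - 1)))"
      by (simp add: powr_powr mult.commute flip: powr_realpow)
    also have "\<dots> = 2 powr \<gamma>' * 2 powr (- (\<gamma>' * real (\<kappa> b)))"
      using kb by (simp add: of_nat_diff powr_add[symmetric] algebra_simps)
    finally show ?thesis using major(2) by (simp add: B'_def mult.assoc)
  qed
  have "cmod (\<Sum>j\<in>{2 ^ k<..2 ^ l}. osc A n q \<theta> x j) \<le> \<epsilon>" if k: "k0 \<le> k" and kl: "k \<le> l" for k l x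
  proof -
    define F where "F i = (\<Sum>j\<in>{2 ^ i<..2 ^ Suc i}. osc A n q \<theta> x j)" for i
    define Bd where "Bd = {i \<in> {k..<l}. \<exists>a b. well_approx n \<theta> i a b}"
    define p where "p i = (SOME ab. well_approx n \<theta> i (fst ab) (snd ab))" for i
    have p: "well_approx n \<theta> i (fst (p i)) (snd (p i))" if "i \<in> Bd" for i
    proof -
      have "\<exists>ab. well_approx n \<theta> i (fst ab) (snd ab)" using that by (auto simp: Bd_def)
      then show ?thesis unfolding p_def by (rule someI_ex)
    qed
    have big: "k0 \<le> i" "2 \<le> i" if "i \<in> {k..<l}" for i using that k by (auto simp: k0_def m0_def)
    have finBd: "finite Bd" by (simp add: Bd_def)
    have run: "cmod (\<Sum>i\<in>{i \<in> Bd. p i = ab}. F i) \<le> B' * 2 powr (- (\<gamma>' * real (\<kappa> (snd ab))))"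
      if "ab \<in> p ` Bd" for ab
    proof -
      obtain a b where ab: "ab = (a, b)" by (cases ab)
      define X where "X = {i \<in> {k..<l}. well_approx n \<theta> i a b}"
      have X: "{i \<in> Bd. p i = ab} = X"
      proof (intro set_eqI iffI)
        fix i assume "i \<in> {i \<in> Bd. p i = ab}"
        then show "i \<in> X" using p[of i] by (auto simp: X_def Bd_def ab)
      next
        fix i assume i: "i \<in> X"
        then have "i \<in> Bd" by (auto simp: X_def Bd_def)
        moreover have "fst (p i) = a" "snd (p i) = b"
          using well_approx_unique[OF n _ p[OF \<open>i \<in> Bd\<close>], of a b] big[of i] i by (auto simp: X_def)
        ultimately show "i \<in> {i \<in> Bd. p i = ab}" by (auto simp: ab prod_eq_iff)
      qed
      have ne: "X \<noteq> {}" using that X by auto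
      have finX: "finite X" by (simp add: X_def)
      define u v where "u = Min X" and "v = Max X"
      have uv: "u \<in> X" "v \<in> X" "u \<le> v" using ne finX by (auto simp: u_def v_def)
      \<comment> \<open>The condition on the denominator is inherited upwards from \<open>u\<close>,
        the approximation downwards from \<open>v\<close>.\<close>
      have "X = {u..<Suc v}"
      proof (intro set_eqI iffI)
        fix i assume "i \<in> X"
        then show "i \<in> {u..<Suc v}" using finX by (auto simp: u_def v_def less_Suc_eq_le)
      next
        fix i assume i: "i \<in> {u..<Suc v}"
        have "b ^ (4 * n) \<le> 2 ^ u" using uv(1) by (simp add: X_def well_approx_def)
        also have "\<dots> \<le> 2 ^ i" using i by (intro power_increasing) auto
        finally have bi: "b ^ (4 * n) \<le> 2 ^ i" .
        have "i \<le> v" using i by simp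
        moreover have "well_approx n \<theta> v a b" using uv(2) by (simp add: X_def)
        ultimately have "well_approx n \<theta> i a b"
          using well_approx_down bi by blast
        moreover have "i \<in> {k..<l}" using i uv(1,2) by (simp add: X_def)
        ultimately show "i \<in> X" by (simp add: X_def)
      qed
      then have "(\<Sum>i\<in>{i \<in> Bd. p i = ab}. F i) = (\<Sum>j\<in>{2 ^ u<..2 ^ Suc v}. osc A n q \<theta> x j)"
        unfolding X F_def using sum_dyadic[of u "Suc v" "osc A n q \<theta> x"] uv(3) by simp
      moreover have "cmod (\<Sum>j\<in>{2 ^ u<..2 ^ Suc v}. osc A n q \<theta> x j) \<le> B * real b powr (- \<gamma>)"
      proof (rule major(3)[OF \<theta>(1)])
        show "1 \<le> b" "coprime a (int b)" "b ^ (4 * n) \<le> 2 ^ u" using uv(1) by (auto simp: X_def well_approx_def)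
        show "k2 \<le> u" using uv(1) k by (auto simp: X_def k0_def m0_def)
        show "u < Suc v" using uv(3) by simp
        show "(\<theta> - a / b)\<^sup>2 * (2 ^ (Suc v - 1)) ^ (2 * n - 3) \<le> 1" using uv(2) by (simp add: X_def well_approx_def)
        show "\<theta> \<noteq> a / b" using \<theta>(2) by (metis Rats_divide Rats_of_int Rats_of_nat)
        have "(\<theta> - a / b)\<^sup>2 \<le> 1"
          using approx_le[of v a b 0] uv(2) by (simp add: X_def)
        then show "\<bar>\<theta> - a / b\<bar> \<le> 1" by (simp add: abs_square_le_1)
      qed
      moreover have "B * real b powr (- \<gamma>) \<le> B' * 2 powr (- (\<gamma>' * real (\<kappa> b)))"
      proof (rule powr_\<kappa>)
        show "1 \<le> b" using uv(1) by (auto simp: X_def well_approx_def)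
        have "m0 \<le> \<kappa> b" using uv(1) big by (intro \<kappa>_ge[of u a]) (auto simp: X_def)
        then show "1 \<le> \<kappa> b" by (simp add: m0_def)
      qed
      ultimately show ?thesis by (simp add: ab)
    qed
    \<comment> \<open>A fraction stays \<open>well_approx\<close> down to its own scale
      \<open>\<kappa>\<close>; two fractions charged to the same scale are both
      \<open>well_approx\<close> there and hence equal.\<close>
    have inj: "inj_on (\<lambda>ab. \<kappa> (snd ab)) (p ` Bd)"
    proof (rule inj_onI)
      fix s t assume st: "s \<in> p ` Bd" "t \<in> p ` Bd" "\<kappa> (snd s) = \<kappa> (snd t)"
      then obtain i j where ij: "i \<in> Bd" "j \<in> Bd" "s = p i" "t = p j" by auto
      have w: "well_approx n \<theta> (\<kappa> (snd (p i))) (fst (p i)) (snd (p i))" if "i \<in> Bd" for i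
        using p[OF that] by (intro well_approx_down[OF _ _ \<kappa>] \<kappa>_le) (auto simp: well_approx_def)
      have "m0 \<le> \<kappa> (snd s)" using \<kappa>_ge[OF p[OF ij(1)]] big ij by (auto simp: Bd_def)
      then have "2 \<le> \<kappa> (snd s)" by (simp add: m0_def)
      from well_approx_unique[OF n this, of \<theta> "fst s" "snd s" "fst t" "snd t"] show "s = t"
        using w[OF ij(1)] w[OF ij(2)] st(3) ij by (auto simp: prod_eq_iff)
    qed
    have "(\<Sum>j\<in>{2 ^ k<..2 ^ l}. osc A n q \<theta> x j) = (\<Sum>i\<in>{k..<l}. F i)"
      unfolding F_def by (rule sum_dyadic[OF kl])
    also have "\<dots> = (\<Sum>i\<in>Bd. F i) + (\<Sum>i\<in>{k..<l} - Bd. F i)"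
      by (subst sum.subset_diff[of Bd]) (auto simp: Bd_def add.commute)
    also have "(\<Sum>i\<in>Bd. F i) = (\<Sum>ab\<in>p ` Bd. \<Sum>i\<in>{i \<in> Bd. p i = ab}. F i)"
      by (rule sum.image_gen[OF finBd])
    also have "cmod (\<dots> + (\<Sum>i\<in>{k..<l} - Bd. F i)) \<le>
        (\<Sum>ab\<in>p ` Bd. B' * 2 powr (- (\<gamma>' * real (\<kappa> (snd ab))))) + (\<Sum>i\<in>{k..<l} - Bd. 2 * 2 powr (- (\<delta> * real i)))"
    proof (intro order.trans[OF norm_triangle_ineq] add_mono)
      show "cmod (\<Sum>ab\<in>p ` Bd. \<Sum>i\<in>{i \<in> Bd. p i = ab}. F i) \<le> (\<Sum>ab\<in>p ` Bd. B' * 2 powr (- (\<gamma>' * real (\<kappa> (snd ab)))))"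
        by (rule order.trans[OF norm_sum], rule sum_mono, rule run)
      show "cmod (\<Sum>i\<in>{k..<l} - Bd. F i) \<le> (\<Sum>i\<in>{k..<l} - Bd. 2 * 2 powr (- (\<delta> * real i)))"
      proof (rule order.trans[OF norm_sum], rule sum_mono)
        fix i assume i: "i \<in> {k..<l} - Bd"
        show "cmod (F i) \<le> 2 * 2 powr (- (\<delta> * real i))"
          unfolding F_def using i k by (intro minor(2)) (auto simp: Bd_def k0_def m0_def)
      qed
    qed
    also have "(\<Sum>ab\<in>p ` Bd. B' * 2 powr (- (\<gamma>' * real (\<kappa> (snd ab))))) =
        B' * (\<Sum>m\<in>(\<lambda>ab. \<kappa> (snd ab)) ` p ` Bd. 2 powr (- (\<gamma>' * real m)))"
      by (subst sum.reindex[OF inj]) (simp add: sum_distrib_left)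
    also have "\<dots> \<le> B' * (\<epsilon> / 2 / B')"
    proof (intro mult_left_mono k4)
      show "(\<lambda>ab. \<kappa> (snd ab)) ` p ` Bd \<subseteq> {k4..}"
      proof
        fix m assume "m \<in> (\<lambda>ab. \<kappa> (snd ab)) ` p ` Bd"
        then obtain i where i: "i \<in> Bd" "m = \<kappa> (snd (p i))" by auto
        have "m0 \<le> m" using \<kappa>_ge[OF p[OF i(1)]] big i by (auto simp: Bd_def)
        then show "m \<in> {k4..}" by (simp add: m0_def)
      qed
    qed (use finBd B' in auto)
    also have "(\<Sum>i\<in>{k..<l} - Bd. 2 * 2 powr (- (\<delta> * real i))) = 2 * (\<Sum>i\<in>{k..<l} - Bd. 2 powr (- (\<delta> * real i)))"
      by (simp only: sum_distrib_left)
    also have "\<dots> \<le> 2 * (\<epsilon> / 4)"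
      using k by (intro mult_left_mono k3) (auto simp: k0_def m0_def)
    also have "B' * (\<epsilon> / 2 / B') + 2 * (\<epsilon> / 4) = \<epsilon>" using B' by simp
    finally show ?thesis by simp
  qed
  then show ?thesis by blast
qed

section \<open>Fourier coefficients on the circle\<close>

abbreviation (input) I2 :: "real set" where "I2 \<equiv> {0..2 * pi}"

lemma set_integrable_mult_bounded:
  fixes f g :: "real \<Rightarrow> complex"
  assumes f: "set_integrable lborel S f" and g: "g \<in> borel_measurable borel" and B: "\<And>x. x \<in> S \<Longrightarrow> cmod (g x) \<le> B"
    and S: "S \<in> sets borel"
  shows "set_integrable lborel S (\<lambda>x. f x * g x)"
  unfolding set_integrable_def
proof (rule Bochner_Integration.integrable_bound)
  show "integrable lborel (\<lambda>x. B * norm (indicator S x *\<^sub>R f x))"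
    using f unfolding set_integrable_def by (intro integrable_mult_right integrable_norm)
  have "(\<lambda>x. (indicator S x *\<^sub>R f x) * g x) \<in> borel_measurable lborel"
  proof (rule borel_measurable_times)
    show "(\<lambda>x. indicator S x *\<^sub>R f x) \<in> borel_measurable lborel" using f by (simp add: set_integrable_def)
  qed (use g in simp)
  then show "(\<lambda>x. indicator S x *\<^sub>R (f x * g x)) \<in> borel_measurable lborel" by simp
  show "AE x in lborel. norm (indicator S x *\<^sub>R (f x * g x)) \<le> norm (B * norm (indicator S x *\<^sub>R f x))"
  proof (rule AE_I2)
    fix x
    show "norm (indicator S x *\<^sub>R (f x * g x)) \<le> norm (B * norm (indicator S x *\<^sub>R f x))"
    proof (cases "x \<in> S")
      case True
      have "0 \<le> B" using B[OF True] norm_ge_zero order.trans by blast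
      then show ?thesis using True mult_right_mono[OF B[OF True], of "cmod (f x)"] by (simp add: norm_mult mult.commute)
    qed simp
  qed
qed

lemma cis_borel [measurable]: "(\<lambda>x. cis (c * x)) \<in> borel_measurable borel"
  by (intro borel_measurable_continuous_onI continuous_intros)

lemma set_integrable_mult_cis:
  assumes "set_integrable lborel I2 f"
  shows "set_integrable lborel I2 (\<lambda>x. f x * cis (c * x))"
  by (rule set_integrable_mult_bounded[OF assms cis_borel, where B = 1]) auto

text \<open>Without the factor \<open>1 / (2 * pi)\<close>, which the expansions carry
  instead.\<close>

definition fourier_coeff :: "(real \<Rightarrow> complex) \<Rightarrow> int \<Rightarrow> complex" where
  "fourier_coeff f j = (LINT x:I2|lborel. f x * cis (- real_of_int j * x))"

text \<open>Rotation of the circle by \<open>s\<close> between 0 and \<open>2 * pi\<close>, written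
  on \<open>I2\<close> itself so that integrals stay on \<open>I2\<close>.\<close>

definition cyclic_shift :: "real \<Rightarrow> (real \<Rightarrow> complex) \<Rightarrow> real \<Rightarrow> complex" where
  "cyclic_shift s G x = (if s \<le> x then G (x - s) else G (x - s + 2 * pi))"

lemma AE_lborel_neq: "AE x in lborel. (x::real) \<noteq> c"
  by (rule AE_lborel_singleton)

text \<open>The interval is cut at \<open>2 * pi - s\<close> and the two pieces are translated
  separately. They overlap at the cut and miss the point \<open>2 * pi\<close>, both of measure
  zero.\<close>

lemma integrable_cyclic_shift:
  assumes s: "0 \<le> s" "s \<le> 2 * pi" and G: "set_integrable lborel I2 G"
  shows "set_integrable lborel I2 (cyclic_shift s G)" "(LINT x:I2|lborel. cyclic_shift s G x) = (LINT x:I2|lborel. G x)"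
proof -
  define g1 where "g1 y = indicator {0..2 * pi - s} y *\<^sub>R G y" for y
  define g2 where "g2 y = indicator {2 * pi - s..<2 * pi} y *\<^sub>R G y" for y
  have i1: "integrable lborel g1"
    using set_integrable_subset[OF G, of "{0..2 * pi - s}"] s by (simp add: set_integrable_def g1_def[abs_def])
  have i2: "integrable lborel g2"
    using set_integrable_subset[OF G, of "{2 * pi - s..<2 * pi}"] s by (simp add: set_integrable_def g2_def[abs_def] subset_eq)
  have t1: "integrable lborel (\<lambda>x. g1 (- s + 1 * x))" "(\<integral>x. g1 (- s + 1 * x) \<partial>lborel) = (\<integral>x. g1 x \<partial>lborel)"
    using i1 lborel_integrable_real_affine[of g1 1 "- s"] lborel_integral_real_affine[of 1 g1 "- s"] by simp_all
  have t2: "integrable lborel (\<lambda>x. g2 ((2 * pi - s) + 1 * x))" "(\<integral>x. g2 ((2 * pi - s) + 1 * x) \<partial>lborel) = (\<integral>x. g2 x \<partial>lborel)"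
    using i2 lborel_integrable_real_affine[of g2 1 "2 * pi - s"] lborel_integral_real_affine[of 1 g2 "2 * pi - s"] by simp_all
  have eq: "indicator I2 x *\<^sub>R cyclic_shift s G x = g1 (- s + 1 * x) + g2 ((2 * pi - s) + 1 * x)" for x
    using s by (auto simp: g1_def g2_def cyclic_shift_def indicator_def algebra_simps)
  show "set_integrable lborel I2 (cyclic_shift s G)"
    unfolding set_integrable_def eq by (rule Bochner_Integration.integrable_add[OF t1(1) t2(1)])
  have "(LINT x:I2|lborel. cyclic_shift s G x) = (\<integral>x. g1 x \<partial>lborel) + (\<integral>x. g2 x \<partial>lborel)"
    unfolding set_lebesgue_integral_def eq Bochner_Integration.integral_add[OF t1(1) t2(1)] t1(2) t2(2) ..
  also have "\<dots> = (\<integral>x. g1 x + g2 x \<partial>lborel)"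
    by (rule Bochner_Integration.integral_add[OF i1 i2, symmetric])
  also have "\<dots> = (LINT x:I2|lborel. G x)"
    unfolding set_lebesgue_integral_def
  proof (rule integral_cong_AE)
    show "(\<lambda>x. g1 x + g2 x) \<in> borel_measurable lborel" using i1 i2 by auto
    show "(\<lambda>x. indicator I2 x *\<^sub>R G x) \<in> borel_measurable lborel"
      using G by (simp add: set_integrable_def)
    show "AE x in lborel. g1 x + g2 x = indicator I2 x *\<^sub>R G x"
      using AE_lborel_neq[of "2 * pi - s"] AE_lborel_neq[of "2 * pi"]
      by eventually_elim (use s in \<open>auto simp: g1_def g2_def indicator_def\<close>)
  qed
  finally show "(LINT x:I2|lborel. cyclic_shift s G x) = (LINT x:I2|lborel. G x)" .
qed

lemma cis_int_period: "cis (real_of_int j * (x + 2 * pi)) = cis (real_of_int j * x)"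
proof -
  have "cis (real_of_int j * (x + 2 * pi)) = cis (real_of_int j * x) * cis (2 * pi * real_of_int j)"
    by (simp add: cis_mult algebra_simps)
  then show ?thesis by simp
qed

lemma fourier_coeff_cyclic_shift:
  assumes s: "0 \<le> s" "s \<le> 2 * pi" and G: "set_integrable lborel I2 G"
  shows "fourier_coeff (cyclic_shift s G) j = cis (- real_of_int j * s) * fourier_coeff G j"
proof -
  have "cyclic_shift s G x * cis (- real_of_int j * x) = cis (- real_of_int j * s) * cyclic_shift s (\<lambda>x. G x * cis (- real_of_int j * x)) x" for x
  proof -
    have "cis (- real_of_int j * x) = cis (- real_of_int j * s) * cis (- real_of_int j * (x - s))"
      by (simp add: cis_mult algebra_simps)
    then show ?thesis
      using cis_int_period[of "- j" "x - s"] by (simp add: cyclic_shift_def)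
  qed
  then have "fourier_coeff (cyclic_shift s G) j = (LINT x:I2|lborel. cis (- real_of_int j * s) * cyclic_shift s (\<lambda>x. G x * cis (- real_of_int j * x)) x)"
    by (simp only: fourier_coeff_def)
  also have "\<dots> = cis (- real_of_int j * s) * (LINT x:I2|lborel. cyclic_shift s (\<lambda>x. G x * cis (- real_of_int j * x)) x)"
    by (rule set_integral_mult_right)
  finally show ?thesis
    using integrable_cyclic_shift(2)[OF s set_integrable_mult_cis[OF G]] by (simp only: fourier_coeff_def)
qed

section \<open>Uniqueness of Fourier coefficients\<close>

inductive trig_polynomial :: "(real \<Rightarrow> complex) \<Rightarrow> bool" where
  monomial: "trig_polynomial (\<lambda>x. a * cis (real_of_int j * x))"
| add: "trig_polynomial f \<Longrightarrow> trig_polynomial g \<Longrightarrow> trig_polynomial (\<lambda>x. f x + g x)"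

lemma trig_polynomial_mult:
  assumes "trig_polynomial f" "trig_polynomial g"
  shows "trig_polynomial (\<lambda>x. f x * g x)"
  using assms
proof (induction f arbitrary: g)
  case (monomial a j)
  from monomial show ?case
  proof (induction g)
    case (monomial b k)
    have "trig_polynomial (\<lambda>x. (a * b) * cis (real_of_int (j + k) * x))" by (rule trig_polynomial.monomial)
    moreover have "(\<lambda>x. (a * b) * cis (real_of_int (j + k) * x)) = (\<lambda>x. a * cis (real_of_int j * x) * (b * cis (real_of_int k * x)))"
      by (simp add: fun_eq_iff cis_mult[symmetric] distrib_right)
    ultimately show ?case by simp
  next
    case (add f g)
    then have "trig_polynomial (\<lambda>x. a * cis (real_of_int j * x) * f x + a * cis (real_of_int j * x) * g x)"
      by (intro trig_polynomial.add) auto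
    then show ?case by (simp add: distrib_left)
  qed
next
  case (add f1 f2)
  then have "trig_polynomial (\<lambda>x. f1 x * g x + f2 x * g x)"
    by (intro trig_polynomial.add) auto
  then show ?case by (simp add: distrib_right)
qed

text \<open>Lets Stone-Weierstrass in the plane deliver trigonometric polynomials: real polynomial
  functions are generated by real-linear functionals, and
  \<open>cos x * h 1 + sin x * h \<i>\<close> combines two exponentials.\<close>

lemma trig_polynomial_real_polynomial_function:
  assumes "real_polynomial_function (g :: complex \<Rightarrow> real)"
  shows "trig_polynomial (\<lambda>x. of_real (g (cis x)))"
  using assms
proof induction
  case (linear h)
  define a where "a = (of_real (h 1) - \<i> * of_real (h \<i>)) / 2"
  define b where "b = (of_real (h 1) + \<i> * of_real (h \<i>)) / 2"
  have "of_real (h (cis x)) = a * cis (real_of_int 1 * x) + b * cis (real_of_int (- 1) * x)" for x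
  proof -
    interpret h: bounded_linear h by fact
    have "cis x = cos x *\<^sub>R 1 + sin x *\<^sub>R \<i>" by (simp add: complex_eq_iff)
    then have "h (cis x) = cos x * h 1 + sin x * h \<i>"
      by (simp only: h.add h.scaleR) simp
    then show ?thesis by (simp add: a_def b_def complex_eq_iff add_divide_distrib[symmetric])
  qed
  then show ?case by (simp only:) (intro trig_polynomial.intros)
next
  case (const c)
  show ?case using trig_polynomial.monomial[of "of_real c" 0] by simp
next
  case (add f g)
  then show ?case using trig_polynomial.add by fastforce
next
  case (mult f g)
  then show ?case using trig_polynomial_mult by fastforce
qed

lemma trig_polynomial_borel_bounded:
  assumes "trig_polynomial \<phi>"
  shows "\<phi> \<in> borel_measurable borel \<and> (\<exists>B. \<forall>x. cmod (\<phi> x) \<le> B)"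
  using assms
proof induction
  case (monomial a j)
  then show ?case by (auto simp: norm_mult)
next
  case (add f g)
  then obtain B C where "\<And>x. cmod (f x) \<le> B" "\<And>x. cmod (g x) \<le> C" by blast
  then have "cmod (f x + g x) \<le> B + C" for x by (intro norm_triangle_mono)
  then show ?case using add by auto
qed

lemma integral_trig_polynomial_zero:
  assumes f: "set_integrable lborel I2 f" and zero: "\<And>j. fourier_coeff f j = 0" and "trig_polynomial \<phi>"
  shows "(LINT x:I2|lborel. f x * \<phi> x) = 0"
  using assms(3)
proof induction
  case (monomial a j)
  have "(LINT x:I2|lborel. f x * (a * cis (real_of_int j * x))) = (LINT x:I2|lborel. a * (f x * cis (- real_of_int (- j) * x)))"
    by (simp add: mult_ac)
  also have "\<dots> = a * fourier_coeff f (- j)" by (simp add: fourier_coeff_def)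
  finally show ?case using zero by simp
next
  case (add g h)
  have int: "set_integrable lborel I2 (\<lambda>x. f x * \<phi> x)" if \<phi>: "trig_polynomial \<phi>" for \<phi>
  proof -
    obtain B where "\<And>x. cmod (\<phi> x) \<le> B" "\<phi> \<in> borel_measurable borel"
      using trig_polynomial_borel_bounded[OF \<phi>] by blast
    then show ?thesis by (intro set_integrable_mult_bounded[OF f]) auto
  qed
  have "(LINT x:I2|lborel. f x * (g x + h x)) = (LINT x:I2|lborel. f x * g x) + (LINT x:I2|lborel. f x * h x)"
    unfolding distrib_left by (rule set_integral_add(2)[OF int int]) (use add in auto)
  then show ?case using add by simp
qed

text \<open>A continuous function on the unit circle is a uniform limit of trigonometric
  polynomials; uniform closeness is what an integrand that is merely integrable can
  tolerate.\<close>

lemma integral_circle_continuous_zero: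
  fixes h :: "complex \<Rightarrow> real"
  assumes f: "set_integrable lborel I2 f" and zero: "\<And>j. fourier_coeff f j = 0" and h: "continuous_on UNIV h"
  shows "(LINT x:I2|lborel. f x * of_real (h (cis x))) = 0"
proof -
  define F where "F = (LINT x:I2|lborel. cmod (f x))"
  have fn: "set_integrable lborel I2 (\<lambda>x. cmod (f x))" using f by (rule set_integrable_norm)
  have F0: "0 \<le> F" unfolding F_def set_lebesgue_integral_def by (intro Bochner_Integration.integral_nonneg) simp
  have "cmod (LINT x:I2|lborel. f x * of_real (h (cis x))) \<le> e" if e: "0 < e" for e
  proof -
    define e' where "e' = e / (F + 1)"
    have e': "0 < e'" using e F0 by (simp add: e'_def)
    obtain g where g: "real_polynomial_function g" "\<And>z. z \<in> sphere 0 1 \<Longrightarrow> \<bar>h z - g z\<bar> < e'"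
      using Stone_Weierstrass_real_polynomial_function[of "sphere (0::complex) 1" h e'] h e'
      by (metis compact_sphere continuous_on_subset subset_UNIV)
    have tg: "trig_polynomial (\<lambda>x. of_real (g (cis x)))"
      by (rule trig_polynomial_real_polynomial_function[OF g(1)])
    have hb: "(\<lambda>x. of_real (h (cis x)) - of_real (g (cis x)) :: complex) \<in> borel_measurable borel"
    proof (rule borel_measurable_diff)
      have "continuous_on UNIV (\<lambda>x. complex_of_real (h (cis (1 * x))))"
        by (intro continuous_intros continuous_on_compose2[OF h]) auto
      then show "(\<lambda>x. complex_of_real (h (cis x))) \<in> borel_measurable borel"
        by (simp add: borel_measurable_continuous_onI)
    qed (use trig_polynomial_borel_bounded[OF tg] in simp)
    have b: "cmod (of_real (h (cis x)) - of_real (g (cis x))) \<le> e'" for x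
      using g(2)[of "cis x"] by (simp flip: of_real_diff)
    have intd: "set_integrable lborel I2 (\<lambda>x. f x * (of_real (h (cis x)) - of_real (g (cis x))))"
      by (rule set_integrable_mult_bounded[OF f hb b]) simp
    have intg: "set_integrable lborel I2 (\<lambda>x. f x * of_real (g (cis x)))"
    proof -
      obtain B where "\<And>x. cmod (of_real (g (cis x))) \<le> B" "(\<lambda>x. complex_of_real (g (cis x))) \<in> borel_measurable borel"
        using trig_polynomial_borel_bounded[OF tg] by blast
      then show ?thesis by (intro set_integrable_mult_bounded[OF f]) auto
    qed
    have "(LINT x:I2|lborel. f x * of_real (h (cis x))) =
        (LINT x:I2|lborel. f x * (of_real (h (cis x)) - of_real (g (cis x))) + f x * of_real (g (cis x)))"
      by (simp add: algebra_simps)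
    also have "\<dots> = (LINT x:I2|lborel. f x * (of_real (h (cis x)) - of_real (g (cis x)))) + 0"
      using set_integral_add(2)[OF intd intg] integral_trig_polynomial_zero[OF f zero tg] by simp
    also have "cmod \<dots> \<le> (LINT x:I2|lborel. cmod (f x * (of_real (h (cis x)) - of_real (g (cis x)))))"
      using set_integral_norm_bound[OF intd] by simp
    also have "\<dots> \<le> (LINT x:I2|lborel. e' * cmod (f x))"
    proof (rule set_integral_mono)
      show "set_integrable lborel I2 (\<lambda>x. cmod (f x * (of_real (h (cis x)) - of_real (g (cis x)))))"
        by (rule set_integrable_norm[OF intd])
      show "set_integrable lborel I2 (\<lambda>x. e' * cmod (f x))" using fn by simp
      fix x show "cmod (f x * (of_real (h (cis x)) - of_real (g (cis x)))) \<le> e' * cmod (f x)"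
        unfolding norm_mult using b[of x] by (subst mult.commute) (intro mult_right_mono, auto)
    qed
    also have "\<dots> = e' * F" by (simp add: F_def)
    also have "\<dots> \<le> e" using F0 e by (simp add: e'_def field_simps)
    finally show ?thesis .
  qed
  then have "cmod (LINT x:I2|lborel. f x * of_real (h (cis x))) \<le> 0" by (rule field_le_epsilon[of _ 0, simplified])
  then show ?thesis by simp
qed

lemma cis_inj:
  assumes "cis x = cis y" "0 \<le> x" "x < 2 * pi" "0 \<le> y" "y < 2 * pi"
  shows "x = y"
proof -
  have "cis (x - y) = 1" using assms(1) by (simp add: cis_divide[symmetric])
  then have "cos (x - y) = 1" by (simp add: complex_eq_iff)
  then obtain n :: int where n: "x - y = of_int n * 2 * pi" using cos_one_2pi_int by blast
  then have "\<bar>of_int n * (2 * pi)\<bar> < 1 * (2 * pi)" using assms by auto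
  then have "\<bar>real_of_int n\<bar> < 1" by (simp add: abs_mult)
  then have "n = 0" by linarith
  then show ?thesis using n by simp
qed

text \<open>The continuous functions \<open>h n\<close> decrease on the circle to the indicator of a
  closed arc, and dominated convergence applies. As \<open>a < 2 * pi\<close>, no point of
  \<open>I2\<close> beyond \<open>a\<close> maps into the arc, except possibly the null set
  \<open>2 * pi\<close>.\<close>

lemma integral_initial_interval_zero:
  assumes f: "set_integrable lborel I2 f" and zero: "\<And>j. fourier_coeff f j = 0" and a: "0 \<le> a" "a < 2 * pi"
  shows "(LINT x:{0..a}|lborel. f x) = 0"
proof -
  define Arc where "Arc = cis ` {0..a}"
  define h where "h n z = max 0 (1 - real n * infdist z Arc)" for n z
  have "compact Arc" unfolding Arc_def
    by (intro compact_continuous_image continuous_intros compact_Icc)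
  then have Arc: "closed Arc" "Arc \<noteq> {}" using a by (auto simp: Arc_def compact_imp_closed)
  have hc: "continuous_on UNIV (h n)" for n
    unfolding h_def by (intro continuous_intros)
  have h01: "0 \<le> h n z" "h n z \<le> 1" for n z
    by (auto simp: h_def infdist_nonneg)
  define s where "s n x = indicator I2 x *\<^sub>R (f x * of_real (h n (cis x)))" for n x
  have "(\<lambda>n. \<integral>x. s n x \<partial>lborel) \<longlonglongrightarrow> (\<integral>x. indicator {0..a} x *\<^sub>R f x \<partial>lborel)"
  proof (rule integral_dominated_convergence)
    have "set_integrable lborel {0..a} f" using set_integrable_subset[OF f, of "{0..a}"] a by simp
    then show "(\<lambda>x. indicator {0..a} x *\<^sub>R f x) \<in> borel_measurable lborel" by (simp add: set_integrable_def)
    show "s n \<in> borel_measurable lborel" for n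
    proof -
      have "continuous_on UNIV (\<lambda>x. complex_of_real (h n (cis (1 * x))))"
        by (intro continuous_intros continuous_on_compose2[OF hc]) auto
      then have "(\<lambda>x. complex_of_real (h n (cis x))) \<in> borel_measurable borel"
        by (simp add: borel_measurable_continuous_onI)
      then have "set_integrable lborel I2 (\<lambda>x. f x * of_real (h n (cis x)))"
        using h01 by (intro set_integrable_mult_bounded[OF f, where B = 1]) auto
      then show ?thesis by (simp add: set_integrable_def s_def[abs_def])
    qed
    show "integrable lborel (\<lambda>x. norm (indicator I2 x *\<^sub>R f x))"
      by (rule integrable_norm[OF f[unfolded set_integrable_def]])
    show "AE x in lborel. norm (s n x) \<le> norm (indicator I2 x *\<^sub>R f x)" for n
      by (rule AE_I2) (use h01 in \<open>auto simp: s_def norm_mult indicator_def mult_left_le\<close>)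
    show "AE x in lborel. (\<lambda>n. s n x) \<longlonglongrightarrow> indicator {0..a} x *\<^sub>R f x"
      using AE_lborel_neq[of "2 * pi"]
    proof eventually_elim
      case (elim x)
      show ?case
      proof (cases "x \<in> {0..<2 * pi}")
        case False
        then have "x \<notin> I2" "x \<notin> {0..a}" using elim a by auto
        then show ?thesis by (simp add: s_def)
      next
        case x: True
        show ?thesis
        proof (cases "x \<in> {0..a}")
          case True
          then have "infdist (cis x) Arc = 0" by (simp add: Arc_def)
          then have "s n x = f x" for n using x by (simp add: s_def h_def)
          then show ?thesis using True by simp
        next
          case False
          have "cis x \<notin> Arc"
          proof
            assume "cis x \<in> Arc"
            then obtain y where "cis x = cis y" "y \<in> {0..a}" by (auto simp: Arc_def)
            then show False using cis_inj[of x y] x a False by auto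
          qed
          then have "infdist (cis x) Arc \<noteq> 0" using Arc in_closed_iff_infdist_zero by blast
          then have d: "0 < infdist (cis x) Arc" using infdist_nonneg[of "cis x" Arc] by linarith
          obtain m where m: "1 / infdist (cis x) Arc < real m" using reals_Archimedean2 by blast
          have "s n x = 0" if "m \<le> n" for n
          proof -
            have "1 < real m * infdist (cis x) Arc" using m d by (simp add: field_simps)
            also have "\<dots> \<le> real n * infdist (cis x) Arc" using that d by (intro mult_right_mono) auto
            finally show ?thesis by (simp add: s_def h_def)
          qed
          then have "eventually (\<lambda>n. s n x = 0) sequentially" by (auto simp: eventually_sequentially)
          then have "(\<lambda>n. s n x) \<longlonglongrightarrow> 0" by (rule tendsto_eventually)
          then show ?thesis using False by simp
        qed
      qed
    qed
  qed
  moreover have "(\<integral>x. s n x \<partial>lborel) = 0" for n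
    using integral_circle_continuous_zero[OF f zero hc] by (simp add: s_def set_lebesgue_integral_def)
  ultimately have "(\<lambda>n::nat. 0) \<longlonglongrightarrow> (\<integral>x. indicator {0..a} x *\<^sub>R f x \<partial>lborel)" by simp
  then show ?thesis using LIMSEQ_unique tendsto_const unfolding set_lebesgue_integral_def by blast
qed

text \<open>The integrals over half-lines vanish. Half-lines are stable under intersection and
  generate the Borel sets, so all Borel integrals vanish, and with them the density.\<close>

theorem fourier_uniqueness:
  assumes f: "set_integrable lborel I2 f" and zero: "\<And>j. fourier_coeff f j = 0"
  shows "AE x in lborel. x \<in> I2 \<longrightarrow> f x = 0"
proof -
  define F where "F x = indicator I2 x *\<^sub>R f x" for x
  have F: "integrable lborel F" using f by (simp add: set_integrable_def F_def[abs_def])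
  have FA: "set_integrable lborel A F" if "A \<in> sets borel" for A
    using F that unfolding set_integrable_def by (intro integrable_mult_indicator) auto
  have total: "(LINT x|lborel. F x) = 0"
    using zero[of 0] by (simp add: fourier_coeff_def F_def set_lebesgue_integral_def)
  have "(LINT x:A|lborel. F x) = 0" if A: "A \<in> sets borel" for A
  proof -
    have borel: "sets borel = sigma_sets UNIV (range (\<lambda>a::real. {..a}))"
      by (subst borel_eq_atMost) simp
    have "Int_stable (range (\<lambda>a::real. {..a}))" by (auto simp: Int_stable_def)
    moreover have "range (\<lambda>a::real. {..a}) \<subseteq> Pow UNIV" by simp
    moreover have "A \<in> sigma_sets UNIV (range (\<lambda>a::real. {..a}))" using A borel by simp
    ultimately show ?thesis
    proof (induction rule: sigma_sets_induct_disjoint)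
      case (basic A)
      then obtain a where A: "A = {..a}" by auto
      have eq: "(LINT x:A|lborel. F x) = (LINT x|lborel. indicator (A \<inter> I2) x *\<^sub>R f x)"
        by (simp add: set_lebesgue_integral_def F_def indicator_inter_arith)
      consider "a < 0" | "0 \<le> a" "a < 2 * pi" | "2 * pi \<le> a" by linarith
      then show ?case
      proof cases
        case 1
        then have "A \<inter> I2 = {}" by (auto simp: A)
        then show ?thesis unfolding eq by simp
      next
        case 2
        then have "A \<inter> I2 = {0..a}" by (auto simp: A)
        then show ?thesis unfolding eq using integral_initial_interval_zero[OF f zero 2]
          by (simp add: set_lebesgue_integral_def)
      next
        case 3
        then have "A \<inter> I2 = I2" by (auto simp: A)
        then show ?thesis unfolding eq using total by (simp add: F_def)
      qed
    next
      case empty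
      show ?case by (simp add: set_lebesgue_integral_def)
    next
      case (compl A)
      then have A: "A \<in> sets borel" by (simp add: borel)
      have "(LINT x|lborel. F x) = (LINT x|lborel. indicator A x *\<^sub>R F x + indicator (UNIV - A) x *\<^sub>R F x)"
        by (intro Bochner_Integration.integral_cong) (auto simp: indicator_def)
      also have "\<dots> = (LINT x:A|lborel. F x) + (LINT x:UNIV - A|lborel. F x)"
        using FA[OF A] FA[of "UNIV - A"] A unfolding set_integrable_def set_lebesgue_integral_def
        by (intro Bochner_Integration.integral_add) auto
      finally show ?case using total compl by simp
    next
      case (union A)
      then have meas: "A i \<in> sets lborel" for i by (auto simp: borel)
      have "(LINT x:(\<Union>i. A i)|lborel. F x) = (\<Sum>i. (LINT x:A i|lborel. F x))"
        using union(1) meas by (intro lebesgue_integral_countable_add FA) (auto simp: disjoint_family_on_def)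
      then show ?case using union by simp
    qed
  qed
  then have "AE x in lborel. F x = 0"
    by (intro sigma_finite_measure.density_zero[OF lborel.sigma_finite_measure_axioms F]) simp
  then show ?thesis by eventually_elim (auto simp: F_def)
qed

section \<open>Partial sums and the solution in L^2\<close>

lemma set_integrable_const_I2: "set_integrable lborel I2 (\<lambda>x. c :: 'a :: {banach, second_countable_topology})"
  by (intro borel_integrable_atLeastAtMost') (auto intro: continuous_intros)

lemma set_integrable_I2_bounded:
  fixes g :: "real \<Rightarrow> complex"
  assumes "g \<in> borel_measurable borel" "\<And>x. cmod (g x) \<le> B"
  shows "set_integrable lborel I2 g"
proof -
  from set_integrable_mult_bounded[OF set_integrable_const_I2[of 1] assms] show ?thesis by simp
qed

lemma fourier_coeff_sum:
  assumes "finite S" "\<And>k. k \<in> S \<Longrightarrow> set_integrable lborel I2 (f k)"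
  shows "fourier_coeff (\<lambda>x. \<Sum>k\<in>S. a k * f k x) j = (\<Sum>k\<in>S. a k * fourier_coeff (f k) j)"
proof -
  have int: "integrable lborel (\<lambda>x. indicator I2 x *\<^sub>R (f k x * cis (- real_of_int j * x)))" if "k \<in> S" for k
    using set_integrable_mult_cis[OF assms(2)[OF that]] by (simp only: set_integrable_def)
  have "fourier_coeff (\<lambda>x. \<Sum>k\<in>S. a k * f k x) j = (\<integral>x. (\<Sum>k\<in>S. a k * (indicator I2 x *\<^sub>R (f k x * cis (- real_of_int j * x)))) \<partial>lborel)"
    unfolding fourier_coeff_def set_lebesgue_integral_def
    by (intro Bochner_Integration.integral_cong refl) (simp add: sum_distrib_right scaleR_sum_right mult.assoc)
  also have "\<dots> = (\<Sum>k\<in>S. \<integral>x. a k * (indicator I2 x *\<^sub>R (f k x * cis (- real_of_int j * x))) \<partial>lborel)"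
    using int by (intro Bochner_Integration.integral_sum integrable_mult_right) auto
  also have "\<dots> = (\<Sum>k\<in>S. a k * fourier_coeff (f k) j)"
    by (simp only: fourier_coeff_def set_lebesgue_integral_def integral_mult_right_zero)
  finally show ?thesis .
qed

lemma fourier_coeff_diff:
  assumes "set_integrable lborel I2 f" "set_integrable lborel I2 g"
  shows "fourier_coeff (\<lambda>x. f x - g x) j = fourier_coeff f j - fourier_coeff g j"
  unfolding fourier_coeff_def left_diff_distrib
  by (rule set_integral_diff(2)[OF set_integrable_mult_cis[OF assms(1)] set_integrable_mult_cis[OF assms(2)]])

lemma norm_fourier_coeff_le:
  assumes "set_integrable lborel I2 f"
  shows "cmod (fourier_coeff f j) \<le> (LINT x:I2|lborel. cmod (f x))"
  using set_integral_norm_bound[OF set_integrable_mult_cis[OF assms, of "- real_of_int j"]]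
  by (simp add: fourier_coeff_def norm_mult)

text \<open>A cyclic shift multiplies \<open>cis (l * x)\<close> by a constant other than 1 and preserves its integral.\<close>

lemma fourier_coeff_cis: "fourier_coeff (\<lambda>x. cis (real_of_int k * x)) j = (if j = k then 2 * of_real pi else 0)"
proof -
  define l where "l = k - j"
  define G where "G x = cis (real_of_int l * x)" for x
  have G: "set_integrable lborel I2 G"
    unfolding G_def by (rule set_integrable_I2_bounded[where B = 1]) auto
  have eq: "fourier_coeff (\<lambda>x. cis (real_of_int k * x)) j = (LINT x:I2|lborel. G x)"
    by (simp add: fourier_coeff_def G_def l_def cis_mult algebra_simps)
  show ?thesis
  proof (cases "l = 0")
    case True
    then have "(LINT x:I2|lborel. G x) = (LINT x:I2|lborel. (1::complex))" by (simp add: G_def)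
    also have "\<dots> = 2 * of_real pi"
      by (simp add: set_lebesgue_integral_def scaleR_conv_of_real)
    finally show ?thesis using True eq by (simp add: l_def)
  next
    case False
    define s where "s = pi / \<bar>real_of_int l\<bar>"
    have l1: "1 \<le> \<bar>real_of_int l\<bar>" using False by linarith
    have "s \<le> pi / 1" unfolding s_def using l1 by (intro divide_left_mono) auto
    then have s: "0 \<le> s" "s \<le> 2 * pi" using pi_gt_zero by (simp add: s_def, linarith)
    have ls: "cis (- real_of_int l * s) = -1"
      using False by (auto simp: s_def abs_if complex_eq_iff)
    have "cyclic_shift s G x = - G x" for x
    proof -
      have "cyclic_shift s G x = cis (real_of_int l * (x - s))"
        using cis_int_period[of l "x - s"] by (simp add: cyclic_shift_def G_def)
      also have "\<dots> = G x * cis (- real_of_int l * s)"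
        by (simp add: G_def cis_mult algebra_simps)
      finally show ?thesis by (simp only: ls mult_minus1_right)
    qed
    then have "(LINT x:I2|lborel. G x) = (LINT x:I2|lborel. - G x)"
      using integrable_cyclic_shift(2)[OF s G] by simp
    also have "\<dots> = - (LINT x:I2|lborel. G x)"
      by (simp add: set_lebesgue_integral_def)
    finally have "(LINT x:I2|lborel. G x) = 0" by simp
    then show ?thesis using False eq by (simp add: l_def)
  qed
qed

lemma L2_set_integrable:
  assumes "L2_0_2pi f"
  shows "set_integrable lborel I2 f"
  unfolding set_integrable_def
proof (rule Bochner_Integration.integrable_bound)
  have "set_integrable lborel I2 (\<lambda>x. 1 + (cmod (f x))\<^sup>2)"
    using assms by (intro set_integral_add(1) set_integrable_const_I2) (simp add: L2_0_2pi_def)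
  then show "integrable lborel (\<lambda>x. indicator I2 x *\<^sub>R (1 + (cmod (f x))\<^sup>2))" by (simp add: set_integrable_def)
  show "(\<lambda>x. indicator I2 x *\<^sub>R f x) \<in> borel_measurable lborel"
    using assms by (simp add: L2_0_2pi_def set_borel_measurable_def)
  have le: "t \<le> 1 + t\<^sup>2" for t :: real
    using zero_le_power2[of "t - 1/2"] by (simp add: power2_eq_square algebra_simps)
  show "AE x in lborel. norm (indicator I2 x *\<^sub>R f x) \<le> norm (indicator I2 x *\<^sub>R (1 + (cmod (f x))\<^sup>2))"
    by (rule AE_I2) (auto simp: indicator_def intro: order.trans[OF le])
qed

lemma L2_diff:
  assumes f: "L2_0_2pi f" and g: "g \<in> borel_measurable borel" "\<And>x. cmod (g x) \<le> B"
  shows "set_integrable lborel I2 (\<lambda>x. (cmod (g x - f x))\<^sup>2)"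
  unfolding set_integrable_def
proof (rule Bochner_Integration.integrable_bound)
  have "set_integrable lborel I2 (\<lambda>x. 2 * B\<^sup>2 + 2 * (cmod (f x))\<^sup>2)"
    using f by (intro set_integral_add(1) set_integrable_const_I2) (simp add: L2_0_2pi_def)
  then show "integrable lborel (\<lambda>x. indicator I2 x *\<^sub>R (2 * B\<^sup>2 + 2 * (cmod (f x))\<^sup>2))" by (simp add: set_integrable_def)
  have "(\<lambda>x. indicator I2 x *\<^sub>R f x) \<in> borel_measurable lborel"
    using f by (simp add: L2_0_2pi_def set_borel_measurable_def)
  then have "(\<lambda>x. indicator I2 x * (cmod (g x - indicator I2 x *\<^sub>R f x))\<^sup>2) \<in> borel_measurable lborel"
    using g by measurable
  moreover have "(\<lambda>x. indicator I2 x * (cmod (g x - indicator I2 x *\<^sub>R f x))\<^sup>2) = (\<lambda>x. indicator I2 x *\<^sub>R (cmod (g x - f x))\<^sup>2)"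
    by (auto simp: indicator_def fun_eq_iff)
  ultimately show "(\<lambda>x. indicator I2 x *\<^sub>R (cmod (g x - f x))\<^sup>2) \<in> borel_measurable lborel" by simp
  have le: "(cmod (g x - f x))\<^sup>2 \<le> 2 * B\<^sup>2 + 2 * (cmod (f x))\<^sup>2" for x
  proof -
    have "(cmod (g x - f x))\<^sup>2 \<le> (cmod (g x) + cmod (f x))\<^sup>2"
      by (intro power_mono norm_triangle_ineq4) auto
    also have "\<dots> \<le> 2 * (cmod (g x))\<^sup>2 + 2 * (cmod (f x))\<^sup>2"
      using zero_le_power2[of "cmod (g x) - cmod (f x)"] by (simp add: power2_eq_square algebra_simps)
    also have "(cmod (g x))\<^sup>2 \<le> B\<^sup>2" using g(2) by (intro power_mono) auto
    finally show ?thesis by simp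
  qed
  show "AE x in lborel. norm (indicator I2 x *\<^sub>R (cmod (g x - f x))\<^sup>2) \<le> norm (indicator I2 x *\<^sub>R (2 * B\<^sup>2 + 2 * (cmod (f x))\<^sup>2))"
    by (rule AE_I2) (use le in \<open>auto simp: indicator_def intro: order.trans[OF le]\<close>)
qed

text \<open>Integrates \<open>t \<le> e / 2 + t\<^sup>2 / (2 * e)\<close> in place of
  Cauchy-Schwarz; \<open>e\<close> remains free to be matched to the target accuracy.\<close>

lemma L1_le_L2:
  assumes f: "set_integrable lborel I2 f" and f2: "set_integrable lborel I2 (\<lambda>x. (cmod (f x))\<^sup>2)" and e: "0 < e"
  shows "(LINT x:I2|lborel. cmod (f x)) \<le> e * pi + (LINT x:I2|lborel. (cmod (f x))\<^sup>2) / (2 * e)"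
proof -
  have c: "set_integrable lborel I2 (\<lambda>x. e / 2)" by (rule set_integrable_const_I2)
  have d: "set_integrable lborel I2 (\<lambda>x. (cmod (f x))\<^sup>2 / (2 * e))" using f2 by simp
  have le: "t \<le> e / 2 + t\<^sup>2 / (2 * e)" for t :: real
  proof -
    have "0 \<le> (t - e)\<^sup>2 / (2 * e)" using e by simp
    also have "\<dots> = e / 2 + t\<^sup>2 / (2 * e) - t" using e by (simp add: field_simps power2_eq_square)
    finally show ?thesis by simp
  qed
  have "(LINT x:I2|lborel. cmod (f x)) \<le> (LINT x:I2|lborel. e / 2 + (cmod (f x))\<^sup>2 / (2 * e))"
    by (rule set_integral_mono[OF set_integrable_norm[OF f] set_integral_add(1)[OF c d] le])
  also have "\<dots> = (LINT x:I2|lborel. e / 2) + (LINT x:I2|lborel. (cmod (f x))\<^sup>2 / (2 * e))"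
    by (rule set_integral_add(2)[OF c d])
  also have "(LINT x:I2|lborel. e / 2) = e * pi"
    by (simp add: set_lebesgue_integral_def)
  finally show ?thesis by simp
qed

definition fourier_partial :: "(int \<Rightarrow> complex) \<Rightarrow> nat \<Rightarrow> real \<Rightarrow> complex" where
  "fourier_partial c N x = (\<Sum>j\<in>{- int N..int N}. c j * cis (real_of_int j * x))"

lemma fourier_coeff_fourier_partial:
  assumes "\<bar>j\<bar> \<le> int N"
  shows "fourier_coeff (fourier_partial c N) j = 2 * of_real pi * c j"
proof -
  have "fourier_coeff (fourier_partial c N) j = (\<Sum>k\<in>{- int N..int N}. c k * fourier_coeff (\<lambda>x. cis (real_of_int k * x)) j)"
    unfolding fourier_partial_def[abs_def]
    by (intro fourier_coeff_sum) (auto intro!: set_integrable_I2_bounded[where B = 1])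
  also have "\<dots> = (\<Sum>k\<in>{- int N..int N}. if k = j then 2 * of_real pi * c j else 0)"
    unfolding fourier_coeff_cis by (intro sum.cong) auto
  also have "\<dots> = 2 * of_real pi * c j" using assms by (auto simp: abs_le_iff)
  finally show ?thesis .
qed

lemma fourier_partial_measurable [measurable]: "fourier_partial c N \<in> borel_measurable borel"
  unfolding fourier_partial_def[abs_def] by measurable

lemma norm_fourier_partial_le: "cmod (fourier_partial c N x) \<le> (\<Sum>j\<in>{- int N..int N}. cmod (c j))"
  unfolding fourier_partial_def by (rule order.trans[OF norm_sum]) (simp add: norm_mult)

text \<open>The factor \<open>cis (\<theta> * x)\<close> reduces the quasi-periodic expansion to an
  ordinary Fourier series of the untwisted datum; the two factors \<open>1 / sqrt (2 * pi)\<close>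
  of \<open>phi\<close> merge.\<close>

lemma QP_partial_fourier:
  fixes \<theta> :: real
  defines "z \<equiv> \<lambda>u x. cis (- \<theta> * x) * u x"
  shows "QP_partial \<alpha> n \<theta> u0 t N x = cis (\<theta> * x) * fourier_partial
    (\<lambda>j. fourier_coeff (z u0) j * exp (- \<i> * complex_of_real (Psym \<alpha> n (real_of_int j + \<theta>) * t)) / (2 * of_real pi)) N x"
proof -
  have phi: "phi \<theta> j x = cis (\<theta> * x) * cis (real_of_int j * x) / of_real (sqrt (2 * pi))" for j x
  proof -
    have "phi \<theta> j x = cis ((real_of_int j + \<theta>) * x) / of_real (sqrt (2 * pi))"
      by (simp add: phi_def cis_conv_exp)
    also have "cis ((real_of_int j + \<theta>) * x) = cis (\<theta> * x) * cis (real_of_int j * x)"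
      by (simp add: cis_mult algebra_simps)
    finally show ?thesis .
  qed
  have inner: "inner_L2 u0 (phi \<theta> j) = fourier_coeff (z u0) j / of_real (sqrt (2 * pi))" for j
  proof -
    have "inner_L2 u0 (phi \<theta> j) = (LINT x:I2|lborel. z u0 x * cis (- real_of_int j * x) / of_real (sqrt (2 * pi)))"
      unfolding inner_L2_def phi z_def by (simp add: cis_cnj mult_ac)
    then show ?thesis by (simp add: fourier_coeff_def)
  qed
  have sq: "of_real (sqrt (2 * pi)) * of_real (sqrt (2 * pi)) = (2 * of_real pi :: complex)"
  proof -
    have "sqrt (2 * pi) * sqrt (2 * pi) = 2 * pi" by simp
    then show ?thesis by (simp only: of_real_mult[symmetric]) simp
  qed
  show ?thesis
    unfolding QP_partial_def inner phi fourier_partial_def sum_distrib_left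
  proof (intro sum.cong refl)
    fix j :: int
    let ?s = "complex_of_real (sqrt (2 * pi))" and ?E = "exp (- \<i> * complex_of_real (Psym \<alpha> n (real_of_int j + \<theta>) * t))"
    show "fourier_coeff (z u0) j / ?s * ?E * (cis (\<theta> * x) * cis (real_of_int j * x) / ?s) =
      cis (\<theta> * x) * (fourier_coeff (z u0) j * ?E / (2 * of_real pi) * cis (real_of_int j * x))"
      unfolding sq[symmetric] by (simp add: field_simps)
  qed
qed

lemma QP_solution_L1:
  fixes \<theta> :: real
  assumes sol: "QP_solution_at \<alpha> n \<theta> u0 t v"
  shows "(\<lambda>N. LINT x:I2|lborel. cmod (QP_partial \<alpha> n \<theta> u0 t N x - v x)) \<longlonglongrightarrow> 0"
proof -
  have v: "L2_0_2pi v" and lim: "(\<lambda>N. LINT x:I2|lborel. (cmod (QP_partial \<alpha> n \<theta> u0 t N x - v x))\<^sup>2) \<longlonglongrightarrow> 0"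
    using sol by (auto simp: QP_solution_at_def)
  define S where "S N x = QP_partial \<alpha> n \<theta> u0 t N x" for N x
  have Sm: "S N \<in> borel_measurable borel" for N
    unfolding S_def[abs_def] QP_partial_fourier by measurable
  have "\<exists>B. \<forall>x. cmod (S N x) \<le> B" for N
    unfolding S_def QP_partial_fourier norm_mult using norm_fourier_partial_le by (simp only: norm_cis mult_1) blast
  then obtain B where B: "\<And>N x. cmod (S N x) \<le> B N" by metis
  have i1: "set_integrable lborel I2 (\<lambda>x. S N x - v x)" for N
    using set_integrable_I2_bounded[OF Sm B] L2_set_integrable[OF v] by (rule set_integral_diff(1))
  have i2: "set_integrable lborel I2 (\<lambda>x. (cmod (S N x - v x))\<^sup>2)" for N
    by (rule L2_diff[OF v Sm B])
  show ?thesis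
  proof (rule LIMSEQ_I)
    fix r :: real assume r: "0 < r"
    \<comment> \<open>With this choice both terms of \<open>L1_le_L2\<close> are at most
      \<open>r / 2\<close>.\<close>
    define e where "e = r / (2 * pi)"
    have e: "0 < e" using r by (simp add: e_def)
    obtain N0 where N0: "\<And>N. N0 \<le> N \<Longrightarrow> \<bar>LINT x:I2|lborel. (cmod (S N x - v x))\<^sup>2\<bar> < e * r"
      using LIMSEQ_D[OF lim, of "e * r"] e r by (auto simp: S_def)
    have "norm ((LINT x:I2|lborel. cmod (S N x - v x)) - 0) < r" if "N0 \<le> N" for N
    proof -
      have "(LINT x:I2|lborel. cmod (S N x - v x)) \<le> e * pi + (LINT x:I2|lborel. (cmod (S N x - v x))\<^sup>2) / (2 * e)"
        by (rule L1_le_L2[OF i1 i2 e])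
      also have "\<dots> < e * pi + (e * r) / (2 * e)"
        using N0[OF that] e by (intro add_strict_left_mono divide_strict_right_mono) auto
      also have "\<dots> = r" using e by (simp add: e_def)
      finally have "(LINT x:I2|lborel. cmod (S N x - v x)) < r" .
      moreover have "0 \<le> (LINT x:I2|lborel. cmod (S N x - v x))"
        unfolding set_lebesgue_integral_def by (intro Bochner_Integration.integral_nonneg) simp
      ultimately show ?thesis by simp
    qed
    then show "\<exists>no. \<forall>N\<ge>no. norm ((LINT x:I2|lborel. cmod (QP_partial \<alpha> n \<theta> u0 t N x - v x)) - 0) < r"
      unfolding S_def by blast
  qed
qed

section \<open>Rational and irrational quasi-periodicity\<close>

lemma exp_phase:
  assumes "0 < q"
  shows "exp (- \<i> * complex_of_real (Psym \<alpha> n (real_of_int j + \<theta>) * (2 * pi * real_of_int p / real_of_int q))) =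
    ee (qphase (\<lambda>m. - p * \<alpha> m) n (nat q) \<theta> (real_of_int j))"
proof -
  have "qphase (\<lambda>m. - p * \<alpha> m) n (nat q) \<theta> (real_of_int j) = - (real_of_int p / real_of_int q) * Psym \<alpha> n (real_of_int j + \<theta>)"
    using assms by (simp add: qphase_def Psym_def sum_distrib_left sum_negf[symmetric] mult.assoc)
  then have "2 * pi * qphase (\<lambda>m. - p * \<alpha> m) n (nat q) \<theta> (real_of_int j) =
      - (Psym \<alpha> n (real_of_int j + \<theta>) * (2 * pi * real_of_int p / real_of_int q))"
    by simp
  then show ?thesis by (simp only: ee_def cis_conv_exp) simp
qed

text \<open>The \<open>j\<close>-th coefficient of the partial sum of order \<open>N\<close> no
  longer changes once \<open>N\<close> is at least \<open>\<bar>j\<bar>\<close>, and coefficients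
  are continuous in L^1.\<close>

lemma fourier_coeff_QP_solution:
  assumes sol: "QP_solution_at \<alpha> n \<theta> u0 t v"
  shows "fourier_coeff (\<lambda>x. cis (- \<theta> * x) * v x) j =
    exp (- \<i> * complex_of_real (Psym \<alpha> n (real_of_int j + \<theta>) * t)) * fourier_coeff (\<lambda>x. cis (- \<theta> * x) * u0 x) j"
    (is "?l = ?r")
proof -
  define c where "c j = fourier_coeff (\<lambda>x. cis (- \<theta> * x) * u0 x) j *
    exp (- \<i> * complex_of_real (Psym \<alpha> n (real_of_int j + \<theta>) * t)) / (2 * of_real pi)" for j
  have S: "QP_partial \<alpha> n \<theta> u0 t N x = cis (\<theta> * x) * fourier_partial c N x" for N x
    unfolding c_def by (rule QP_partial_fourier)
  have v: "set_integrable lborel I2 v"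
    using sol by (intro L2_set_integrable) (simp add: QP_solution_at_def)
  have zv: "set_integrable lborel I2 (\<lambda>x. cis (- \<theta> * x) * v x)"
    using set_integrable_mult_cis[OF v, of "- \<theta>"] by (simp add: mult.commute)
  have Fi: "set_integrable lborel I2 (fourier_partial c N)" for N
    by (rule set_integrable_I2_bounded[OF fourier_partial_measurable norm_fourier_partial_le])
  have "cmod (?r - ?l) \<le> (LINT x:I2|lborel. cmod (QP_partial \<alpha> n \<theta> u0 t N x - v x))" if N: "nat \<bar>j\<bar> \<le> N" for N
  proof -
    have "fourier_coeff (fourier_partial c N) j = ?r"
      using fourier_coeff_fourier_partial[of j N c] N by (simp add: c_def)
    then have "?r - ?l = fourier_coeff (\<lambda>x. fourier_partial c N x - cis (- \<theta> * x) * v x) j"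
      using fourier_coeff_diff[OF Fi zv] by simp
    then have "cmod (?r - ?l) \<le> (LINT x:I2|lborel. cmod (fourier_partial c N x - cis (- \<theta> * x) * v x))"
      using norm_fourier_coeff_le[OF set_integral_diff(1)[OF Fi zv]] by simp
    also have "\<dots> = (LINT x:I2|lborel. cmod (QP_partial \<alpha> n \<theta> u0 t N x - v x))"
    proof (intro set_lebesgue_integral_cong allI impI)
      fix x
      have "QP_partial \<alpha> n \<theta> u0 t N x - v x = cis (\<theta> * x) * (fourier_partial c N x - cis (- \<theta> * x) * v x)"
        by (simp add: S right_diff_distrib mult.assoc[symmetric] cis_mult)
      then show "cmod (fourier_partial c N x - cis (- \<theta> * x) * v x) = cmod (QP_partial \<alpha> n \<theta> u0 t N x - v x)"
        by (simp add: norm_mult)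
    qed simp
    finally show ?thesis .
  qed
  then have "cmod (?r - ?l) \<le> 0"
    by (intro LIMSEQ_le_const[OF QP_solution_L1[OF sol]]) blast
  then show ?thesis by simp
qed

section \<open>Revival for rational \<open>\<theta>\<close>\<close>

lemma per_ext_cyclic_shift:
  assumes "0 \<le> s" "s \<le> 2 * pi" "0 \<le> x" "x < 2 * pi"
  shows "per_ext f (x - s) = cyclic_shift s f x"
proof (cases "s \<le> x")
  case True
  then have "\<lfloor>(x - s) / (2 * pi)\<rfloor> = 0" using assms by (simp add: floor_eq_iff)
  then show ?thesis using True by (simp add: per_ext_def cyclic_shift_def)
next
  case False
  then have "\<lfloor>(x - s) / (2 * pi)\<rfloor> = -1" using assms by (simp add: floor_eq_iff field_simps)
  then show ?thesis using False by (simp add: per_ext_def cyclic_shift_def)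
qed

lemma rational_revival:
  fixes p q :: int and \<theta> :: real
  assumes "\<theta> \<in> \<rat>" and q: "0 < q" and u0: "L2_0_2pi u0"
    and sol: "QP_solution_at \<alpha> n \<theta> u0 (2 * pi * real_of_int p / real_of_int q) v"
  shows "\<exists>(N::nat) (c::nat \<Rightarrow> complex) (\<sigma>::nat \<Rightarrow> real). AE x in lborel. x \<in> I2 \<longrightarrow>
      v x = cis (\<theta> * x) * (\<Sum>j=1..N. c j * per_ext (\<lambda>y. cis (- \<theta> * y) * u0 y) (x - \<sigma> j))"
proof -
  define z where "z = (\<lambda>u x. cis (- \<theta> * x) * u x :: complex)"
  have zi: "set_integrable lborel I2 (z u)" if "L2_0_2pi u" for u
    using set_integrable_mult_cis[OF L2_set_integrable[OF that], of "- \<theta>"] by (simp add: z_def mult.commute)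
  have v: "L2_0_2pi v" using sol by (simp add: QP_solution_at_def)
  obtain a :: int and b :: nat where ab: "0 < b" "\<theta> = a / b"
  proof -
    obtain a' b' :: int where "b' > 0" "\<theta> = of_int a' / of_int b'" using assms(1) by (rule Rats_cases')
    then show ?thesis using that[of "nat b'" a'] by simp
  qed
  define M where "M = nat q * b ^ n"
  have M: "0 < M" using q ab by (simp add: M_def)
  define \<mu> where "\<mu> j = ee (qphase (\<lambda>m. - p * \<alpha> m) n (nat q) \<theta> (of_int j))" for j :: int
  have per: "\<mu> (j + int M) = \<mu> j" for j
    unfolding \<mu>_def M_def ab(2) using q ab(1) by (intro qphase_periodic) auto
  \<comment> \<open>The rotation by \<open>- 2 * pi * k / M\<close>, moved by one period into
    \<open>I2\<close>. For \<open>k = 0\<close> it is the full turn, which is harmless away from the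
    end point \<open>2 * pi\<close>.\<close>
  define s where "s k = 2 * pi * real (M - k) / M" for k
  have s: "0 \<le> s k" "s k \<le> 2 * pi" for k
    using M by (auto simp: s_def field_simps)
  have cis_s: "cis (- real_of_int j * s k) = ee (of_int j * real k / real M)" if "k < M" for j k
  proof -
    have "- real_of_int j * s k = 2 * pi * (of_int j * real k / real M) - 2 * pi * of_int j"
      using that M by (simp add: s_def of_nat_diff field_simps)
    then have "cis (- real_of_int j * s k) = ee (of_int j * real k / real M) * cis (- (2 * pi * of_int j))"
      by (simp add: ee_def cis_mult)
    then show ?thesis by (simp add: cis_cnj[symmetric])
  qed
  define w where "w x = (\<Sum>k<M. dft \<mu> M k * cyclic_shift (s k) (z u0) x)" for x
  have cyci: "set_integrable lborel I2 (cyclic_shift (s k) (z u0))" for k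
    by (rule integrable_cyclic_shift(1)[OF s zi[OF u0]])
  have wi: "set_integrable lborel I2 w"
    using set_integrable_mult_right[of _ lborel I2 "cyclic_shift (s k) (z u0)" for k, OF cyci]
    unfolding w_def[abs_def] set_integrable_def scaleR_sum_right
    by (intro Bochner_Integration.integrable_sum) auto
  have fcw: "fourier_coeff w j = \<mu> j * fourier_coeff (z u0) j" for j
  proof -
    have "fourier_coeff w j = (\<Sum>k<M. dft \<mu> M k * fourier_coeff (cyclic_shift (s k) (z u0)) j)"
      unfolding w_def[abs_def] by (rule fourier_coeff_sum[OF _ cyci]) simp
    also have "\<dots> = (\<Sum>k<M. dft \<mu> M k * ee (of_int j * real k / real M)) * fourier_coeff (z u0) j"
      unfolding sum_distrib_right
      by (intro sum.cong refl) (simp add: fourier_coeff_cyclic_shift[OF s zi[OF u0]] cis_s[simplified] del: of_int_minus)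
    also have "(\<Sum>k<M. dft \<mu> M k * ee (of_int j * real k / real M)) = \<mu> j"
      by (rule dft_inversion[where \<psi> = \<mu> and M = M, OF M per, symmetric])
    finally show ?thesis .
  qed
  have fcv: "fourier_coeff (z v) j = \<mu> j * fourier_coeff (z u0) j" for j
    unfolding z_def \<mu>_def exp_phase[OF q, symmetric] by (rule fourier_coeff_QP_solution[OF sol])
  have "AE x in lborel. x \<in> I2 \<longrightarrow> z v x - w x = 0"
    using zi[OF v] wi by (intro fourier_uniqueness set_integral_diff(1)) (simp_all add: fourier_coeff_diff fcv fcw)
  then have "AE x in lborel. x \<in> I2 \<longrightarrow> v x = cis (\<theta> * x) * (\<Sum>j=1..M. dft \<mu> M (j - 1) * per_ext (z u0) (x - s (j - 1)))"
    using AE_lborel_neq[of "2 * pi"]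
  proof eventually_elim
    case (elim x)
    show ?case
    proof
      assume x: "x \<in> I2"
      have "v x = cis (\<theta> * x) * z v x" by (simp add: z_def mult.assoc[symmetric] cis_mult)
      also have "z v x = w x" using elim x by simp
      also have "w x = (\<Sum>k<M. dft \<mu> M k * per_ext (z u0) (x - s k))"
        unfolding w_def using s x elim by (intro sum.cong refl arg_cong2[of _ _ _ _ "(*)"] per_ext_cyclic_shift[symmetric]) auto
      also have "\<dots> = (\<Sum>j=1..M. dft \<mu> M (j - 1) * per_ext (z u0) (x - s (j - 1)))"
        by (simp add: sum.atLeast1_atMost_eq)
      finally show "v x = cis (\<theta> * x) * (\<Sum>j=1..M. dft \<mu> M (j - 1) * per_ext (z u0) (x - s (j - 1)))" .
    qed
  qed
  then show ?thesis unfolding z_def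
    by (intro exI[of _ M] exI[of _ "\<lambda>j. dft \<mu> M (j - 1)"] exI[of _ "\<lambda>j. s (j - 1)"])
qed

text \<open>For \<open>x\<close> in \<open>[0, h]\<close> the points \<open>x\<close>,
  \<open>x + h\<close>, ..., \<open>x + (N - 1) h\<close> are increasing in \<open>I2\<close>, so
  the increments of \<open>u\<close> along them add up to at most \<open>V\<close>; integration over
  \<open>x\<close> gives \<open>V * h\<close>. The other terms of \<open>C\<close> pay for the twist
  \<open>cis (- \<theta> * x)\<close> and for the first cell, where the rotation wraps around and
  only boundedness helps. Steps \<open>2 * pi / N\<close> make the cells tile the period.\<close>

lemma bounded_variation_translation:
  fixes \<theta> :: real
  assumes bv: "bounded_variation_on u 0 (2 * pi)" and u: "set_integrable lborel I2 u"
  defines "z \<equiv> \<lambda>x. cis (- \<theta> * x) * u x"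
  shows "\<exists>C\<ge>0. \<forall>N\<ge>1. (LINT x:I2|lborel. cmod (z x - cyclic_shift (2 * pi / real N) z x)) \<le> C * (2 * pi / real N)"
proof -
  obtain V where V: "\<And>(m::nat) (xs::nat \<Rightarrow> real). (\<And>k. k \<le> m \<Longrightarrow> 0 \<le> xs k \<and> xs k \<le> 2 * pi) \<Longrightarrow>
      (\<And>k. k < m \<Longrightarrow> xs k \<le> xs (Suc k)) \<Longrightarrow> (\<Sum>k<m. cmod (u (xs (Suc k)) - u (xs k))) \<le> V"
    using bv unfolding bounded_variation_on_def by blast
  have V0: "0 \<le> V" using V[of 0 "\<lambda>_. 0"] by simp
  define U where "U = cmod (u 0) + V"
  have U0: "0 \<le> U" using V0 by (simp add: U_def)
  have U: "cmod (u x) \<le> U" if "x \<in> I2" for x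
  proof -
    have "cmod (u x - u 0) \<le> V"
      using V[of 1 "\<lambda>k. if k = 0 then 0 else x"] that by simp
    then show ?thesis using norm_triangle_ineq2[of "u x" "u 0"] by (simp add: U_def)
  qed
  define C where "C = V + \<bar>\<theta>\<bar> * U * (2 * pi) + 2 * U"
  have C: "0 \<le> C" using V0 U0 by (simp add: C_def)
  have "(LINT x:I2|lborel. cmod (z x - cyclic_shift (2 * pi / real N) z x)) \<le> C * (2 * pi / real N)" if N: "1 \<le> N" for N :: nat
  proof -
    define h where "h = 2 * pi / real N"
    have h: "0 < h" "h \<le> 2 * pi" "real N * h = 2 * pi" using N by (auto simp: h_def field_simps)
    define v where "v x = indicator I2 x *\<^sub>R u x" for x
    have vi: "integrable lborel v" using u by (simp add: set_integrable_def v_def[abs_def])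
    have vi': "integrable lborel (\<lambda>x. v (c + 1 * x))" for c
      using lborel_integrable_real_affine[OF vi, of 1 c] by simp
    define g where "g x = cmod (v x - v (- h + 1 * x))" for x
    have gi: "integrable lborel g"
      unfolding g_def by (intro integrable_norm Bochner_Integration.integrable_diff vi vi')
    define T where "T i = {real i * h..real (Suc i) * h}" for i
    have Ti: "integrable lborel (\<lambda>x. indicator (T i) x *\<^sub>R g x)" for i
      by (intro integrable_mult_indicator gi) (simp add: T_def)
    have zi: "set_integrable lborel I2 z"
      using set_integrable_mult_cis[OF u, of "- \<theta>"] by (simp add: z_def mult.commute)
    have lhsi: "integrable lborel (\<lambda>x. indicator I2 x *\<^sub>R cmod (z x - cyclic_shift h z x))"
      using set_integrable_norm[OF set_integral_diff(1)[OF zi integrable_cyclic_shift(1)[OF _ h(2) zi]]] h(1)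
      by (simp add: set_integrable_def)
    define Sg where "Sg x = (\<Sum>i\<in>{1..<N}. indicator (T i) x *\<^sub>R g x)" for x
    define R where "R x = Sg x + (indicator I2 x *\<^sub>R (\<bar>\<theta>\<bar> * h * U) + indicator {0..h} x *\<^sub>R (2 * U))" for x
    have ind: "integrable lborel (\<lambda>x. indicator {a..b} x *\<^sub>R (c::real))" for a b c :: real
      using borel_integrable_atLeastAtMost'[of a b "\<lambda>x. c"] by (simp add: set_integrable_def)
    have Ri: "integrable lborel R"
      unfolding R_def Sg_def using Ti ind by (intro Bochner_Integration.integrable_add Bochner_Integration.integrable_sum) auto
    have le: "indicator I2 x *\<^sub>R cmod (z x - cyclic_shift h z x) \<le> R x" for x
    proof (cases "x \<in> I2")
      case False
      then show ?thesis using U0 h(1) by (auto simp: R_def Sg_def g_def intro!: add_nonneg_nonneg sum_nonneg)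
    next
      case x: True
      have Rx: "R x = Sg x + (\<bar>\<theta>\<bar> * h * U + indicator {0..h} x * (2 * U))"
        using x by (simp add: R_def)
      have S0: "0 \<le> Sg x" unfolding Sg_def by (intro sum_nonneg) (simp add: g_def)
      show ?thesis
      proof (cases "h \<le> x")
        case False
        have "cmod (z x - cyclic_shift h z x) \<le> cmod (z x) + cmod (cyclic_shift h z x)" by (rule norm_triangle_ineq4)
        also have "\<dots> \<le> U + U"
          using U[OF x] U[of "x - h + 2 * pi"] False x h by (intro add_mono) (auto simp: z_def cyclic_shift_def norm_mult)
        finally have "cmod (z x - cyclic_shift h z x) \<le> 2 * U" by simp
        moreover have "0 \<le> \<bar>\<theta>\<bar> * h * U" using h U0 by simp
        moreover have "indicator {0..h} x * (2 * U) = 2 * U" using x False by simp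
        ultimately have "cmod (z x - cyclic_shift h z x) \<le> R x" using S0 unfolding Rx by linarith
        then show ?thesis using x by simp
      next
        case True
        \<comment> \<open>The cell that contains \<open>x\<close>; the minimum puts the end point
          \<open>2 * pi\<close> into the last cell.\<close>
        define i where "i = min (nat \<lfloor>x / h\<rfloor>) (N - 1)"
        have xh: "1 \<le> x / h" "x / h \<le> N" using True x h by (auto simp: field_simps)
        have fl: "real (nat \<lfloor>x / h\<rfloor>) \<le> x / h" "x / h < real (nat \<lfloor>x / h\<rfloor>) + 1" "1 \<le> nat \<lfloor>x / h\<rfloor>"
          using xh by linarith+
        have ir: "real i \<le> x / h" "x / h \<le> real (Suc i)"
        proof -
          have "real i \<le> x / h \<and> x / h \<le> real i + 1"
          proof (cases "nat \<lfloor>x / h\<rfloor> \<le> N - 1")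
            case True
            then have "i = nat \<lfloor>x / h\<rfloor>" by (simp add: i_def)
            then show ?thesis using fl by linarith
          next
            case False
            then have "i = N - 1" by (simp add: i_def)
            then have "real i = real N - 1" "i \<le> nat \<lfloor>x / h\<rfloor>" using N False by (auto simp: of_nat_diff)
            then show ?thesis using fl xh by linarith
          qed
          then show "real i \<le> x / h" "x / h \<le> real (Suc i)" by auto
        qed
        then have xT: "x \<in> T i" using h by (simp add: T_def field_simps)
        show ?thesis
        \<comment> \<open>With a single cell only \<open>x = 2 * pi\<close> is left, and the term
          for \<open>{0..h}\<close> covers it.\<close>
        proof (cases "N = 1")
          case True
          then have "h = 2 * pi" using h by simp
          then have x2: "x = 2 * pi" using \<open>h \<le> x\<close> x by simp
          have "cmod (z x - cyclic_shift h z x) \<le> cmod (z x) + cmod (cyclic_shift h z x)" by (rule norm_triangle_ineq4)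
          also have "\<dots> \<le> U + U"
            using U[OF x] U[of 0] x2 \<open>h = 2 * pi\<close> by (intro add_mono) (auto simp: z_def cyclic_shift_def norm_mult)
          finally have "cmod (z x - cyclic_shift h z x) \<le> 2 * U" by simp
          moreover have "0 \<le> \<bar>\<theta>\<bar> * h * U" using h U0 by simp
          moreover have "indicator {0..h} x * (2 * U) = 2 * U" using x2 \<open>h = 2 * pi\<close> by simp
          ultimately have "cmod (z x - cyclic_shift h z x) \<le> R x" using S0 unfolding Rx by linarith
          then show ?thesis using x by simp
        next
          case False
          then have iN: "i \<in> {1..<N}" using fl N by (auto simp: i_def min_def)
          have "g x = indicator (T i) x *\<^sub>R g x" using xT by simp
          also have "\<dots> \<le> (\<Sum>i\<in>{1..<N}. indicator (T i) x *\<^sub>R g x)"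
            using iN by (intro member_le_sum[of i "{1..<N}" "\<lambda>i. indicator (T i) x *\<^sub>R g x"]) (auto simp: g_def)
          finally have gS: "g x \<le> Sg x" by (simp only: Sg_def)
          have xI: "x - h \<in> I2" using \<open>h \<le> x\<close> x h by auto
          have gx: "g x = cmod (u x - u (x - h))" using x xI by (simp add: g_def v_def)
          have "z x - cyclic_shift h z x = cis (- \<theta> * x) * (u x - u (x - h)) + (cis (- \<theta> * x) - cis (- \<theta> * (x - h))) * u (x - h)"
            using \<open>h \<le> x\<close> by (simp add: z_def cyclic_shift_def algebra_simps)
          then have "cmod (z x - cyclic_shift h z x) \<le> cmod (cis (- \<theta> * x) * (u x - u (x - h))) + cmod ((cis (- \<theta> * x) - cis (- \<theta> * (x - h))) * u (x - h))"
            by (simp only: norm_triangle_ineq)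
          also have "\<dots> \<le> g x + \<bar>\<theta>\<bar> * h * U"
          proof (intro add_mono)
            show "cmod (cis (- \<theta> * x) * (u x - u (x - h))) \<le> g x" by (simp add: norm_mult gx)
            have "cmod (cis (- \<theta> * x) - cis (- \<theta> * (x - h))) \<le> \<bar>\<theta>\<bar> * h"
            proof -
              have "cis (- \<theta> * x) = ee (- \<theta> * x / (2 * pi))" "cis (- \<theta> * (x - h)) = ee (- \<theta> * (x - h) / (2 * pi))"
                by (simp_all add: ee_def)
              then have "cmod (cis (- \<theta> * x) - cis (- \<theta> * (x - h))) \<le> 2 * pi * \<bar>- \<theta> * x / (2 * pi) - - \<theta> * (x - h) / (2 * pi)\<bar>"
                by (simp only: norm_ee_diff_le)
              also have "- \<theta> * x / (2 * pi) - - \<theta> * (x - h) / (2 * pi) = - \<theta> * h / (2 * pi)"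
                by (simp add: diff_divide_distrib[symmetric] algebra_simps)
              also have "2 * pi * \<bar>- \<theta> * h / (2 * pi)\<bar> = \<bar>\<theta>\<bar> * h" using h by (simp add: abs_mult)
              finally show ?thesis .
            qed
            then show "cmod ((cis (- \<theta> * x) - cis (- \<theta> * (x - h))) * u (x - h)) \<le> \<bar>\<theta>\<bar> * h * U"
              unfolding norm_mult using U[OF xI] h by (intro mult_mono) auto
          qed
          finally have "cmod (z x - cyclic_shift h z x) \<le> Sg x + \<bar>\<theta>\<bar> * h * U"
            using gS by simp
          moreover have "0 \<le> indicator {0..h} x * (2 * U)" using U0 by simp
          ultimately have "cmod (z x - cyclic_shift h z x) \<le> R x" unfolding Rx by linarith
          then show ?thesis using x by simp
        qed
      qed
    qed
    have sumT: "(\<Sum>i\<in>{1..<N}. \<integral>x. indicator (T i) x *\<^sub>R g x \<partial>lborel) \<le> V * h"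
    proof -
      have tr: "(\<integral>x. indicator (T i) x *\<^sub>R g x \<partial>lborel) = (\<integral>x. indicator {0..h} x *\<^sub>R g (real i * h + 1 * x) \<partial>lborel)"
        "integrable lborel (\<lambda>x. indicator {0..h} x *\<^sub>R g (real i * h + 1 * x))" for i
      proof -
        have eq: "indicator (T i) (real i * h + 1 * x) *\<^sub>R g (real i * h + 1 * x) = indicator {0..h} x *\<^sub>R g (real i * h + 1 * x)" for x
          by (simp add: T_def indicator_def algebra_simps)
        show "(\<integral>x. indicator (T i) x *\<^sub>R g x \<partial>lborel) = (\<integral>x. indicator {0..h} x *\<^sub>R g (real i * h + 1 * x) \<partial>lborel)"
          using lborel_integral_real_affine[of 1 "\<lambda>x. indicator (T i) x *\<^sub>R g x" "real i * h"] unfolding eq by simp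
        show "integrable lborel (\<lambda>x. indicator {0..h} x *\<^sub>R g (real i * h + 1 * x))"
          using lborel_integrable_real_affine[OF Ti[of i], of 1 "real i * h"] unfolding eq by simp
      qed
      have "(\<Sum>i\<in>{1..<N}. \<integral>x. indicator (T i) x *\<^sub>R g x \<partial>lborel) = (\<integral>x. (\<Sum>i\<in>{1..<N}. indicator {0..h} x *\<^sub>R g (real i * h + 1 * x)) \<partial>lborel)"
        unfolding tr(1) by (rule Bochner_Integration.integral_sum[symmetric]) (rule tr(2))
      also have "\<dots> \<le> (\<integral>x. indicator {0..h} x *\<^sub>R V \<partial>lborel)"
      proof (rule integral_mono)
        show "integrable lborel (\<lambda>x. \<Sum>i\<in>{1..<N}. indicator {0..h} x *\<^sub>R g (real i * h + 1 * x))"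
          by (intro Bochner_Integration.integrable_sum tr(2))
        show "integrable lborel (\<lambda>x. indicator {0..h} x *\<^sub>R V)" by (rule ind)
        fix x
        show "(\<Sum>i\<in>{1..<N}. indicator {0..h} x *\<^sub>R g (real i * h + 1 * x)) \<le> indicator {0..h} x *\<^sub>R V"
        proof (cases "x \<in> {0..h}")
          case True
          define xs where "xs k = real k * h + x" for k
          have xsI: "xs k \<in> I2" if "k < N" for k
          proof -
            have "real k * h + x \<le> real k * h + h" using True by simp
            also have "\<dots> = real (Suc k) * h" by (simp add: algebra_simps)
            also have "\<dots> \<le> real N * h" using that h by (intro mult_right_mono) auto
            finally show ?thesis using True h by (simp add: xs_def)
          qed
          have "(\<Sum>i\<in>{1..<N}. g (real i * h + 1 * x)) = (\<Sum>k<N - 1. cmod (u (xs (Suc k)) - u (xs k)))"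
          proof (rule sum.reindex_bij_witness[of _ Suc "\<lambda>i. i - 1"])
            fix i assume i: "i \<in> {1..<N}"
            then obtain k where k: "i = Suc k" by (cases i) auto
            have e: "- h + 1 * xs i = xs k" "real i * h + 1 * x = xs i"
              by (simp_all add: k xs_def algebra_simps)
            have "xs i \<in> I2" "xs k \<in> I2" using xsI[of i] xsI[of k] i k by auto
            then show "cmod (u (xs (Suc (i - 1))) - u (xs (i - 1))) = g (real i * h + 1 * x)"
              unfolding g_def e by (simp add: k v_def)
          qed auto
          also have "\<dots> \<le> V"
            using xsI h N by (intro V) (auto simp: xs_def algebra_simps)
          finally show ?thesis using True by simp
        qed simp
      qed
      also have "\<dots> = V * h" using h by simp
      finally show ?thesis .
    qed
    have "(LINT x:I2|lborel. cmod (z x - cyclic_shift h z x)) \<le> (\<integral>x. R x \<partial>lborel)"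
      unfolding set_lebesgue_integral_def by (rule integral_mono[OF lhsi Ri le])
    also have "\<dots> = (\<Sum>i\<in>{1..<N}. \<integral>x. indicator (T i) x *\<^sub>R g x \<partial>lborel) + (\<bar>\<theta>\<bar> * h * U * (2 * pi) + 2 * U * h)"
    proof -
      have e1: "integrable lborel (\<lambda>x. \<Sum>i\<in>{1..<N}. indicator (T i) x *\<^sub>R g x)"
        by (intro Bochner_Integration.integrable_sum Ti)
      have "(\<integral>x. R x \<partial>lborel) = (\<integral>x. (\<Sum>i\<in>{1..<N}. indicator (T i) x *\<^sub>R g x) \<partial>lborel) +
          ((\<integral>x. indicator I2 x *\<^sub>R (\<bar>\<theta>\<bar> * h * U) \<partial>lborel) + (\<integral>x. indicator {0..h} x *\<^sub>R (2 * U) \<partial>lborel))"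
        unfolding R_def Sg_def
        by (simp only: Bochner_Integration.integral_add[OF e1 Bochner_Integration.integrable_add[OF ind ind]]
            Bochner_Integration.integral_add[OF ind ind])
      also have "(\<integral>x. (\<Sum>i\<in>{1..<N}. indicator (T i) x *\<^sub>R g x) \<partial>lborel) = (\<Sum>i\<in>{1..<N}. \<integral>x. indicator (T i) x *\<^sub>R g x \<partial>lborel)"
        by (rule Bochner_Integration.integral_sum[OF Ti])
      finally show ?thesis using h by simp
    qed
    also have "\<dots> \<le> V * h + (\<bar>\<theta>\<bar> * h * U * (2 * pi) + 2 * U * h)"
      using sumT by simp
    also have "\<dots> = C * h" by (simp add: C_def algebra_simps)
    finally show ?thesis by (simp only: h_def)
  qed
  then show ?thesis using C by blast
qed

text \<open>The symbol of the difference quotient divided by that of the derivative.\<close>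

lemma difference_quotient_cis:
  assumes "j \<noteq> 0"
  shows "(\<lambda>N. (1 - cis (- real_of_int j * (2 * pi / real N))) / (\<i> * of_int j * of_real (2 * pi / real N))) \<longlonglongrightarrow> 1"
proof -
  define w where "w N = - (\<i> * of_int j * complex_of_real (2 * pi / real N))" for N
  have "(\<lambda>N. 2 * pi * inverse (real N)) \<longlonglongrightarrow> 2 * pi * 0"
    by (intro tendsto_intros lim_inverse_n)
  then have "(\<lambda>N. 2 * pi / real N) \<longlonglongrightarrow> 0" by (simp add: field_simps)
  then have "w \<longlonglongrightarrow> - (\<i> * of_int j * complex_of_real 0)"
    unfolding w_def by (intro tendsto_intros)
  then have "w \<longlonglongrightarrow> 0" by simp
  moreover have "eventually (\<lambda>N. w N \<noteq> 0) sequentially"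
    using eventually_gt_at_top[of 0] by eventually_elim (use assms in \<open>simp add: w_def\<close>)
  ultimately have "filterlim w (at 0) sequentially" by (simp add: filterlim_at)
  from filterlim_compose[OF lim_exp_minus_1 this]
  have "(\<lambda>N. (exp (w N) - 1) / w N) \<longlonglongrightarrow> 1" .
  moreover have "(exp (w N) - 1) / w N = (1 - cis (- real_of_int j * (2 * pi / real N))) / (\<i> * of_int j * of_real (2 * pi / real N))" for N
  proof -
    have ex: "exp (w N) = cis (- real_of_int j * (2 * pi / real N))"
      by (simp add: w_def cis_conv_exp mult_ac)
    have neg: "(e - 1) / (- u) = (1 - e) / u" for e u :: complex
      by (simp add: minus_divide_right[symmetric] minus_divide_left)
    show ?thesis unfolding ex unfolding w_def by (rule neg)
  qed
  ultimately show ?thesis by simp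
qed

text \<open>The multiplier with symbol \<open>\<mu>\<close> maps \<open>z\<close> to the convolution of the derivative of \<open>z\<close>, here a difference
  quotient with bounded \<open>L^1\<close> norm, with the kernel that has the coefficients \<open>\<mu> j / j\<close>.\<close>

lemma multiplier_block_bound:
  assumes z: "set_integrable lborel I2 z"
    and C: "\<And>N. 1 \<le> N \<Longrightarrow> (LINT x:I2|lborel. cmod (z x - cyclic_shift (2 * pi / real N) z x)) \<le> C * (2 * pi / real N)"
    and J: "finite J" "0 \<notin> J"
    and kernel: "\<And>y. cmod (\<Sum>j\<in>J. \<mu> j / of_int j * cis (real_of_int j * y)) \<le> e" and e: "0 \<le> e"
  shows "cmod (\<Sum>j\<in>J. fourier_coeff z j * \<mu> j * cis (real_of_int j * x)) \<le> C * e"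
proof -
  define r where "r N j = (1 - cis (- real_of_int j * (2 * pi / real N))) / (\<i> * of_int j * of_real (2 * pi / real N))" for N j
  define T where "T N = (\<Sum>j\<in>J. r N j * (fourier_coeff z j * \<mu> j * cis (real_of_int j * x)))" for N
  have "T \<longlonglongrightarrow> (\<Sum>j\<in>J. 1 * (fourier_coeff z j * \<mu> j * cis (real_of_int j * x)))"
    unfolding T_def r_def using J(2)
    by (intro tendsto_sum tendsto_mult_right difference_quotient_cis) auto
  then have lim: "(\<lambda>N. cmod (T N)) \<longlonglongrightarrow> cmod (\<Sum>j\<in>J. fourier_coeff z j * \<mu> j * cis (real_of_int j * x))"
    by (intro tendsto_norm) simp
  have bound: "cmod (T N) \<le> C * e" if N: "1 \<le> N" for N
  proof -
    define h where "h = 2 * pi / real N"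
    have h: "0 < h" "0 \<le> h" "h \<le> 2 * pi" using N by (auto simp: h_def field_simps)
    define D where "D y = z y - cyclic_shift h z y" for y
    have ci: "set_integrable lborel I2 (cyclic_shift h z)" by (rule integrable_cyclic_shift(1)[OF h(2,3) z])
    have Di: "set_integrable lborel I2 D" unfolding D_def[abs_def] using z ci by (rule set_integral_diff(1))
    \<comment> \<open>The kernel at \<open>x - y\<close>, so that the integral of
      \<open>D y * H y\<close> is a convolution at \<open>x\<close>.\<close>
    define H where "H y = (\<Sum>j\<in>J. \<mu> j / of_int j * cis (real_of_int j * (x - y)))" for y
    have Hm: "H \<in> borel_measurable borel"
      unfolding H_def[abs_def] by (intro borel_measurable_continuous_onI continuous_intros)
    have fcD: "fourier_coeff D j = (1 - cis (- real_of_int j * h)) * fourier_coeff z j" for j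
      unfolding D_def[abs_def] fourier_coeff_diff[OF z ci] fourier_coeff_cyclic_shift[OF h(2,3) z] by (simp add: algebra_simps)
    have DHi: "set_integrable lborel I2 (\<lambda>y. D y * H y)"
      by (rule set_integrable_mult_bounded[OF Di Hm, where B = e]) (use kernel in \<open>auto simp: H_def\<close>)
    have "(LINT y:I2|lborel. D y * H y) = (\<Sum>j\<in>J. \<mu> j / of_int j * cis (real_of_int j * x) * fourier_coeff D j)"
    proof -
      have sp: "cis (real_of_int j * (x - y)) = cis (real_of_int j * x) * cis (- real_of_int j * y)" for j y
        by (simp add: cis_mult algebra_simps)
      \<comment> \<open>The coefficient of index 0 is a plain integral; in this shape
        \<open>fourier_coeff_sum\<close> exchanges sum and integral.\<close>
      have "(LINT y:I2|lborel. D y * H y) = fourier_coeff (\<lambda>y. \<Sum>j\<in>J. (\<mu> j / of_int j * cis (real_of_int j * x)) * (D y * cis (- real_of_int j * y))) 0"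
        unfolding fourier_coeff_def H_def sum_distrib_left sum_distrib_right
        by (intro set_lebesgue_integral_cong allI impI sum.cong refl) (simp_all add: sp mult_ac)
      also have "\<dots> = (\<Sum>j\<in>J. (\<mu> j / of_int j * cis (real_of_int j * x)) * fourier_coeff (\<lambda>y. D y * cis (- real_of_int j * y)) 0)"
        by (rule fourier_coeff_sum[OF J(1) set_integrable_mult_cis[OF Di]])
      also have "\<dots> = (\<Sum>j\<in>J. \<mu> j / of_int j * cis (real_of_int j * x) * fourier_coeff D j)" by (simp add: fourier_coeff_def)
      finally show ?thesis .
    qed
    also have "\<dots> = (\<i> * of_real h) * T N"
      unfolding T_def sum_distrib_left
    proof (intro sum.cong refl)
      fix j assume "j \<in> J"
      then have "j \<noteq> 0" using J(2) by auto
      then show "\<mu> j / of_int j * cis (real_of_int j * x) * fourier_coeff D j = \<i> * of_real h * (r N j * (fourier_coeff z j * \<mu> j * cis (real_of_int j * x)))"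
        using h by (simp add: fcD r_def h_def[symmetric])
    qed
    finally have "cmod (LINT y:I2|lborel. D y * H y) = h * cmod (T N)"
      using h by (simp add: norm_mult)
    moreover have "cmod (LINT y:I2|lborel. D y * H y) \<le> (LINT y:I2|lborel. cmod (D y * H y))"
      by (rule set_integral_norm_bound[OF DHi])
    moreover have "(LINT y:I2|lborel. cmod (D y * H y)) \<le> (LINT y:I2|lborel. cmod (D y) * e)"
    proof (rule set_integral_mono)
      show "set_integrable lborel I2 (\<lambda>y. cmod (D y * H y))" by (rule set_integrable_norm[OF DHi])
      show "set_integrable lborel I2 (\<lambda>y. cmod (D y) * e)" using set_integrable_norm[OF Di] by simp
      show "cmod (D y * H y) \<le> cmod (D y) * e" for y
        unfolding norm_mult H_def using kernel by (intro mult_left_mono) auto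
    qed
    moreover have "(LINT y:I2|lborel. cmod (D y) * e) = (LINT y:I2|lborel. cmod (D y)) * e" by simp
    moreover have "(LINT y:I2|lborel. cmod (D y)) * e \<le> C * h * e"
      using C[OF N] e unfolding D_def h_def by (intro mult_right_mono) auto
    ultimately have "h * cmod (T N) \<le> h * (C * e)" by (simp add: mult_ac)
    then show ?thesis using h by simp
  qed
  show ?thesis
    by (rule LIMSEQ_le_const2[OF lim]) (use bound in blast)
qed

text \<open>Pairs the frequencies \<open>j\<close> and \<open>- j\<close>;
  \<open>y / (2 * pi)\<close> appears because \<open>osc\<close> measures phases in full
  turns.\<close>

lemma symmetric_block_osc:
  "(\<Sum>j\<in>{- int V..int V} - {- int U..int U}. ee (qphase A n q \<theta> (of_int j)) / of_int j * cis (real_of_int j * y)) =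
    (\<Sum>j\<in>{U<..V}. osc A n q \<theta> (y / (2 * pi)) j)"
proof -
  define f where "f j = ee (qphase A n q \<theta> (of_int j)) / of_int j * cis (real_of_int j * y)" for j :: int
  have "{- int V..int V} - {- int U..int U} = int ` {U<..V} \<union> (\<lambda>j. - int j) ` {U<..V}"
  proof (intro set_eqI iffI)
    fix j assume j: "j \<in> {- int V..int V} - {- int U..int U}"
    show "j \<in> int ` {U<..V} \<union> (\<lambda>j. - int j) ` {U<..V}"
    proof (cases "0 \<le> j")
      case True
      then have "j = int (nat j)" "nat j \<in> {U<..V}" using j by auto
      then show ?thesis by blast
    next
      case False
      then have "j = - int (nat (- j))" "nat (- j) \<in> {U<..V}" using j by auto
      then show ?thesis by blast
    qed
  qed auto
  then have "(\<Sum>j\<in>{- int V..int V} - {- int U..int U}. f j) = (\<Sum>j\<in>int ` {U<..V}. f j) + (\<Sum>j\<in>(\<lambda>j. - int j) ` {U<..V}. f j)"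
    by (simp only:) (rule sum.union_disjoint, auto)
  also have "\<dots> = (\<Sum>j\<in>{U<..V}. f (int j) + f (- int j))"
    by (subst (1 2) sum.reindex) (auto simp: inj_on_def sum.distrib)
  also have "\<dots> = (\<Sum>j\<in>{U<..V}. osc A n q \<theta> (y / (2 * pi)) j)"
  proof (intro sum.cong refl)
    fix j
    have "cis (real j * y) = ee (y / (2 * pi) * real j)" "cis (- (real j * y)) = ee (- (y / (2 * pi) * real j))"
      by (simp_all add: ee_def mult_ac)
    then show "f (int j) + f (- int j) = osc A n q \<theta> (y / (2 * pi)) j"
      by (simp add: f_def osc_def diff_divide_distrib ee_add ee_diff ee_minus)
  qed
  finally show ?thesis by (simp only: f_def)
qed

lemma irrational_continuity:
  fixes p q :: int and \<theta> :: real
  assumes \<theta>: "0 < \<theta>" "\<theta> < 1" "\<theta> \<notin> \<rat>" and n: "3 \<le> n" "\<alpha> n \<noteq> 0" and p: "0 < p" and q: "0 < q" and u0: "L2_0_2pi u0"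
    and bv: "bounded_variation_on u0 0 (2 * pi)"
    and sol: "QP_solution_at \<alpha> n \<theta> u0 (2 * pi * real_of_int p / real_of_int q) v"
  shows "\<exists>g. continuous_on I2 g \<and> (AE x in lborel. x \<in> I2 \<longrightarrow> v x = g x) \<and> cis (2 * pi * \<theta>) * g 0 = g (2 * pi)"
proof -
  define z where "z x = cis (- \<theta> * x) * u0 x" for x
  define A where "A m = - p * \<alpha> m" for m
  define \<mu> where "\<mu> j = ee (qphase A n (nat q) \<theta> (real_of_int j))" for j
  define c where "c j = fourier_coeff z j * \<mu> j / (2 * of_real pi)" for j
  \<comment> \<open>Only orders \<open>2 ^ K\<close> occur, as the kernel is controlled over dyadic
    ranges. This suffices: all partial sums converge to \<open>v\<close> in the mean, so a uniformly
    convergent subsequence determines \<open>v\<close>.\<close>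
  define S where "S K = fourier_partial c (2 ^ K)" for K
  have u0i: "set_integrable lborel I2 u0" by (rule L2_set_integrable[OF u0])
  have zi: "set_integrable lborel I2 z"
    using set_integrable_mult_cis[OF u0i, of "- \<theta>"] by (simp add: z_def[abs_def] mult.commute)
  obtain C where C: "0 \<le> C" "\<And>N. 1 \<le> N \<Longrightarrow> (LINT x:I2|lborel. cmod (z x - cyclic_shift (2 * pi / real N) z x)) \<le> C * (2 * pi / real N)"
    using bounded_variation_translation[OF bv u0i, of \<theta>] unfolding z_def[symmetric] by blast
  have QP: "QP_partial \<alpha> n \<theta> u0 (2 * pi * real_of_int p / real_of_int q) (2 ^ K) x = cis (\<theta> * x) * S K x" for K x
    unfolding QP_partial_fourier exp_phase[OF q] S_def c_def z_def[abs_def] \<mu>_def A_def[abs_def] ..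
  have An: "A n \<noteq> 0" using n p by (simp add: A_def)
  have Cauchy: "\<exists>k0. \<forall>k l x. k0 \<le> k \<longrightarrow> k \<le> l \<longrightarrow> cmod (S l x - S k x) \<le> \<epsilon>" if \<epsilon>: "0 < \<epsilon>" for \<epsilon>
  proof -
    define e where "e = \<epsilon> / (C + 1)"
    have e: "0 < e" using \<epsilon> C by (simp add: e_def)
    obtain k0 where k0: "\<And>k l x. k0 \<le> k \<Longrightarrow> k \<le> l \<Longrightarrow> cmod (\<Sum>j\<in>{2 ^ k<..2 ^ l}. osc A n (nat q) \<theta> x j) \<le> e"
      using symmetric_sums_uniformly_Cauchy[where A = A and \<theta> = \<theta> and q = "nat q", OF n(1) _ An _ \<theta>(3) e] q \<theta> by auto
    have "cmod (S l x - S k x) \<le> \<epsilon>" if k: "k0 \<le> k" "k \<le> l" for k l x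
    proof -
      define J where "J = {- int (2 ^ l)..int (2 ^ l)} - {- int (2 ^ k)..int (2 ^ k)}"
      have "(2::int) ^ k \<le> 2 ^ l" using k(2) by (intro power_increasing) auto
      then have "S l x - S k x = (\<Sum>j\<in>J. c j * cis (real_of_int j * x))"
        unfolding S_def fourier_partial_def J_def by (intro sum_diff[symmetric]) auto
      also have "\<dots> = (\<Sum>j\<in>J. fourier_coeff z j * \<mu> j * cis (real_of_int j * x)) / (2 * of_real pi)"
        by (simp add: c_def sum_divide_distrib)
      also have "cmod \<dots> = cmod (\<Sum>j\<in>J. fourier_coeff z j * \<mu> j * cis (real_of_int j * x)) / (2 * pi)"
        by (simp add: norm_divide norm_mult)
      also have "\<dots> \<le> (C * e) / (2 * pi)"
      proof (intro divide_right_mono multiplier_block_bound[OF zi C(2)])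
        show "cmod (\<Sum>j\<in>J. \<mu> j / of_int j * cis (real_of_int j * y)) \<le> e" for y
          unfolding J_def \<mu>_def symmetric_block_osc by (rule k0[OF k])
      qed (use e in \<open>auto simp: J_def\<close>)
      also have "\<dots> \<le> (C * e) / 1"
        using C e pi_ge_two by (intro divide_left_mono) auto
      also have "\<dots> \<le> \<epsilon>" using C \<epsilon> by (simp add: e_def field_simps)
      finally show ?thesis .
    qed
    then show ?thesis by blast
  qed
  have "uniformly_Cauchy_on UNIV S"
    unfolding uniformly_Cauchy_on_def
  proof (intro allI impI)
    fix \<epsilon> :: real assume \<epsilon>: "0 < \<epsilon>"
    obtain k0 where k0: "\<And>k l x. k0 \<le> k \<Longrightarrow> k \<le> l \<Longrightarrow> cmod (S l x - S k x) \<le> \<epsilon> / 2"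
      using Cauchy[of "\<epsilon> / 2"] \<epsilon> by auto
    have "dist (S m x) (S k x) < \<epsilon>" if "k0 \<le> m" "k0 \<le> k" for m k x
    proof (cases "k \<le> m")
      case True
      then show ?thesis using k0[of k m x] that \<epsilon> by (simp add: dist_norm)
    next
      case False
      then show ?thesis using k0[of m k x] that \<epsilon> by (simp add: dist_norm norm_minus_commute)
    qed
    then show "\<exists>M. \<forall>x\<in>UNIV. \<forall>m\<ge>M. \<forall>n\<ge>M. dist (S m x) (S n x) < \<epsilon>" by blast
  qed
  then obtain g0 where g0: "uniform_limit UNIV S g0 sequentially"
    using Cauchy_uniformly_convergent unfolding uniformly_convergent_on_def by blast
  have Sc: "continuous_on UNIV (S K)" for K
    unfolding S_def fourier_partial_def[abs_def] by (intro continuous_intros)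
  have g0c: "continuous_on UNIV g0"
    by (rule uniform_limit_theorem[OF _ g0]) (use Sc in auto)
  define g where "g x = cis (\<theta> * x) * g0 x" for x
  have gc: "continuous_on UNIV g" unfolding g_def[abs_def]
    by (intro continuous_intros g0c)
  have pw: "(\<lambda>K. S K x) \<longlonglongrightarrow> g0 x" for x
    by (rule tendsto_uniform_limitI[OF g0]) simp
  \<comment> \<open>\<open>g0\<close> inherits the period, and the factor
    \<open>cis (\<theta> * x)\<close> of \<open>g\<close> then produces the quasi-periodic boundary
    condition.\<close>
  have "S K (2 * pi) = S K 0" for K
    unfolding S_def fourier_partial_def
    using cis_int_period[of j 0 for j] by simp
  then have "g0 (2 * pi) = g0 0" using pw[of "2 * pi"] pw[of 0] LIMSEQ_unique by auto
  then have qp: "cis (2 * pi * \<theta>) * g 0 = g (2 * pi)" by (simp add: g_def mult.commute)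
  have v: "set_integrable lborel I2 v"
    using sol by (intro L2_set_integrable) (simp add: QP_solution_at_def)
  have gi: "set_integrable lborel I2 g"
    by (intro borel_integrable_atLeastAtMost' continuous_on_subset[OF gc]) auto
  have vgi: "set_integrable lborel I2 (\<lambda>x. cmod (v x - g x))"
    by (rule set_integrable_norm[OF set_integral_diff(1)[OF v gi]])
  have "strict_mono (\<lambda>K. (2::nat) ^ K)" by (rule strict_monoI) simp
  from LIMSEQ_subseq_LIMSEQ[OF QP_solution_L1[OF sol] this]
  have L1: "(\<lambda>K. LINT x:I2|lborel. cmod (cis (\<theta> * x) * S K x - v x)) \<longlonglongrightarrow> 0"
    by (simp add: o_def QP)
  have "(LINT x:I2|lborel. cmod (v x - g x)) \<le> 0"
  proof (rule field_le_epsilon)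
    fix \<epsilon> :: real assume \<epsilon>: "0 < \<epsilon>"
    \<comment> \<open>The error in the mean contributes \<open>e\<close>, the uniform error
      contributes \<open>e\<close> times the length \<open>2 * pi\<close>.\<close>
    define e where "e = \<epsilon> / (1 + 2 * pi)"
    have "0 < 1 + 2 * pi" using pi_gt_zero by linarith
    then have e: "0 < e" "e * (1 + 2 * pi) = \<epsilon>" using \<epsilon> by (simp_all add: e_def)
    have "eventually (\<lambda>K. \<forall>x\<in>UNIV. dist (S K x) (g0 x) < e) sequentially"
      using g0 e(1) unfolding uniform_limit_iff by blast
    moreover have "eventually (\<lambda>K. dist (LINT x:I2|lborel. cmod (cis (\<theta> * x) * S K x - v x)) 0 < e) sequentially"
      using tendstoD[OF L1 e(1)] .
    ultimately have "eventually (\<lambda>K. (\<forall>x\<in>UNIV. dist (S K x) (g0 x) < e) \<and>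
        dist (LINT x:I2|lborel. cmod (cis (\<theta> * x) * S K x - v x)) 0 < e) sequentially"
      by eventually_elim simp
    then obtain K where K: "\<And>x. dist (S K x) (g0 x) < e" "\<bar>LINT x:I2|lborel. cmod (cis (\<theta> * x) * S K x - v x)\<bar> < e"
      by (auto simp: eventually_sequentially)
    have Si: "set_integrable lborel I2 (\<lambda>x. cis (\<theta> * x) * S K x)"
      by (intro borel_integrable_atLeastAtMost' continuous_intros continuous_on_subset[OF Sc]) auto
    have "(LINT x:I2|lborel. cmod (v x - g x)) \<le> (LINT x:I2|lborel. cmod (cis (\<theta> * x) * S K x - v x) + e)"
    proof (rule set_integral_mono[OF vgi])
      show "set_integrable lborel I2 (\<lambda>x. cmod (cis (\<theta> * x) * S K x - v x) + e)"
        by (intro set_integral_add(1) set_integrable_norm set_integral_diff(1) Si v set_integrable_const_I2)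
      fix x
      have "v x - g x = - (cis (\<theta> * x) * S K x - v x) + cis (\<theta> * x) * (S K x - g0 x)"
        by (simp add: g_def algebra_simps)
      then have "cmod (v x - g x) \<le> cmod (- (cis (\<theta> * x) * S K x - v x)) + cmod (cis (\<theta> * x) * (S K x - g0 x))"
        by (simp only: norm_triangle_ineq)
      also have "\<dots> \<le> cmod (cis (\<theta> * x) * S K x - v x) + e"
        using K(1)[of x] by (simp only: norm_minus_cancel norm_mult norm_cis mult_1 dist_norm add_le_cancel_left less_imp_le)
      finally show "cmod (v x - g x) \<le> cmod (cis (\<theta> * x) * S K x - v x) + e" .
    qed
    also have "\<dots> = (LINT x:I2|lborel. cmod (cis (\<theta> * x) * S K x - v x)) + (LINT x:I2|lborel. e)"
      by (intro set_integral_add(2) set_integrable_norm set_integral_diff(1) Si v set_integrable_const_I2)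
    also have "(LINT x:I2|lborel. e) = e * (2 * pi)" by (simp add: set_lebesgue_integral_def)
    also have "(LINT x:I2|lborel. cmod (cis (\<theta> * x) * S K x - v x)) + e * (2 * pi) \<le> \<epsilon>"
      using K(2) e(2) by (simp add: algebra_simps)
    finally show "(LINT x:I2|lborel. cmod (v x - g x)) \<le> 0 + \<epsilon>" by simp
  qed
  moreover have "0 \<le> (LINT x:I2|lborel. cmod (v x - g x))"
    unfolding set_lebesgue_integral_def by (intro Bochner_Integration.integral_nonneg) simp
  ultimately have "(LINT x:I2|lborel. cmod (v x - g x)) = 0" by simp
  then have "AE x in lborel. indicator I2 x *\<^sub>R cmod (v x - g x) = 0"
    using vgi unfolding set_lebesgue_integral_def set_integrable_def
    by (subst (asm) integral_nonneg_eq_0_iff_AE) auto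
  then have "AE x in lborel. x \<in> I2 \<longrightarrow> v x = g x" by eventually_elim auto
  then show ?thesis using qp continuous_on_subset[OF gc, of I2] by (intro exI[of _ g]) auto
qed

theorem theorem2p1:
  fixes \<theta> :: real and n :: nat and \<alpha> :: "nat \<Rightarrow> int" and p q :: int
    and u0 v :: "real \<Rightarrow> complex"
  assumes "0 < \<theta>" and "\<theta> < 1"
    and "n \<ge> 3" and "\<alpha> n \<noteq> 0"
    and "p > 0" and "q > 0" and "coprime p q"
    and "L2_0_2pi u0"
    and "QP_solution_at \<alpha> n \<theta> u0 (2*pi*real_of_int p / real_of_int q) v"
  shows "(\<theta> \<in> \<rat> \<longrightarrow>
            (\<exists>(N::nat) (c::nat \<Rightarrow> complex) (\<sigma>::nat \<Rightarrow> real).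
               AE x in lborel. x \<in> {0..2*pi} \<longrightarrow>
                 v x = exp (\<i> * complex_of_real (\<theta> * x)) *
                   (\<Sum>j=1..N. c j * per_ext (\<lambda>y. exp (- \<i> * complex_of_real (\<theta> * y)) * u0 y) (x - \<sigma> j))))
       \<and> (\<theta> \<notin> \<rat> \<and> bounded_variation_on u0 0 (2*pi) \<longrightarrow>
            (\<exists>g. continuous_on {0..2*pi} g \<and>
                 (AE x in lborel. x \<in> {0..2*pi} \<longrightarrow> v x = g x) \<and>
                 exp (\<i> * complex_of_real (2*pi*\<theta>)) * g 0 = g (2*pi)))"
proof -
  have "exp (\<i> * complex_of_real t) = cis t" "exp (- \<i> * complex_of_real t) = cis (- t)" for t
    by (simp_all add: cis_conv_exp)
  then show ?thesis
    using rational_revival[OF _ assms(6,8,9)] irrational_continuity[OF assms(1,2) _ assms(3-6,8) _ assms(9)]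
    by (simp only: minus_mult_left) blast
qed

end
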